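(* The Fisher information matrix of $\psi=(\theta,\alpha^{2})$ contained in $\mathbf Z$ is $$I_N(\psi)=\begin{pmatrix} d_N/\alpha^{2} & 0\\ 0 & N/(2\alpha^{4})\end{pmatrix}.$$ Consequently: (i) $\theta$ and $\alpha^{2}$ are orthogonal parameters (the off-diagonal entry of $I_N(\psi)$ vanishes); (ii) $\mathrm{Var}(\widehat\theta)=\alpha^{2}/d_N$, so $\widehat\theta$ attains the Cramér–Rao bound for unbiased estimation of $\theta$ at every sample size $N\ge2$; (iii) for $N\ge2$, the Cramér–Rao bound for unbiased estimation of $\alpha^{2}$ is $2\alpha^{4}/N$; it is attained by no unbiased estimator of $\alpha^2$, and the variance of the uniformly minimum variance unbiased estimator $\widetilde\alpha^{\,2}=\frac{N}{N-1}\widehat\alpha^{\,2}$ exceeds it by the factor $N/(N-1)$, which tends to $1$ as $N\to\infty$.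
   Context: Fix a mesh $h>0$, an integer $m\ge1$ and known Hurst parameters $H_1,\dots,H_m\in(1/2,1)$. Let $B^{H_1},\dots,B^{H_m}$ be independent fractional Brownian motions, i.e. independent centred continuous Gaussian processes with $B^{H_r}(0)=0$ and $\mathbb E[B^{H_r}(t)B^{H_r}(s)]=\frac12(t^{2H_r}+s^{2H_r}-|t-s|^{2H_r})$ for $s,t\ge0$. For unknown $\theta\in\mathbb R$ and $\alpha>0$ set $Z(t)=\theta t+\alpha\sum_{r=1}^m B^{H_r}(t)$, $t_k=kh$, $\mathbf T=(t_1,\dots,t_N)^\top$, $\mathbf Z=(Z(t_1),\dots,Z(t_N))^\top$. Let $\Gamma_H=\sum_{r=1}^m\Gamma_{H_r}$ be the $N\times N$ positive definite matrix with $(\Gamma_{H_r})_{ij}=\frac12(t_i^{2H_r}+t_j^{2H_r}-|t_i-t_j|^{2H_r})$. The statistical model is the family of laws $\mathbf Z\sim\mathcal N(\theta\mathbf T,\alpha^2\Gamma_H)$ indexed by $(\theta,\alpha^2)\in\mathbb R\times(0,\infty)$. Put $d_N=\mathbf T^\top\Gamma_H^{-1}\mathbf T>0$ and $$\widehat\theta=\frac{\mathbf T^\top\Gamma_H^{-1}\mathbf Z}{d_N},\qquad \widehat\alpha^{\,2}=\frac1N\left(\mathbf Z^\top\Gamma_H^{-1}\mathbf Z-\frac{(\mathbf T^\top\Gamma_H^{-1}\mathbf Z)^2}{d_N}\right).$$ The Cramér–Rao bound for unbiased estimation of the $i$-th component of $\psi$ is the $i$-th diagonal entry of $I_N(\psi)^{-1}$.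 *)

theory Defs
  imports "HOL-Probability.Probability" "Jordan_Normal_Form.Gauss_Jordan_Elimination"
    "Jordan_Normal_Form.Determinant"
begin

unbundle no vec_syntax and no inner_syntax

hide_const (open) Finite_Cartesian_Product.vec Determinants.det
hide_type (open) Finite_Cartesian_Product.vec

section \<open>Fractional Brownian motion\<close>

text \<open>The one-dimensional normal law; \<open>\<sigma> = 0\<close> is the degenerate case.\<close>

definition normal_law :: "real \<Rightarrow> real \<Rightarrow> real measure" where
  "normal_law \<mu> \<sigma> =
     (if \<sigma> = 0 then return borel \<mu> else density lborel (\<lambda>x. ennreal (normal_density \<mu> \<sigma> x)))"

definition gaussian_process :: "'w measure \<Rightarrow> 't set \<Rightarrow> ('t \<Rightarrow> 'w \<Rightarrow> real) \<Rightarrow> bool" where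
  "gaussian_process M I X \<longleftrightarrow>
     (\<forall>t\<in>I. X t \<in> borel_measurable M) \<and>
     (\<forall>F c. finite F \<and> F \<subseteq> I \<longrightarrow>
        (\<exists>\<mu> \<sigma>. 0 \<le> \<sigma> \<and> distr M borel (\<lambda>\<omega>. \<Sum>t\<in>F. c t * X t \<omega>) = normal_law \<mu> \<sigma>))"

definition fbm_cov :: "real \<Rightarrow> real \<Rightarrow> real \<Rightarrow> real" where
  "fbm_cov H s t = (s powr (2 * H) + t powr (2 * H) - \<bar>s - t\<bar> powr (2 * H)) / 2"

text \<open>The sample-path conditions are only required almost surely; this includes the
  version of the definition in which they hold everywhere.\<close>

definition fractional_brownian_motion ::
  "'w measure \<Rightarrow> real \<Rightarrow> (real \<Rightarrow> 'w \<Rightarrow> real) \<Rightarrow> bool" where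
  "fractional_brownian_motion M H X \<longleftrightarrow>
     gaussian_process M {0..} X \<and>
     (AE \<omega> in M. X 0 \<omega> = 0) \<and>
     (AE \<omega> in M. continuous_on {0..} (\<lambda>t. X t \<omega>)) \<and>
     (\<forall>t\<ge>0. prob_space.expectation M (X t) = 0) \<and>
     (\<forall>s\<ge>0. \<forall>t\<ge>0. prob_space.expectation M (\<lambda>\<omega>. X t \<omega> * X s \<omega>) = fbm_cov H t s)"

text \<open>Independence of the processes as random elements of \<open>\<real>\<close> to the power \<open>[0,\<infinity>)\<close>
  with its product sigma-algebra.\<close>

definition independent_processes ::
  "'w measure \<Rightarrow> 'i set \<Rightarrow> ('i \<Rightarrow> real \<Rightarrow> 'w \<Rightarrow> real) \<Rightarrow> bool" where
  "independent_processes M R B \<longleftrightarrow>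
     prob_space.indep_vars M (\<lambda>_. \<Pi>\<^sub>M t\<in>{0::real..}. borel) (\<lambda>r \<omega>. \<lambda>t\<in>{0..}. B r t \<omega>) R"


section \<open>Parametric models, Fisher information and unbiased estimation\<close>

text \<open>A parameter \<open>\<psi>\<close> is a real vector; \<open>P \<psi>\<close> is a law on the sample space and \<open>p \<psi>\<close> a version
  of its density with respect to a fixed dominating measure. The score is the partial derivative
  of the log-density with respect to the \<open>i\<close>-th component of \<open>\<psi>\<close>.\<close>

definition log_density_section ::
  "(real vec \<Rightarrow> 'z \<Rightarrow> real) \<Rightarrow> real vec \<Rightarrow> nat \<Rightarrow> 'z \<Rightarrow> real \<Rightarrow> real" where
  "log_density_section p \<psi> i z x = ln (p (vec (dim_vec \<psi>) (\<lambda>j. if j = i then x else \<psi> $ j)) z)"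

definition score :: "(real vec \<Rightarrow> 'z \<Rightarrow> real) \<Rightarrow> real vec \<Rightarrow> nat \<Rightarrow> 'z \<Rightarrow> real" where
  "score p \<psi> i z = deriv (log_density_section p \<psi> i z) (\<psi> $ i)"

definition fisher_information ::
  "(real vec \<Rightarrow> 'z measure) \<Rightarrow> (real vec \<Rightarrow> 'z \<Rightarrow> real) \<Rightarrow> real vec \<Rightarrow> real mat" where
  "fisher_information P p \<psi> =
     mat (dim_vec \<psi>) (dim_vec \<psi>) (\<lambda>(i, j). \<integral>z. score p \<psi> i z * score p \<psi> j z \<partial>P \<psi>)"

text \<open>Since \<^const>\<open>deriv\<close> and the Bochner integral are total functions, the following
  predicate records that the Fisher information is really defined at \<open>\<psi>\<close>.\<close>

definition fisher_information_exists ::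
  "(real vec \<Rightarrow> 'z measure) \<Rightarrow> (real vec \<Rightarrow> 'z \<Rightarrow> real) \<Rightarrow> real vec \<Rightarrow> bool" where
  "fisher_information_exists P p \<psi> \<longleftrightarrow>
     (\<forall>z\<in>space (P \<psi>). 0 < p \<psi> z \<and>
        (\<forall>i<dim_vec \<psi>. log_density_section p \<psi> i z field_differentiable at (\<psi> $ i))) \<and>
     (\<forall>i<dim_vec \<psi>. \<forall>j<dim_vec \<psi>. integrable (P \<psi>) (\<lambda>z. score p \<psi> i z * score p \<psi> j z))"

definition cramer_rao_bound ::
  "(real vec \<Rightarrow> 'z measure) \<Rightarrow> (real vec \<Rightarrow> 'z \<Rightarrow> real) \<Rightarrow> real vec \<Rightarrow> nat \<Rightarrow> real" where
  "cramer_rao_bound P p \<psi> i = the (mat_inverse (fisher_information P p \<psi>)) $$ (i, i)"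

definition unbiased_estimator ::
  "real vec set \<Rightarrow> (real vec \<Rightarrow> 'z measure) \<Rightarrow> (real vec \<Rightarrow> real) \<Rightarrow> ('z \<Rightarrow> real) \<Rightarrow> bool" where
  "unbiased_estimator \<Theta> P g S \<longleftrightarrow>
     (\<forall>\<psi>\<in>\<Theta>. integrable (P \<psi>) S \<and> prob_space.expectation (P \<psi>) S = g \<psi>)"

definition finite_variance :: "'z measure \<Rightarrow> ('z \<Rightarrow> real) \<Rightarrow> bool" where
  "finite_variance Q S \<longleftrightarrow> integrable Q S \<and> integrable Q (\<lambda>z. (S z)\<^sup>2)"

text \<open>\<open>S\<close> attains at the parameter point \<open>\<psi>\<close> the bound for unbiased estimation (over all
  of \<open>\<Theta>\<close>) of the \<open>i\<close>-th component.\<close>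

definition attains_cramer_rao_at ::
  "real vec set \<Rightarrow> (real vec \<Rightarrow> 'z measure) \<Rightarrow> (real vec \<Rightarrow> 'z \<Rightarrow> real) \<Rightarrow> nat \<Rightarrow>
     ('z \<Rightarrow> real) \<Rightarrow> real vec \<Rightarrow> bool" where
  "attains_cramer_rao_at \<Theta> P p i S \<psi> \<longleftrightarrow>
     unbiased_estimator \<Theta> P (\<lambda>\<psi>. \<psi> $ i) S \<and> finite_variance (P \<psi>) S \<and>
     prob_space.variance (P \<psi>) S = cramer_rao_bound P p \<psi> i"

text \<open>A competitor is unbiased on all of \<open>\<Theta>\<close>, but may have infinite variance at some parameter
  points; there it is not a competitor.\<close>

definition umvu_estimator ::
  "real vec set \<Rightarrow> (real vec \<Rightarrow> 'z measure) \<Rightarrow> (real vec \<Rightarrow> real) \<Rightarrow> ('z \<Rightarrow> real) \<Rightarrow> bool" where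
  "umvu_estimator \<Theta> P g S \<longleftrightarrow>
     unbiased_estimator \<Theta> P g S \<and>
     (\<forall>\<psi>\<in>\<Theta>. finite_variance (P \<psi>) S \<and>
        (\<forall>S'. unbiased_estimator \<Theta> P g S' \<and> finite_variance (P \<psi>) S' \<longrightarrow>
           prob_space.variance (P \<psi>) S \<le> prob_space.variance (P \<psi>) S'))"


section \<open>The observed process and its model\<close>

text \<open>Parameters are \<open>\<psi> = (\<theta>, \<alpha>\<^sup>2)\<close>. Components \<open>k = 1, \<dots>, N\<close> of vectors and
  matrices carry the indices \<open>0, \<dots>, N - 1\<close>; samples are functions on \<open>{..<N}\<close>.\<close>

definition params :: "real vec set" where
  "params = {vec_of_list [\<theta>, v] | \<theta> v. v > 0}"

definition obs_time :: "real \<Rightarrow> nat \<Rightarrow> real" where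
  "obs_time h i = real (Suc i) * h"

definition time_vec :: "real \<Rightarrow> nat \<Rightarrow> real vec" where
  "time_vec h N = vec N (obs_time h)"

definition Gamma_mat :: "(nat \<Rightarrow> real) \<Rightarrow> nat \<Rightarrow> real \<Rightarrow> nat \<Rightarrow> real mat" where
  "Gamma_mat H m h N =
     mat N N (\<lambda>(i, j). \<Sum>r = 1..m. fbm_cov (H r) (obs_time h i) (obs_time h j))"

definition Gamma_inv :: "(nat \<Rightarrow> real) \<Rightarrow> nat \<Rightarrow> real \<Rightarrow> nat \<Rightarrow> real mat" where
  "Gamma_inv H m h N = the (mat_inverse (Gamma_mat H m h N))"

definition Z_process ::
  "(nat \<Rightarrow> real \<Rightarrow> 'w \<Rightarrow> real) \<Rightarrow> nat \<Rightarrow> real \<Rightarrow> real \<Rightarrow> real \<Rightarrow> 'w \<Rightarrow> real" where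
  "Z_process B m \<theta> \<alpha> t \<omega> = \<theta> * t + \<alpha> * (\<Sum>r = 1..m. B r t \<omega>)"

definition sample_space :: "nat \<Rightarrow> (nat \<Rightarrow> real) measure" where
  "sample_space N = (\<Pi>\<^sub>M i\<in>{..<N}. lborel)"

definition Z_law ::
  "'w measure \<Rightarrow> (nat \<Rightarrow> real \<Rightarrow> 'w \<Rightarrow> real) \<Rightarrow> nat \<Rightarrow> real \<Rightarrow> nat \<Rightarrow> real vec \<Rightarrow> (nat \<Rightarrow> real) measure" where
  "Z_law M B m h N \<psi> =
     distr M (sample_space N)
       (\<lambda>\<omega>. \<lambda>i\<in>{..<N}. Z_process B m (\<psi> $ 0) (sqrt (\<psi> $ 1)) (obs_time h i) \<omega>)"

definition mvn_density :: "nat \<Rightarrow> real vec \<Rightarrow> real mat \<Rightarrow> (nat \<Rightarrow> real) \<Rightarrow> real" where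
  "mvn_density N \<mu> \<Sigma> z =
     exp (- ((vec N z - \<mu>) \<bullet> (the (mat_inverse \<Sigma>) *\<^sub>v (vec N z - \<mu>))) / 2) /
     sqrt ((2 * pi) ^ N * det \<Sigma>)"

definition Z_density ::
  "(nat \<Rightarrow> real) \<Rightarrow> nat \<Rightarrow> real \<Rightarrow> nat \<Rightarrow> real vec \<Rightarrow> (nat \<Rightarrow> real) \<Rightarrow> real" where
  "Z_density H m h N \<psi> =
     mvn_density N (\<psi> $ 0 \<cdot>\<^sub>v time_vec h N) (\<psi> $ 1 \<cdot>\<^sub>m Gamma_mat H m h N)"

definition d_coeff :: "(nat \<Rightarrow> real) \<Rightarrow> nat \<Rightarrow> real \<Rightarrow> nat \<Rightarrow> real" where
  "d_coeff H m h N = time_vec h N \<bullet> (Gamma_inv H m h N *\<^sub>v time_vec h N)"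

definition theta_hat :: "(nat \<Rightarrow> real) \<Rightarrow> nat \<Rightarrow> real \<Rightarrow> nat \<Rightarrow> (nat \<Rightarrow> real) \<Rightarrow> real" where
  "theta_hat H m h N z =
     (time_vec h N \<bullet> (Gamma_inv H m h N *\<^sub>v vec N z)) / d_coeff H m h N"

definition alpha2_hat :: "(nat \<Rightarrow> real) \<Rightarrow> nat \<Rightarrow> real \<Rightarrow> nat \<Rightarrow> (nat \<Rightarrow> real) \<Rightarrow> real" where
  "alpha2_hat H m h N z =
     (1 / real N) *
       (vec N z \<bullet> (Gamma_inv H m h N *\<^sub>v vec N z)
        - (time_vec h N \<bullet> (Gamma_inv H m h N *\<^sub>v vec N z))\<^sup>2 / d_coeff H m h N)"

definition alpha2_tilde :: "(nat \<Rightarrow> real) \<Rightarrow> nat \<Rightarrow> real \<Rightarrow> nat \<Rightarrow> (nat \<Rightarrow> real) \<Rightarrow> real" where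
  "alpha2_tilde H m h N z = real N / (real N - 1) * alpha2_hat H m h N z"

end

(* The components of fractional Brownian motion have the spectral representation
   t^(2H) = const * int_0^oo (1 - cos (t x)) x^(-2H-1) dx, so the covariance form of a nonzero
   coefficient vector is the weighted L2-norm of a nonzero trigonometric polynomial and Gamma_H is
   positive definite.  Write Gamma_H = A A^T with T a positive multiple c of the first column of A
   (a Cholesky factor followed by a Householder reflection).  By uniqueness of characteristic
   functions, Z has the law of theta T + alpha A W with W standard normal, so in the coordinates
   y = A^(-1) Z the model is y_0 ~ N(theta c, alpha^2), y_k ~ N(0, alpha^2), all independent, with
   c^2 = d_N; every moment needed is one of a standard normal vector.  An unbiased estimator U of
   zero satisfies E U = 0 for all parameters of a full exponential family; differentiating in the
   natural parameters gives E[U |y|^2] = E[U y_0^2] = 0, hence U is uncorrelated with the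
   corrected variance estimator |y|^2 - y_0^2 up to scale, which is therefore UMVU.  Since its
   variance exceeds the Cramer-Rao bound, no unbiased estimator attains that bound. *)

theory Submission
  imports Defs "HOL-Real_Asymp.Real_Asymp"
begin

text \<open>Two obstacles shape the proof. First, Gaussianity is given only for one-dimensional
  combinations, with unspecified mean and variance, so the law of the vector has to be rebuilt from
  cosine integrals; real cosines with a phase replace complex exponentials because
  \<open>1 + cos\<close> can serve as the weight of a measure. Second, no moment of an unbiased
  estimator beyond integrability may be assumed when differentiating under the integral. The
  dominating functions come from unbiasedness at neighbouring parameters, whose densities are
  exponential tilts of the one at hand; this is where unbiasedness on all of \<open>params\<close>
  enters, while finite variance is used only at the point where variances are compared. Two square
  roots of the covariance occur. The triangular one admits a change of variables coordinate by
  coordinate and so gives the density; the rotated one confines the drift to a single coordinate.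
  They describe the same law because only \<open>A A^T\<close> enters the characteristic
  function.\<close>

subsection \<open>Uniqueness of characteristic functions on finite products\<close>


text \<open>Product-to-sum: a cosine integrated against the weight \<open>1 + cos\<close> is again a
  combination of integrals of single cosines, to which an induction hypothesis about cosines
  applies.\<close>

lemma cos_weight:
  "p * (1 + cos a) * cos b = p * cos b + 1/2 * (p * cos (a + b)) + 1/2 * (p * cos (a - b))" for p a b :: real
  by (simp add: cos_add cos_diff algebra_simps)

text \<open>Dividing the weights by their common mass \<open>a\<close> gives probability measures,
  to which Levy's theorem applies; the phases 0 and -pi/2 in \<open>eq\<close> supply the real and
  imaginary parts of the characteristic functions.\<close>

lemma weighted_law_eqI:
  fixes X :: "'a \<Rightarrow> real" and Y :: "'b \<Rightarrow> real"
  assumes [measurable]: "X \<in> borel_measurable M" "Y \<in> borel_measurable N"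
    and g: "integrable M g" "\<And>x. 0 \<le> g x" and g': "integrable N g'" "\<And>x. 0 \<le> g' x"
    and eq: "\<And>t \<psi>. (\<integral>x. g x * cos (t * X x + \<psi>) \<partial>M) = (\<integral>x. g' x * cos (t * Y x + \<psi>) \<partial>N)"
    and [measurable]: "A \<in> sets borel"
  shows "(\<integral>x. g x * indicator A (X x) \<partial>M) = (\<integral>x. g' x * indicator A (Y x) \<partial>N)"
proof -
  note [measurable] = borel_measurable_integrable[OF g(1)] borel_measurable_integrable[OF g'(1)]
  define a where "a = (\<integral>x. g x \<partial>M)"
  \<comment> \<open>Frequency and phase 0 make the cosine 1, so both weights have the same total
    mass.\<close>
  have a': "a = (\<integral>x. g' x \<partial>N)"
    using eq[of 0 0] by (simp add: a_def)
  have a0: "a \<ge> 0"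
    unfolding a_def using g(2) by simp
  show ?thesis
  proof (cases "a = 0")
    case True
    have "AE x in M. g x = 0"
      using integral_nonneg_eq_0_iff_AE[OF g(1)] g(2) True by (simp add: a_def)
    then have 1: "(\<integral>x. g x * indicator A (X x) \<partial>M) = 0"
      by (intro integral_eq_zero_AE) auto
    have "AE x in N. g' x = 0"
      using integral_nonneg_eq_0_iff_AE[OF g'(1)] g'(2) True a' by simp
    then have 2: "(\<integral>x. g' x * indicator A (Y x) \<partial>N) = 0"
      by (intro integral_eq_zero_AE) auto
    show ?thesis using 1 2 by simp
  next
    case False
    then have a: "a > 0" using a0 by simp
    have gen: "real_distribution (distr (density K (\<lambda>x. ennreal (f x / a))) borel Z)"
      "char (distr (density K (\<lambda>x. ennreal (f x / a))) borel Z) t =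
         Complex ((\<integral>x. f x * cos (t * Z x + 0) \<partial>K) / a) ((\<integral>x. f x * cos (t * Z x + (- (pi/2))) \<partial>K) / a)"
      "measure (distr (density K (\<lambda>x. ennreal (f x / a))) borel Z) A = (\<integral>x. f x * indicator A (Z x) \<partial>K) / a"
      if f: "integrable K f" "\<And>x. 0 \<le> f x" "(\<integral>x. f x \<partial>K) = a" and [measurable]: "Z \<in> borel_measurable K"
      for K :: "'c measure" and f Z t
    proof -
      note [measurable] = borel_measurable_integrable[OF f(1)]
      let ?D = "density K (\<lambda>x. ennreal (f x / a))"
      have "emeasure ?D (space ?D) = (\<integral>\<^sup>+x. ennreal (f x / a) \<partial>K)"
        by (simp add: emeasure_density cong: nn_integral_cong)
      also have "\<dots> = ennreal (\<integral>x. f x / a \<partial>K)"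
        using f a by (intro nn_integral_eq_integral) auto
      also have "\<dots> = 1" using f a by simp
      finally have D: "prob_space ?D" by (rule prob_spaceI)
      then interpret D: prob_space ?D .
      show "real_distribution (distr ?D borel Z)"
        by (intro D.real_distribution_distr) simp
      have int: "integrable K (\<lambda>x. f x * cos (t * Z x + \<psi>))" for \<psi>
        by (rule Bochner_Integration.integrable_bound[OF f(1)])
           (auto simp: abs_mult intro!: AE_I2 mult_left_le)
      have "char (distr ?D borel Z) t = (\<integral>x. (f x / a) *\<^sub>R iexp (t * Z x) \<partial>K)"
        unfolding char_def using f(2) a
        by (subst integral_distr) (auto simp: integral_density simp del: of_real_mult)
      also have "\<dots> = (\<integral>x. complex_of_real (f x * cos (t * Z x + 0) / a)
                       + \<i> * complex_of_real (f x * cos (t * Z x + (- (pi/2))) / a) \<partial>K)"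
        by (intro Bochner_Integration.integral_cong refl)
           (auto simp: complex_eq_iff Re_exp Im_exp cos_diff)
      also have "\<dots> = complex_of_real (\<integral>x. f x * cos (t * Z x + 0) / a \<partial>K)
                       + \<i> * complex_of_real (\<integral>x. f x * cos (t * Z x + (- (pi/2))) / a \<partial>K)"
        using int[of 0] int[of "- (pi/2)"]
        by (subst Bochner_Integration.integral_add)
           (simp_all only: integral_complex_of_real integral_mult_right_zero
              integrable_mult_right integrable_divide integrable_of_real)
      finally show "char (distr ?D borel Z) t =
         Complex ((\<integral>x. f x * cos (t * Z x + 0) \<partial>K) / a) ((\<integral>x. f x * cos (t * Z x + (- (pi/2))) \<partial>K) / a)"
        by (simp add: Complex_eq)
      have "measure (distr ?D borel Z) A = (\<integral>x. indicator A x \<partial>distr ?D borel Z)"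
        by simp
      also have "\<dots> = (\<integral>x. f x / a * indicator A (Z x) \<partial>K)"
        using f(2) a by (subst integral_distr) (auto simp: integral_density)
      finally show "measure (distr ?D borel Z) A = (\<integral>x. f x * indicator A (Z x) \<partial>K) / a"
        by simp
    qed
    let ?D1 = "distr (density M (\<lambda>x. ennreal (g x / a))) borel X"
    let ?D2 = "distr (density N (\<lambda>x. ennreal (g' x / a))) borel Y"
    have "char ?D1 = char ?D2"
    proof
      fix t
      show "char ?D1 t = char ?D2 t"
        unfolding gen(2)[OF g a_def[symmetric] assms(1)] gen(2)[OF g' a'[symmetric] assms(2)] eq ..
    qed
    then have "?D1 = ?D2"
      by (intro Levy_uniqueness gen(1)) (use g g' a_def a' in auto)
    then have "measure ?D1 A = measure ?D2 A" by simp
    then show ?thesis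
      using gen(3)[OF g, of X] gen(3)[OF g', of Y] a a' a_def by simp
  qed
qed

text \<open>Levy's theorem only covers real measures. Coordinates are therefore replaced by indicators
  one at a time: the weight \<open>1 + cos\<close> is nonnegative, so the weighted law of the next coordinate is
  a finite measure on the reals, and its characteristic function is known by induction.\<close>

theorem PiM_borel_eqI_cos:
  fixes \<mu> \<nu> :: "('i \<Rightarrow> real) measure"
  assumes I: "finite I" and "prob_space \<mu>" "prob_space \<nu>"
    and sets: "sets \<mu> = sets (\<Pi>\<^sub>M i\<in>I. borel)" "sets \<nu> = sets (\<Pi>\<^sub>M i\<in>I. borel)"
    and eq: "\<And>c \<phi>. (\<integral>w. cos ((\<Sum>i\<in>I. c i * w i) + \<phi>) \<partial>\<mu>) = (\<integral>w. cos ((\<Sum>i\<in>I. c i * w i) + \<phi>) \<partial>\<nu>)"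
  shows "\<mu> = \<nu>"
proof -
  interpret \<mu>: prob_space \<mu> by fact
  interpret \<nu>: prob_space \<nu> by fact
  note [measurable_cong] = sets
  \<comment> \<open>The cosine keeps running over all of \<open>I\<close> while only the coordinates
    in \<open>J\<close> carry indicators. The frequency of the next coordinate can therefore still
    be varied freely.\<close>
  have main: "(\<integral>w. (\<Prod>j\<in>J. indicator (A j) (w j)) * cos ((\<Sum>i\<in>I. c i * w i) + \<phi>) \<partial>\<mu>) =
        (\<integral>w. (\<Prod>j\<in>J. indicator (A j) (w j)) * cos ((\<Sum>i\<in>I. c i * w i) + \<phi>) \<partial>\<nu>)"
    if "J \<subseteq> I" and A: "\<And>j. j \<in> J \<Longrightarrow> A j \<in> sets borel" for J A c \<phi>
    using finite_subset[OF that(1) I] that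
  proof (induction J arbitrary: c \<phi> rule: finite_induct)
    case empty
    then show ?case using eq by simp
  next
    case (insert k J)
    let ?P = "\<lambda>w :: 'i \<Rightarrow> real. \<Prod>j\<in>J. indicator (A j) (w j) :: real"
    let ?y = "\<lambda>c w :: 'i \<Rightarrow> real. \<Sum>i\<in>I. c i * w i"
    have J[measurable]: "\<And>j. j \<in> J \<Longrightarrow> A j \<in> sets borel" and k[measurable]: "A k \<in> sets borel"
      and JI: "J \<subseteq> I" "k \<in> I"
      using insert by auto
    have [measurable]: "?P \<in> borel_measurable \<mu>" "?P \<in> borel_measurable \<nu>"
      using JI by (auto intro!: borel_measurable_prod)
    have [measurable]: "(\<lambda>w. w k) \<in> borel_measurable \<mu>" "(\<lambda>w. w k) \<in> borel_measurable \<nu>"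
      using JI by auto
    have comp: "(\<lambda>w. w i) \<in> borel_measurable \<mu>" "(\<lambda>w. w i) \<in> borel_measurable \<nu>" if "i \<in> I" for i
      using that by (simp_all add: measurable_cong_sets[OF sets(1) refl] measurable_cong_sets[OF sets(2) refl])
    have [measurable]: "?y c \<in> borel_measurable \<mu>" "?y c \<in> borel_measurable \<nu>" for c
      by (auto intro!: borel_measurable_sum borel_measurable_times comp)
    have P: "0 \<le> ?P w" "?P w \<le> 1" for w
      by (auto intro!: prod_nonneg prod_le_1 simp: indicator_def)
    have IH: "(\<integral>w. ?P w * cos (?y c w + \<phi>) \<partial>\<mu>) = (\<integral>w. ?P w * cos (?y c w + \<phi>) \<partial>\<nu>)" for c \<phi>
      using insert.IH[of c \<phi>] JI J by simp
    have bound: "integrable \<mu> f" if "f \<in> borel_measurable \<mu>" "\<And>w. \<bar>f w\<bar> \<le> 2" for f :: "_ \<Rightarrow> real"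
      using that by (intro \<mu>.integrable_const_bound[of _ 2]) auto
    have bound': "integrable \<nu> f" if "f \<in> borel_measurable \<nu>" "\<And>w. \<bar>f w\<bar> \<le> 2" for f :: "_ \<Rightarrow> real"
      using that by (intro \<nu>.integrable_const_bound[of _ 2]) auto
    have Pcos: "\<bar>?P w * cos x\<bar> \<le> 2" "\<bar>?P w * (1 + cos x)\<bar> \<le> 2" for w x
    proof -
      have "\<bar>?P w * cos x\<bar> \<le> 1 * 1"
        unfolding abs_mult by (rule mult_mono) (use P in auto)
      then show "\<bar>?P w * cos x\<bar> \<le> 2" by simp
      have "\<bar>1 + cos x\<bar> \<le> 2"
        using cos_ge_minus_one[of x] cos_le_one[of x] unfolding abs_le_iff by linarith
      then have "\<bar>?P w * (1 + cos x)\<bar> \<le> 1 * 2"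
        unfolding abs_mult by (intro mult_mono) (use P in auto)
      then show "\<bar>?P w * (1 + cos x)\<bar> \<le> 2" by simp
    qed
    \<comment> \<open>A single coordinate is written as a linear form over \<open>I\<close>, the
      shape in which the induction hypothesis is available.\<close>
    have shift: "t * w k + x = ?y (\<lambda>i. if i = k then t else 0) w + x" for t x and w :: "'i \<Rightarrow> real"
      using JI I by (simp add: if_distrib[of "\<lambda>z. z * _"] sum.delta cong: if_cong)
    have int: "integrable \<mu> (\<lambda>w. ?P w * cos (?y c w + \<phi>))" for c \<phi>
      by (rule bound[OF _ Pcos(1)]) simp
    have int': "integrable \<nu> (\<lambda>w. ?P w * cos (?y c w + \<phi>))" for c \<phi>
      by (rule bound'[OF _ Pcos(1)]) simp
    have prodcos: "?P w * (1 + cos (?y c w + \<phi>)) * cos (t * w k + \<psi>) =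
        ?P w * cos (?y (\<lambda>i. if i = k then t else 0) w + \<psi>)
        + 1/2 * (?P w * cos (?y (\<lambda>i. c i + (if i = k then t else 0)) w + (\<phi> + \<psi>)))
        + 1/2 * (?P w * cos (?y (\<lambda>i. c i - (if i = k then t else 0)) w + (\<phi> - \<psi>)))" for w c \<phi> t \<psi>
    proof -
      have "?P w * (1 + cos (?y c w + \<phi>)) * cos (t * w k + \<psi>)
         = ?P w * cos (t * w k + \<psi>) + 1/2 * (?P w * cos (?y c w + \<phi> + (t * w k + \<psi>)))
           + 1/2 * (?P w * cos (?y c w + \<phi> - (t * w k + \<psi>)))"
        by (rule cos_weight)
      also have "?y c w + \<phi> + (t * w k + \<psi>) = ?y (\<lambda>i. c i + (if i = k then t else 0)) w + (\<phi> + \<psi>)"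
        unfolding shift by (simp add: sum.distrib algebra_simps)
      also have "?y c w + \<phi> - (t * w k + \<psi>) = ?y (\<lambda>i. c i - (if i = k then t else 0)) w + (\<phi> - \<psi>)"
        unfolding shift by (simp add: sum_subtractf algebra_simps)
      finally show ?thesis unfolding shift .
    qed
    have "(\<integral>w. ?P w * (1 + cos (?y c w + \<phi>)) * cos (t * w k + \<psi>) \<partial>\<mu>) =
          (\<integral>w. ?P w * (1 + cos (?y c w + \<phi>)) * cos (t * w k + \<psi>) \<partial>\<nu>)" for c \<phi> t \<psi>
      unfolding prodcos using int int'
      by (simp only: Bochner_Integration.integral_add integral_mult_right_zero
            Bochner_Integration.integrable_add integrable_mult_right IH)
    then have *: "(\<integral>w. ?P w * (1 + cos (?y c w + \<phi>)) * indicator (A k) (w k) \<partial>\<mu>) =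
          (\<integral>w. ?P w * (1 + cos (?y c w + \<phi>)) * indicator (A k) (w k) \<partial>\<nu>)" for c \<phi>
    proof (rule weighted_law_eqI[rotated 6])
      show "integrable \<mu> (\<lambda>w. ?P w * (1 + cos (?y c w + \<phi>)))"
        by (rule bound[OF _ Pcos(2)]) simp
      show "integrable \<nu> (\<lambda>w. ?P w * (1 + cos (?y c w + \<phi>)))"
        by (rule bound'[OF _ Pcos(2)]) simp
      have "0 \<le> 1 + cos x" for x :: real
        using cos_ge_minus_one[of x] by linarith
      then have "0 \<le> ?P w * (1 + cos x)" for w x
        by (intro mult_nonneg_nonneg P(1))
      then show "\<And>w. 0 \<le> ?P w * (1 + cos (?y c w + \<phi>))" "\<And>w. 0 \<le> ?P w * (1 + cos (?y c w + \<phi>))"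
        by this+
    qed (use comp[OF JI(2)] k in simp_all)
    have Pk: "\<bar>indicator (A k) (w k) * (?P w * cos x)\<bar> \<le> 2" "\<bar>indicator (A k) (w k) * ?P w\<bar> \<le> 2" for w x
      using Pcos(1)[of w x] P[of w] by (auto simp: indicator_def)
    have "(\<integral>w. indicator (A k) (w k) * ?P w + indicator (A k) (w k) * (?P w * cos (?y c w + \<phi>)) \<partial>\<mu>) =
          (\<integral>w. indicator (A k) (w k) * ?P w + indicator (A k) (w k) * (?P w * cos (?y c w + \<phi>)) \<partial>\<nu>)" for c \<phi>
      using *[of c \<phi>] by (simp add: algebra_simps)
    then have **: "(\<integral>w. indicator (A k) (w k) * ?P w \<partial>\<mu>) + (\<integral>w. indicator (A k) (w k) * (?P w * cos (?y c w + \<phi>)) \<partial>\<mu>) =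
          (\<integral>w. indicator (A k) (w k) * ?P w \<partial>\<nu>) + (\<integral>w. indicator (A k) (w k) * (?P w * cos (?y c w + \<phi>)) \<partial>\<nu>)" for c \<phi>
      by (subst (asm) (1 2) Bochner_Integration.integral_add)
         (auto intro!: bound bound' Pk)
    \<comment> \<open>For zero frequencies and phase the cosine is 1, so twice this integral agrees
      on both sides; subtracting it then isolates the cosine term.\<close>
    have "(\<integral>w. indicator (A k) (w k) * ?P w \<partial>\<mu>) = (\<integral>w. indicator (A k) (w k) * ?P w \<partial>\<nu>)"
      using **[of "\<lambda>_. 0" 0] by simp
    then have "(\<integral>w. indicator (A k) (w k) * (?P w * cos (?y c w + \<phi>)) \<partial>\<mu>) =
               (\<integral>w. indicator (A k) (w k) * (?P w * cos (?y c w + \<phi>)) \<partial>\<nu>)"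
      using **[of c \<phi>] by simp
    then show ?case
      using insert.hyps by (simp add: mult.assoc)
  qed
  \<comment> \<open>The factor \<open>cos 0\<close> only gives the integrand the form of
    \<open>main\<close> with all coordinates replaced by indicators.\<close>
  have box: "measure K (Pi\<^sub>E I A) = (\<integral>w. (\<Prod>j\<in>I. indicator (A j) (w j)) * cos ((\<Sum>i\<in>I. 0 * w i) + 0) \<partial>K)"
    if K: "sets K = sets (\<Pi>\<^sub>M i\<in>I. borel)" "prob_space K" and A: "\<And>i. i \<in> I \<Longrightarrow> A i \<in> sets borel"
    for K :: "('i \<Rightarrow> real) measure" and A
  proof -
    have spK: "space K = extensional I"
      using sets_eq_imp_space_eq[OF K(1)] by (auto simp: space_PiM PiE_def)
    have "Pi\<^sub>E I A \<in> sets K"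
      using A I K by (auto intro!: sets_PiM_I_finite)
    then have "measure K (Pi\<^sub>E I A) = (\<integral>w. indicator (Pi\<^sub>E I A) w \<partial>K)"
      by simp
    also have "\<dots> = (\<integral>w. (\<Prod>j\<in>I. indicator (A j) (w j)) * cos ((\<Sum>i\<in>I. 0 * w i) + 0) \<partial>K)"
    proof (rule Bochner_Integration.integral_cong[OF refl])
      fix w assume "w \<in> space K"
      then show "indicator (Pi\<^sub>E I A) w = (\<Prod>j\<in>I. indicator (A j) (w j)) * cos ((\<Sum>i\<in>I. 0 * w i) + 0)"
        using I spK by (cases "\<forall>i\<in>I. w i \<in> A i")
          (auto simp: indicator_def PiE_def Pi_iff prod_zero_iff intro!: prod.neutral)
    qed
    finally show ?thesis .
  qed
  show ?thesis
  proof (rule measure_eqI_PiM_finite[OF I sets])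
    fix A :: "'i \<Rightarrow> real set" assume A: "\<And>i. i \<in> I \<Longrightarrow> A i \<in> sets borel"
    show "emeasure \<mu> (Pi\<^sub>E I A) = emeasure \<nu> (Pi\<^sub>E I A)"
      using main[of I A "\<lambda>_. 0" 0] A box[OF sets(1) assms(2) A] box[OF sets(2) assms(3) A]
      by (simp add: \<mu>.emeasure_eq_measure \<nu>.emeasure_eq_measure)
  next
    show "range (\<lambda>_::nat. Pi\<^sub>E I (\<lambda>_. UNIV)) \<subseteq> prod_algebra I (\<lambda>_. borel)"
      by (auto intro!: prod_algebraI_finite I)
    show "(\<Union>i::nat. Pi\<^sub>E I (\<lambda>_. UNIV)) = space (\<Pi>\<^sub>M i\<in>I. borel)"
      by (auto simp: space_PiM)
    show "emeasure \<mu> (Pi\<^sub>E I (\<lambda>_. UNIV)) \<noteq> \<infinity>"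
      by simp
  qed
qed

subsection \<open>Positive definiteness of the covariance of fractional Brownian motion\<close>


text \<open>The spectral density up to a constant factor, kept on the positive half line because the
  integrands are even. The constant is never computed; only its sign is used.\<close>

definition fbm_spectral :: "real \<Rightarrow> real \<Rightarrow> real" where
  "fbm_spectral H x = indicator {0<..} x * x powr (- 2 * H - 1)"

lemma fbm_spectral_nonneg: "0 \<le> fbm_spectral H x"
  by (simp add: fbm_spectral_def)

lemma fbm_spectral_measurable [measurable]: "fbm_spectral H \<in> borel_measurable borel"
  unfolding fbm_spectral_def by measurable

text \<open>The bound 2 controls the spectral integrals at infinity, the bound \<open>x^2\<close>
  near 0.\<close>

lemma one_minus_cos_bounds: "0 \<le> 1 - cos x" "1 - cos x \<le> 2" "1 - cos x \<le> x\<^sup>2" for x :: real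
proof -
  show "0 \<le> 1 - cos x" by simp
  show "1 - cos x \<le> 2" using cos_ge_minus_one[of x] by linarith
  have "1 - cos x = 2 * (sin (x/2))\<^sup>2"
    using cos_double_sin[of "x/2"] by simp
  also have "(sin (x/2))\<^sup>2 \<le> (x/2)\<^sup>2"
    using abs_sin_x_le_abs_x[of "x/2"] by (metis abs_le_square_iff)
  also have "2 * (x/2)\<^sup>2 \<le> x\<^sup>2" by (simp add: power_divide)
  finally show "1 - cos x \<le> x\<^sup>2" by simp
qed

text \<open>Near 0 the integrand is at most \<open>x powr (1 - 2 * H)\<close>, integrable because H
  < 1; beyond 1 it is at most \<open>2 * x powr (- 2 * H - 1)\<close>, integrable because H >
  0.\<close>

lemma integrable_one_minus_cos:
  assumes "0 < H" "H < 1"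
  shows "integrable lborel (\<lambda>x. fbm_spectral H x * (1 - cos x))"
proof -
  have lborel_of_has_integral: "integrable lborel (\<lambda>x. indicator S x * f x)"
    if "(f has_integral I) S" "S \<in> sets borel" "f \<in> borel_measurable borel" "\<And>x. x \<in> S \<Longrightarrow> 0 \<le> f x"
    for f :: "real \<Rightarrow> real" and S I
  proof -
    have "f absolutely_integrable_on S"
      using that by (intro nonnegative_absolutely_integrable_1) (auto simp: integrable_on_def)
    then have "integrable lebesgue (\<lambda>x. indicator S x * f x)"
      by (simp add: set_integrable_def)
    then show ?thesis
      using that by (subst (asm) integrable_completion) auto
  qed
  have 1: "integrable lborel (\<lambda>x. indicator {0..1} x * x powr (1 - 2 * H))"
    using assms by (intro lborel_of_has_integral[OF has_integral_powr_from_0]) auto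
  have 2: "integrable lborel (\<lambda>x. indicator {1..} x * x powr (- 2 * H - 1))"
    using assms by (intro lborel_of_has_integral[OF has_integral_powr_to_inf]) auto
  have "integrable lborel (\<lambda>x. indicator {0..1} x * x powr (1 - 2 * H)
          + 2 * (indicator {1..} x * x powr (- 2 * H - 1)))"
    using 1 2 by (intro Bochner_Integration.integrable_add integrable_mult_right)
  then show ?thesis
  proof (rule Bochner_Integration.integrable_bound, safe intro!: AE_I2)
    fix x :: real
    consider "x \<le> 0" | "0 < x" "x \<le> 1" | "1 < x" by linarith
    then show "norm (fbm_spectral H x * (1 - cos x)) \<le> norm (indicator {0..1} x * x powr (1 - 2 * H)
          + 2 * (indicator {1..} x * x powr (- 2 * H - 1)))"
    proof cases
      case 2
      have "x powr (- 2 * H - 1) * (1 - cos x) \<le> x powr (- 2 * H - 1) * x\<^sup>2"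
        by (intro mult_left_mono one_minus_cos_bounds) auto
      also have "\<dots> = x powr (1 - 2 * H)"
        using 2 powr_add[of x "- 2 * H - 1" 2] by simp
      also have "\<dots> \<le> \<bar>x powr (1 - 2 * H) + 2 * (indicator {1..} x * x powr (- 2 * H - 1))\<bar>"
        by simp
      finally show ?thesis using 2 by (simp add: fbm_spectral_def abs_mult)
    next
      case 3
      have "x powr (- 2 * H - 1) * (1 - cos x) \<le> x powr (- 2 * H - 1) * 2"
        by (intro mult_left_mono one_minus_cos_bounds) auto
      then show ?thesis using 3 by (simp add: fbm_spectral_def abs_mult)
    qed (simp add: fbm_spectral_def)
  qed measurable
qed

text \<open>Substituting \<open>\<bar>t\<bar> * x\<close>: the weight is homogeneous of degree
  \<open>- 2 * H - 1\<close>, and the Jacobian leaves the power \<open>2 * H\<close>.\<close>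

lemma spectral_one_minus_cos_scale:
  assumes "0 < H" "H < 1"
  shows "integrable lborel (\<lambda>x. fbm_spectral H x * (1 - cos (t * x)))"
    and "(\<integral>x. fbm_spectral H x * (1 - cos (t * x)) \<partial>lborel) =
      \<bar>t\<bar> powr (2 * H) * (\<integral>x. fbm_spectral H x * (1 - cos x) \<partial>lborel)"
proof -
  let ?f = "\<lambda>x. fbm_spectral H x * (1 - cos x)"
  have *: "?f (0 + \<bar>t\<bar> * x) = \<bar>t\<bar> powr (- 2 * H - 1) * (fbm_spectral H x * (1 - cos (t * x)))" if "t \<noteq> 0" for x
  proof -
    have "cos (\<bar>t\<bar> * x) = cos (t * x)" by (cases "t \<ge> 0") auto
    moreover have "fbm_spectral H (\<bar>t\<bar> * x) = \<bar>t\<bar> powr (- 2 * H - 1) * fbm_spectral H x"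
      using that by (auto simp: fbm_spectral_def indicator_def zero_less_mult_iff powr_mult)
    ultimately show ?thesis by simp
  qed
  show "integrable lborel (\<lambda>x. fbm_spectral H x * (1 - cos (t * x)))"
  proof (cases "t = 0")
    case False
    then show ?thesis
      using lborel_integrable_real_affine[OF integrable_one_minus_cos[OF assms], of "\<bar>t\<bar>" 0]
      unfolding *[OF False] by simp
  qed simp
  show "(\<integral>x. fbm_spectral H x * (1 - cos (t * x)) \<partial>lborel) =
      \<bar>t\<bar> powr (2 * H) * (\<integral>x. ?f x \<partial>lborel)"
  proof (cases "t = 0")
    case False
    have "(\<integral>x. ?f x \<partial>lborel) = \<bar>t\<bar> * (\<bar>t\<bar> powr (- 2 * H - 1) * (\<integral>x. fbm_spectral H x * (1 - cos (t * x)) \<partial>lborel))"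
      using lborel_integral_real_affine[of "\<bar>t\<bar>" ?f 0] False unfolding *[OF False] by simp
    also have "\<dots> = \<bar>t\<bar> powr (- 2 * H) * (\<integral>x. fbm_spectral H x * (1 - cos (t * x)) \<partial>lborel)"
      using False by (simp add: powr_diff)
    finally show ?thesis
      using False by (simp add: powr_minus field_simps)
  qed simp
qed

theorem fbm_cov_pos_def:
  fixes c :: "nat \<Rightarrow> real"
  assumes H: "0 < H" "H < 1" and h: "h > 0" and k: "k < N" "c k \<noteq> 0"
  shows "0 < (\<Sum>i<N. \<Sum>j<N. c i * c j * fbm_cov H (obs_time h i) (obs_time h j))"
proof -
  let ?t = "obs_time h"
  let ?F = "\<lambda>x. fbm_spectral H x"
  define K where "K = (\<integral>x. ?F x * (1 - cos x) \<partial>lborel)"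
  \<comment> \<open>\<open>P + iQ\<close> is the sum of \<open>c i * (exp(i t_i x) - 1)\<close>. Its
    squared modulus expands through Re((e^(ia) - 1)(e^(-ib) - 1)) = (1 - cos a) + (1 - cos b) - (1 -
    cos(a - b)), the spectral form of \<open>fbm_cov\<close>.\<close>
  define P where "P x = (\<Sum>i<N. c i * (cos (?t i * x) - 1))" for x
  define Q where "Q x = (\<Sum>i<N. c i * sin (?t i * x))" for x
  \<comment> \<open>Weak positivity is enough: once \<open>2 * K\<close> times the covariance form
    is known to be positive, both factors must be.\<close>
  have K0: "K \<ge> 0"
    unfolding K_def by (intro Bochner_Integration.integral_nonneg mult_nonneg_nonneg fbm_spectral_nonneg one_minus_cos_bounds)
  have PQ: "?F x * ((P x)\<^sup>2 + (Q x)\<^sup>2) = (\<Sum>i<N. \<Sum>j<N. c i * c j *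
      (?F x * (1 - cos (?t i * x)) + ?F x * (1 - cos (?t j * x)) - ?F x * (1 - cos ((?t i - ?t j) * x))))" for x
  proof -
    have "(P x)\<^sup>2 + (Q x)\<^sup>2 = (\<Sum>i<N. \<Sum>j<N. (c i * (cos (?t i * x) - 1)) * (c j * (cos (?t j * x) - 1)) +
        (c i * sin (?t i * x)) * (c j * sin (?t j * x)))"
      by (simp only: P_def Q_def power2_eq_square sum_product sum.distrib)
    then show ?thesis
      by (simp only: sum_distrib_left)
         (intro sum.cong refl, simp add: cos_diff left_diff_distrib algebra_simps)
  qed
  have int: "integrable lborel (\<lambda>x. ?F x * ((P x)\<^sup>2 + (Q x)\<^sup>2))"
    unfolding PQ by (intro Bochner_Integration.integrable_sum integrable_mult_right
        Bochner_Integration.integrable_diff Bochner_Integration.integrable_add spectral_one_minus_cos_scale(1)[OF H])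
  have "(\<integral>x. ?F x * ((P x)\<^sup>2 + (Q x)\<^sup>2) \<partial>lborel) = (\<Sum>i<N. \<Sum>j<N. c i * c j *
      (\<bar>?t i\<bar> powr (2 * H) * K + \<bar>?t j\<bar> powr (2 * H) * K - \<bar>?t i - ?t j\<bar> powr (2 * H) * K))"
  proof -
    have I: "has_bochner_integral lborel (\<lambda>x. ?F x * (1 - cos (t * x))) (\<bar>t\<bar> powr (2 * H) * K)" for t
      unfolding has_bochner_integral_iff K_def using spectral_one_minus_cos_scale[OF H] by blast
    show ?thesis
      unfolding PQ
      by (intro has_bochner_integral_integral_eq has_bochner_integral_sum has_bochner_integral_mult_right
          has_bochner_integral_add has_bochner_integral_diff I)
  qed
  also have "\<dots> = 2 * K * (\<Sum>i<N. \<Sum>j<N. c i * c j * fbm_cov H (?t i) (?t j))"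
  proof -
    have t: "\<bar>?t i\<bar> = ?t i" for i
      using h by (simp add: obs_time_def)
    have "x * y * (a * K + b * K - d * K) = 2 * K * (x * y * ((a + b - d) / 2))" for x y a b d :: real
      by (simp add: field_simps)
    then show ?thesis
      unfolding fbm_cov_def sum_distrib_left t by (intro sum.cong refl)
  qed
  finally have eq: "(\<integral>x. ?F x * ((P x)\<^sup>2 + (Q x)\<^sup>2) \<partial>lborel) = 2 * K * (\<Sum>i<N. \<Sum>j<N. c i * c j * fbm_cov H (?t i) (?t j))" .
  have nonneg: "0 \<le> ?F x * ((P x)\<^sup>2 + (Q x)\<^sup>2)" for x
    by (intro mult_nonneg_nonneg fbm_spectral_nonneg) simp
  have "(\<integral>x. ?F x * ((P x)\<^sup>2 + (Q x)\<^sup>2) \<partial>lborel) \<noteq> 0"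
  proof
    assume "(\<integral>x. ?F x * ((P x)\<^sup>2 + (Q x)\<^sup>2) \<partial>lborel) = 0"
    then have ae: "AE x in lborel. ?F x * ((P x)\<^sup>2 + (Q x)\<^sup>2) = 0"
      using integral_nonneg_eq_0_iff_AE[OF int] nonneg by simp
    \<comment> \<open>The equally spaced times \<open>(i + 1) * h\<close> turn the trigonometric sum
      into this polynomial evaluated at \<open>cis (h * x)\<close>. Degree \<open>k + 1\<close>
      carries the coefficient \<open>c k\<close>, so it is not the zero polynomial.\<close>
    define p :: "complex poly" where "p = (\<Sum>i<N. Polynomial.smult (of_real (c i)) (Polynomial.monom 1 (Suc i) - 1))"
    have "Polynomial.coeff p (Suc k) = (\<Sum>i<N. if i = k then of_real (c i) else 0)"
      unfolding p_def Polynomial.coeff_sum by (intro sum.cong) auto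
    also have "\<dots> = of_real (c k)" using k by simp
    finally have "p \<noteq> 0" using k by auto
    then have fin: "finite {z. poly p z = 0}" by (rule poly_roots_finite)
    have root: "poly p (cis (h * x)) = 0" if "x > 0" "?F x * ((P x)\<^sup>2 + (Q x)\<^sup>2) = 0" for x
    proof -
      have "P x = 0" "Q x = 0"
        using that by (auto simp: fbm_spectral_def sum_power2_eq_zero_iff)
      moreover have "cis (h * x) ^ Suc i = cis (?t i * x)" for i
        by (subst Complex.DeMoivre) (simp add: obs_time_def algebra_simps)
      then have "poly p (cis (h * x)) = Complex (P x) (Q x)"
        unfolding p_def P_def Q_def poly_sum
        by (simp add: poly_monom complex_eq_iff del: power_Suc)
      ultimately show ?thesis by (simp add: Complex_eq)
    qed
    \<comment> \<open>On this window \<open>h * x\<close> stays in (0, pi), where the cosine is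
      injective; finitely many roots of \<open>p\<close> thus leave finitely many zeros in the
      window.\<close>
    define S where "S = {x \<in> {0<..<pi / h}. ?F x * ((P x)\<^sup>2 + (Q x)\<^sup>2) = 0}"
    have "inj_on (\<lambda>x. cis (h * x)) S"
    proof (rule inj_onI)
      fix x y assume xy: "x \<in> S" "y \<in> S" "cis (h * x) = cis (h * y)"
      have "0 < z \<and> z < pi / h" if "z \<in> S" for z
        using that unfolding S_def by (simp only: mem_Collect_eq greaterThanLessThan_iff)
      then have "0 < z \<and> z * h < pi" if "z \<in> S" for z
        using that h pos_less_divide_eq[OF h] by blast
      then have *: "0 \<le> h * z" "h * z \<le> pi" if "z \<in> S" for z
        using mult_pos_pos[OF h, of z] less_imp_le that unfolding mult.commute[of h z] by blast+
      have "cos (h * x) = cos (h * y)"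
        using arg_cong[OF xy(3), of Re] unfolding cis.sel .
      then have "h * x = h * y"
        by (rule cos_inj_pi[OF *(1)[OF xy(1)] *(2)[OF xy(1)] *(1)[OF xy(2)] *(2)[OF xy(2)]])
      then show "x = y" using h by simp
    qed
    moreover have "(\<lambda>x. cis (h * x)) ` S \<subseteq> {z. poly p z = 0}"
      using root by (auto simp: S_def)
    ultimately have "finite S"
      using finite_imageD[OF finite_subset[OF _ fin]] by blast
    then have "S \<in> null_sets lborel" by (rule finite_imp_null_set_lborel)
    then have "AE x in lborel. x \<notin> S" by (rule AE_not_in)
    with ae have "AE x in lborel. x \<notin> {0<..<pi / h}"
      by eventually_elim (auto simp: S_def)
    then have "{0<..<pi / h} \<in> null_sets lborel"
      using AE_iff_null_sets[of "{0<..<pi / h}" lborel] by simp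
    then have "emeasure lborel {0<..<pi / h} = 0" by (rule null_setsD1)
    then show False using h by simp
  qed
  then have "0 < (\<integral>x. ?F x * ((P x)\<^sup>2 + (Q x)\<^sup>2) \<partial>lborel)"
    using Bochner_Integration.integral_nonneg[of lborel "\<lambda>x. ?F x * ((P x)\<^sup>2 + (Q x)\<^sup>2)"] nonneg
    by (metis less_eq_real_def)
  then show ?thesis
    unfolding eq using K0 by (simp add: zero_less_mult_iff)
qed

subsection \<open>Triangular images of a standard normal vector\<close>


text \<open>Induction on the size through the Schur complement \<open>G'\<close> of the first coordinate.\<close>

lemma cholesky_exists:
  fixes G :: "nat \<Rightarrow> nat \<Rightarrow> real"
  assumes "\<And>i j. G i j = G j i"
    and "\<And>c k. k < N \<Longrightarrow> c k \<noteq> 0 \<Longrightarrow> 0 < (\<Sum>i<N. \<Sum>j<N. c i * c j * G i j)"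
  shows "\<exists>L. (\<forall>i<N. 0 < L i i) \<and> (\<forall>i j. i < j \<longrightarrow> L i j = 0) \<and>
    (\<forall>i<N. \<forall>j<N. (\<Sum>k<N. L i k * L j k) = G i j)"
  using assms
proof (induction N arbitrary: G)
  case 0
  show ?case by (rule exI[of _ "\<lambda>_ _. 0"]) simp
next
  case (Suc n)
  note sym = Suc.prems(1) and pos = Suc.prems(2)
  have G0: "0 < G 0 0"
    using pos[of 0 "\<lambda>i. if i = 0 then 1 else 0"]
    by (simp add: sum.lessThan_Suc_shift del: sum.lessThan_Suc)
  define G' where "G' i j = G (Suc i) (Suc j) - G (Suc i) 0 * G (Suc j) 0 / G 0 0" for i j
  have pos': "0 < (\<Sum>i<n. \<Sum>j<n. c i * c j * G' i j)" if k: "k < n" "c k \<noteq> 0" for c k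
  proof -
    define s where "s = (\<Sum>i<n. c i * G (Suc i) 0)"
    \<comment> \<open>The first coordinate \<open>- s / G 0 0\<close> minimizes the form of
      \<open>G\<close> over that coordinate; the minimum is the form of the Schur complement at
      \<open>c\<close>.\<close>
    define e where "e = (\<lambda>i. case i of 0 \<Rightarrow> - s / G 0 0 | Suc i \<Rightarrow> c i)"
    have "(\<Sum>i<n. \<Sum>j<n. c i * c j * G' i j) =
        (\<Sum>i<n. \<Sum>j<n. c i * c j * G (Suc i) (Suc j) - (c i * G (Suc i) 0) * (c j * G (Suc j) 0) / G 0 0)"
      by (intro sum.cong refl) (simp add: G'_def algebra_simps)
    also have "\<dots> = (\<Sum>i<n. \<Sum>j<n. c i * c j * G (Suc i) (Suc j)) - s * s / G 0 0"
      unfolding s_def sum_product by (simp only: sum_subtractf sum_divide_distrib)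
    also have "\<dots> = (\<Sum>i<Suc n. \<Sum>j<Suc n. e i * e j * G i j)"
    proof -
      have s': "(\<Sum>j<n. a * c j * G 0 (Suc j)) = a * s" for a
        unfolding s_def sum_distrib_left by (intro sum.cong refl) (simp add: sym[of 0])
      have s'': "(\<Sum>i<n. c i * a * G (Suc i) 0) = a * s" for a
        unfolding s_def sum_distrib_left by (intro sum.cong refl) simp
      show ?thesis
        unfolding sum.lessThan_Suc_shift sum.distrib using G0
        by (simp only: e_def nat.case s' s'') simp
    qed
    also have "0 < \<dots>"
      using pos[of "Suc k" e] k by (simp add: e_def)
    finally show ?thesis .
  qed
  have sym': "G' i j = G' j i" for i j
    using sym[of "Suc i" "Suc j"] by (simp add: G'_def mult.commute)
  have "\<exists>L. (\<forall>i<n. 0 < L i i) \<and> (\<forall>i j. i < j \<longrightarrow> L i j = 0) \<and>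
    (\<forall>i<n. \<forall>j<n. (\<Sum>k<n. L i k * L j k) = G' i j)"
    by (rule Suc.IH) (rule sym', rule pos')
  then obtain L where L0: "(\<forall>i<n. 0 < L i i) \<and> (\<forall>i j. i < j \<longrightarrow> L i j = 0) \<and>
    (\<forall>i<n. \<forall>j<n. (\<Sum>k<n. L i k * L j k) = G' i j)" ..
  note L = L0[THEN conjunct1, rule_format] L0[THEN conjunct2, THEN conjunct1, rule_format]
    L0[THEN conjunct2, THEN conjunct2, rule_format]
  \<comment> \<open>The first column accounts for the rank-one part subtracted in \<open>G'\<close>;
    the factor of \<open>G'\<close> fills the remaining block.\<close>
  define M where "M i k = (case k of 0 \<Rightarrow> G i 0 / sqrt (G 0 0)
      | Suc k \<Rightarrow> (case i of 0 \<Rightarrow> 0 | Suc i \<Rightarrow> L i k))" for i k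
  show ?case
  proof (intro exI[of _ M] conjI allI impI)
    fix i assume "i < Suc n"
    then show "0 < M i i" using G0 L(1) by (cases i) (auto simp: M_def)
  next
    fix i j :: nat assume "i < j"
    then show "M i j = 0" using L(2) by (cases i; cases j) (auto simp: M_def)
  next
    fix i j assume ij: "i < Suc n" "j < Suc n"
    have "(\<Sum>k<Suc n. M i k * M j k) = G i 0 * G j 0 / G 0 0 + (\<Sum>k<n. M i (Suc k) * M j (Suc k))"
      using G0 unfolding sum.lessThan_Suc_shift by (simp add: M_def)
    also have "\<dots> = G i j"
    proof (cases i)
      case 0
      then show ?thesis using G0 sym[of 0 j] by (cases j) (simp_all add: M_def)
    next
      case i: (Suc i')
      show ?thesis
      proof (cases j)
        case 0
        then show ?thesis using G0 i by (simp add: M_def)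
      next
        case (Suc j')
        then show ?thesis using L(3)[of i' j'] ij i by (simp add: M_def G'_def)
      qed
    qed
    finally show "(\<Sum>k<Suc n. M i k * M j k) = G i j" .
  qed
qed

text \<open>The restriction to \<open>{..<N}\<close> is needed because points of
  \<open>sample_space\<close> are extensional functions.\<close>

definition affine_image :: "nat \<Rightarrow> (nat \<Rightarrow> real) \<Rightarrow> (nat \<Rightarrow> nat \<Rightarrow> real) \<Rightarrow> (nat \<Rightarrow> real) \<Rightarrow> nat \<Rightarrow> real" where
  "affine_image N \<mu> A w = (\<lambda>i\<in>{..<N}. \<mu> i + (\<Sum>k<N. A i k * w k))"

lemma sets_sample_space: "sets (sample_space N) = sets (\<Pi>\<^sub>M i\<in>{..<N}. borel)"
  unfolding sample_space_def by (intro sets_PiM_cong) auto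

lemma measurable_affine_image [measurable]:
  assumes "sets M = sets (\<Pi>\<^sub>M i\<in>{..<N}. borel)" 
  shows "affine_image N \<mu> A \<in> measurable M (sample_space N)"
proof -
  have "(\<lambda>w. w k) \<in> borel_measurable M" if "k < N" for k
    using that by (simp add: measurable_cong_sets[OF assms refl])
  then show ?thesis
    unfolding affine_image_def sample_space_def
    by (intro measurable_restrict) (auto intro!: borel_measurable_add borel_measurable_sum borel_measurable_times)
qed

text \<open>Triangularity makes the last coordinate, with the others fixed, a one-dimensional affine
  map of slope \<open>L n n\<close>. Fubini and induction then multiply these slopes, which replaces
  a multidimensional change of variables.\<close>

lemma nn_integral_triangular_image:
  assumes "\<And>i. i < N \<Longrightarrow> 0 < L i i" "\<And>i j. i < j \<Longrightarrow> L i j = 0"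
    and "f \<in> borel_measurable (sample_space N)"
  shows "(\<integral>\<^sup>+z. f z \<partial>sample_space N) =
    (\<integral>\<^sup>+w. ennreal (\<Prod>i<N. L i i) * f (affine_image N \<mu> L w) \<partial>sample_space N)"
  using assms
proof (induction N arbitrary: f)
  case 0
  show ?case
    by (simp add: sample_space_def space_PiM affine_image_def PiM_empty nn_integral_count_space_finite)
next
  case (Suc n)
  interpret product_sigma_finite "\<lambda>_::nat. lborel :: real measure" ..
  have ins: "{..<Suc n} = insert n {..<n}" by auto
  note f[measurable] = Suc.prems(3)[unfolded sample_space_def ins]
  have fI: "integral\<^sup>N (sample_space (Suc n)) f' = (\<integral>\<^sup>+x. (\<integral>\<^sup>+y. f' (x(n := y)) \<partial>lborel) \<partial>sample_space n)"
    if "f' \<in> borel_measurable (sample_space (Suc n))" for f'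
    using that unfolding sample_space_def ins by (intro product_nn_integral_insert) auto
  have meas2: "(\<lambda>(x, y). f (x(n := y))) \<in> borel_measurable (sample_space n \<Otimes>\<^sub>M lborel)"
    unfolding sample_space_def by measurable
  have meas: "(\<lambda>x. \<integral>\<^sup>+y. f (x(n := y)) \<partial>lborel) \<in> borel_measurable (sample_space n)"
    using lborel.borel_measurable_nn_integral[OF meas2] by simp
  have "integral\<^sup>N (sample_space (Suc n)) f = (\<integral>\<^sup>+x. (\<integral>\<^sup>+y. f (x(n := y)) \<partial>lborel) \<partial>sample_space n)"
    by (rule fI[OF Suc.prems(3)])
  also have "\<dots> = (\<integral>\<^sup>+x. ennreal (\<Prod>i<n. L i i) * (\<integral>\<^sup>+y. f ((affine_image n \<mu> L x)(n := y)) \<partial>lborel) \<partial>sample_space n)"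
    by (rule Suc.IH[OF Suc.prems(1) Suc.prems(2) meas]) auto
  also have "\<dots> = (\<integral>\<^sup>+x. \<integral>\<^sup>+y. ennreal (\<Prod>i<Suc n. L i i) * f (affine_image (Suc n) \<mu> L (x(n := y))) \<partial>lborel \<partial>sample_space n)"
  proof (rule nn_integral_cong)
    fix x assume x: "x \<in> space (sample_space n)"
    \<comment> \<open>\<open>?t\<close> collects the part of row \<open>n\<close> that depends on
      earlier coordinates; it is a constant in the inner integral.\<close>
    let ?x' = "affine_image n \<mu> L x" and ?t = "\<mu> n + (\<Sum>k<n. L n k * x k)"
    have x': "?x' \<in> space (sample_space n)"
      by (simp add: sample_space_def space_PiM affine_image_def)
    have fm: "(\<lambda>y. f (?x'(n := y))) \<in> borel_measurable borel"
      using measurable_Pair2[OF meas2 x'] by simp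
    have upd: "?x'(n := ?t + L n n * y) = affine_image (Suc n) \<mu> L (x(n := y))" for y
      using Suc.prems(2) by (auto simp: affine_image_def fun_eq_iff intro!: sum.cong)
    have "(\<integral>\<^sup>+y. f (?x'(n := y)) \<partial>lborel) = ennreal (L n n) * (\<integral>\<^sup>+y. f (?x'(n := ?t + L n n * y)) \<partial>lborel)"
      using nn_integral_real_affine[OF fm, of "L n n" ?t] Suc.prems(1)[of n] by simp
    also have "\<dots> = (\<integral>\<^sup>+y. ennreal (L n n) * f (affine_image (Suc n) \<mu> L (x(n := y))) \<partial>lborel)"
      unfolding upd[symmetric] using measurable_compose[OF _ fm, of "\<lambda>y. ?t + L n n * y" lborel]
      by (subst nn_integral_cmult) auto
    finally have "ennreal (\<Prod>i<n. L i i) * (\<integral>\<^sup>+y. f (?x'(n := y)) \<partial>lborel) =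
        ennreal (\<Prod>i<n. L i i) * (\<integral>\<^sup>+y. ennreal (L n n) * f (affine_image (Suc n) \<mu> L (x(n := y))) \<partial>lborel)"
      by simp
    also have "\<dots> = (\<integral>\<^sup>+y. ennreal (\<Prod>i<n. L i i) * (ennreal (L n n) * f (affine_image (Suc n) \<mu> L (x(n := y)))) \<partial>lborel)"
      unfolding upd[symmetric] using measurable_compose[OF _ fm, of "\<lambda>y. ?t + L n n * y" lborel]
      by (intro nn_integral_cmult[symmetric]) auto
    also have "\<dots> = (\<integral>\<^sup>+y. ennreal (\<Prod>i<Suc n. L i i) * f (affine_image (Suc n) \<mu> L (x(n := y))) \<partial>lborel)"
    proof -
      have "0 \<le> (\<Prod>i<n. L i i)" "0 \<le> L n n"
        using less_imp_le[OF Suc.prems(1)] by (auto intro: prod_nonneg)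
      then have "ennreal (\<Prod>i<Suc n. L i i) = ennreal (\<Prod>i<n. L i i) * ennreal (L n n)"
        by (simp add: ennreal_mult)
      then show ?thesis
        by (simp only: mult.assoc)
    qed
    finally show "ennreal (\<Prod>i<n. L i i) * (\<integral>\<^sup>+y. f (?x'(n := y)) \<partial>lborel) =
        (\<integral>\<^sup>+y. ennreal (\<Prod>i<Suc n. L i i) * f (affine_image (Suc n) \<mu> L (x(n := y))) \<partial>lborel)" .
  qed
  also have "\<dots> = (\<integral>\<^sup>+w. ennreal (\<Prod>i<Suc n. L i i) * f (affine_image (Suc n) \<mu> L w) \<partial>sample_space (Suc n))"
    by (rule fI[symmetric])
       (intro borel_measurable_times_ennreal borel_measurable_const
         measurable_compose[OF measurable_affine_image[OF sets_sample_space] Suc.prems(3)])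
  finally show ?case .
qed

section \<open>The standard normal vector: density, triangular images and cosine integrals\<close>

abbreviation std_normal_vec :: "nat \<Rightarrow> (nat \<Rightarrow> real) measure" where
  "std_normal_vec N \<equiv> \<Pi>\<^sub>M i\<in>{..<N}. std_normal_distribution"

lemma sets_std_normal_vec: "sets (std_normal_vec N) = sets (\<Pi>\<^sub>M i\<in>{..<N}. borel)"
  by (intro sets_PiM_cong) auto

lemma prob_space_std_normal_vec: "prob_space (std_normal_vec N)"
  by (intro prob_space_PiM prob_space_normal_density) simp

lemma std_normal_vec_density:
  "std_normal_vec N = density (sample_space N) (\<lambda>w. ennreal (\<Prod>i<N. std_normal_density (w i)))"
proof -
  interpret S: prob_space std_normal_distribution by (rule prob_space_normal_density) simp
  interpret P: product_sigma_finite "\<lambda>_::nat. std_normal_distribution" ..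
  interpret Q: product_sigma_finite "\<lambda>_::nat. lborel :: real measure" ..
  show ?thesis
  proof (rule P.PiM_eqI[symmetric])
    show "sets (density (sample_space N) (\<lambda>w. ennreal (\<Prod>i<N. std_normal_density (w i)))) = sets (std_normal_vec N)"
      using sets_sample_space sets_std_normal_vec by simp
    fix A :: "nat \<Rightarrow> real set" assume A: "\<And>i. i \<in> {..<N} \<Longrightarrow> A i \<in> sets std_normal_distribution"
    have m: "(\<lambda>w. \<Prod>i<N. std_normal_density (w i)) \<in> borel_measurable (sample_space N)"
      unfolding sample_space_def by (intro borel_measurable_prod) auto
    have "emeasure (density (sample_space N) (\<lambda>w. ennreal (\<Prod>i<N. std_normal_density (w i)))) (Pi\<^sub>E {..<N} A)
        = (\<integral>\<^sup>+w. ennreal (\<Prod>i<N. std_normal_density (w i)) * indicator (Pi\<^sub>E {..<N} A) w \<partial>sample_space N)"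
      using m A unfolding sample_space_def by (intro emeasure_density) (auto intro!: sets_PiM_I_finite)
    also have "\<dots> = (\<integral>\<^sup>+w. (\<Prod>i<N. ennreal (std_normal_density (w i)) * indicator (A i) (w i)) \<partial>sample_space N)"
    proof (rule nn_integral_cong)
      fix w assume w: "w \<in> space (sample_space N)"
      have "indicator (Pi\<^sub>E {..<N} A) w = (\<Prod>i<N. indicator (A i) (w i) :: ennreal)"
        using w by (cases "\<forall>i<N. w i \<in> A i")
          (auto simp: indicator_def PiE_def Pi_iff sample_space_def space_PiM prod_zero_iff intro!: prod.neutral)
      then show "ennreal (\<Prod>i<N. std_normal_density (w i)) * indicator (Pi\<^sub>E {..<N} A) w =
          (\<Prod>i<N. ennreal (std_normal_density (w i)) * indicator (A i) (w i))"
        by (simp add: prod.distrib prod_ennreal)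
    qed
    also have "\<dots> = (\<Prod>i<N. \<integral>\<^sup>+x. ennreal (std_normal_density x) * indicator (A i) x \<partial>lborel)"
      unfolding sample_space_def using A by (intro Q.product_nn_integral_prod) auto
    also have "\<dots> = (\<Prod>i<N. emeasure std_normal_distribution (A i))"
      using A by (intro prod.cong refl emeasure_density[symmetric]) auto
    finally show "emeasure (density (sample_space N) (\<lambda>w. ennreal (\<Prod>i<N. std_normal_density (w i)))) (Pi\<^sub>E {..<N} A)
        = (\<Prod>i<N. emeasure std_normal_distribution (A i))" .
  qed simp
qed

text \<open>The product of the diagonal entries is the Jacobian, so \<open>eq\<close> is the
  pointwise change-of-variables identity that a density of the image must satisfy.\<close>

lemma triangular_image_density:
  assumes L: "\<And>i. i < N \<Longrightarrow> 0 < L i i" "\<And>i j. i < j \<Longrightarrow> L i j = 0"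
    and p: "p \<in> borel_measurable (sample_space N)"
    and eq: "\<And>w. (\<Prod>i<N. L i i) * p (affine_image N \<mu> L w) = (\<Prod>i<N. std_normal_density (w i))"
  shows "distr (std_normal_vec N) (sample_space N) (affine_image N \<mu> L) = density (sample_space N) (\<lambda>z. ennreal (p z))"
proof (rule measure_eqI)
  note m1 = measurable_affine_image[OF sets_std_normal_vec, of N \<mu> L]
  note m2 = measurable_affine_image[OF sets_sample_space, of N \<mu> L]
  fix A assume "A \<in> sets (distr (std_normal_vec N) (sample_space N) (affine_image N \<mu> L))"
  then have A[measurable]: "A \<in> sets (sample_space N)" by simp
  have m: "(\<lambda>w. \<Prod>i<N. std_normal_density (w i)) \<in> borel_measurable (sample_space N)"
    unfolding sample_space_def by (intro borel_measurable_prod) auto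
  have mi: "(\<lambda>w. indicator A (affine_image N \<mu> L w) :: ennreal) \<in> borel_measurable (sample_space N)"
    using measurable_compose[OF m2, of "indicator A" borel] by auto
  have "emeasure (distr (std_normal_vec N) (sample_space N) (affine_image N \<mu> L)) A
      = (\<integral>\<^sup>+z. indicator A z \<partial>distr (std_normal_vec N) (sample_space N) (affine_image N \<mu> L))"
    by simp
  also have "\<dots> = (\<integral>\<^sup>+w. indicator A (affine_image N \<mu> L w) \<partial>std_normal_vec N)"
    by (intro nn_integral_distr m1) auto
  also have "\<dots> = (\<integral>\<^sup>+w. ennreal (\<Prod>i<N. std_normal_density (w i)) * indicator A (affine_image N \<mu> L w) \<partial>sample_space N)"
    unfolding std_normal_vec_density using m mi by (intro nn_integral_density) auto
  also have "\<dots> = (\<integral>\<^sup>+w. ennreal (\<Prod>i<N. L i i) * (ennreal (p (affine_image N \<mu> L w)) * indicator A (affine_image N \<mu> L w)) \<partial>sample_space N)"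
  proof -
    have "0 \<le> (\<Prod>i<N. L i i)"
      using less_imp_le[OF L(1)] by (auto intro: prod_nonneg)
    then show ?thesis
      unfolding eq[symmetric] by (simp only: ennreal_mult' mult.assoc)
  qed
  also have "\<dots> = (\<integral>\<^sup>+z. ennreal (p z) * indicator A z \<partial>sample_space N)"
    using p by (intro nn_integral_triangular_image[OF L, symmetric]) auto
  also have "\<dots> = emeasure (density (sample_space N) (\<lambda>z. ennreal (p z))) A"
    using p by (intro emeasure_density[symmetric]) auto
  finally show "emeasure (distr (std_normal_vec N) (sample_space N) (affine_image N \<mu> L)) A =
      emeasure (density (sample_space N) (\<lambda>z. ennreal (p z))) A" .
qed simp

text \<open>The phase becomes a factor \<open>cis \<phi>\<close>, after which the complex
  exponential factorizes over the independent coordinates.\<close>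

lemma std_normal_vec_cos:
  "(\<integral>w. cos ((\<Sum>k<N. a k * w k) + \<phi>) \<partial>std_normal_vec N) = exp (- (\<Sum>k<N. (a k)\<^sup>2) / 2) * cos \<phi>"
proof -
  interpret S: prob_space std_normal_distribution by (rule prob_space_normal_density) simp
  interpret P: product_sigma_finite "\<lambda>_::nat. std_normal_distribution" ..
  have i: "complex_integrable std_normal_distribution (\<lambda>x. iexp (a k * x))" for k
    by (rule S.integrable_iexp) auto
  have "(\<integral>w. cis \<phi> * (\<Prod>k<N. iexp (a k * w k)) \<partial>std_normal_vec N) =
      cis \<phi> * (\<Prod>k<N. char std_normal_distribution (a k))"
    using P.product_integral_prod[of "{..<N}" "\<lambda>k x. iexp (a k * x)"] i
    by (simp add: char_def)
  also have "(\<Prod>k<N. char std_normal_distribution (a k)) = of_real (exp (- (\<Sum>k<N. (a k)\<^sup>2) / 2))"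
    by (simp add: char_std_normal_distribution exp_sum sum_negf[symmetric] sum_divide_distrib flip: of_real_prod)
  finally have "Re (\<integral>w. cis \<phi> * (\<Prod>k<N. iexp (a k * w k)) \<partial>std_normal_vec N) =
      exp (- (\<Sum>k<N. (a k)\<^sup>2) / 2) * cos \<phi>"
    by simp
  also have "Re (\<integral>w. cis \<phi> * (\<Prod>k<N. iexp (a k * w k)) \<partial>std_normal_vec N) =
      (\<integral>w. Re (cis \<phi> * (\<Prod>k<N. iexp (a k * w k))) \<partial>std_normal_vec N)"
    using P.product_integrable_prod[of "{..<N}" "\<lambda>k x. iexp (a k * x)"] i
    by (intro integral_Re[symmetric]) auto
  also have "(\<lambda>w. Re (cis \<phi> * (\<Prod>k<N. iexp (a k * w k)))) = (\<lambda>w. cos ((\<Sum>k<N. a k * w k) + \<phi>))"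
  proof
    fix w :: "nat \<Rightarrow> real"
    have "cis \<phi> * (\<Prod>k<N. iexp (a k * w k)) = cis \<phi> * cis (\<Sum>k<N. a k * w k)"
      by (simp add: cis_conv_exp exp_sum sum_distrib_left)
    then show "Re (cis \<phi> * (\<Prod>k<N. iexp (a k * w k))) = cos ((\<Sum>k<N. a k * w k) + \<phi>)"
      by (simp add: cis_mult add.commute)
  qed
  finally show ?thesis .
qed

subsection \<open>The law of the observations\<close>


lemma char_normal_law:
  assumes "0 \<le> \<sigma>"
  shows "char (normal_law 0 \<sigma>) t = of_real (exp (- (\<sigma> * t)\<^sup>2 / 2))"
proof (cases "\<sigma> = 0")
  case True
  then show ?thesis by (simp add: normal_law_def char_def integral_return)
next
  case False
  with assms have \<sigma>: "\<sigma> > 0" by simp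
  have dens: "\<sigma> * normal_density 0 \<sigma> (\<sigma> * x) = std_normal_density x" for x
    using \<sigma> by (simp add: normal_density_def power_mult_distrib real_sqrt_mult)
  have "char (normal_law 0 \<sigma>) t = (\<integral>x. normal_density 0 \<sigma> x *\<^sub>R iexp (t * x) \<partial>lborel)"
    using False by (simp add: normal_law_def char_def integral_density)
  also have "\<dots> = \<sigma> *\<^sub>R (\<integral>x. normal_density 0 \<sigma> (0 + \<sigma> * x) *\<^sub>R iexp (t * (0 + \<sigma> * x)) \<partial>lborel)"
    using lborel_integral_real_affine[of \<sigma> "\<lambda>x. normal_density 0 \<sigma> x *\<^sub>R iexp (t * x)" 0] \<sigma> by simp
  also have "\<dots> = (\<integral>x. (\<sigma> * normal_density 0 \<sigma> (\<sigma> * x)) *\<^sub>R iexp ((\<sigma> * t) * x) \<partial>lborel)"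
    unfolding integral_scaleR_right[symmetric] by (simp add: mult_ac)
  also have "\<dots> = char std_normal_distribution (\<sigma> * t)"
    unfolding dens by (simp add: char_def integral_density)
  finally show ?thesis
    by (simp add: char_std_normal_distribution)
qed

text \<open>\<open>gaussian_process\<close> only asserts that some mean and some standard deviation
  exist. These moments, valid in the degenerate case too, are what identifies them later.\<close>

lemma normal_law_moments:
  assumes "0 \<le> \<sigma>"
  shows "integrable (normal_law \<mu> \<sigma>) (\<lambda>x. x)" "integral\<^sup>L (normal_law \<mu> \<sigma>) (\<lambda>x. x) = \<mu>"
    and "integrable (normal_law \<mu> \<sigma>) (\<lambda>x. x\<^sup>2)" "integral\<^sup>L (normal_law \<mu> \<sigma>) (\<lambda>x. x\<^sup>2) = \<mu>\<^sup>2 + \<sigma>\<^sup>2"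
proof -
  have "has_bochner_integral (normal_law \<mu> \<sigma>) (\<lambda>x. x) \<mu> \<and>
    has_bochner_integral (normal_law \<mu> \<sigma>) (\<lambda>x. x\<^sup>2) (\<mu>\<^sup>2 + \<sigma>\<^sup>2)"
  proof (cases "\<sigma> = 0")
    case True
    have ret: "has_bochner_integral (return borel \<mu>) f (f \<mu>)" if [measurable]: "f \<in> borel_measurable borel" for f :: "real \<Rightarrow> real"
    proof -
      interpret prob_space "return borel \<mu>" by (rule prob_space_return) simp
      have "AE x in return borel \<mu>. f x = f \<mu>"
        by (subst AE_return) auto
      then have "integrable (return borel \<mu>) f"
        by (subst integrable_cong_AE[where g="\<lambda>_. f \<mu>"]) auto
      then show ?thesis by (simp add: has_bochner_integral_iff integral_return)
    qed
    have "normal_law \<mu> \<sigma> = return borel \<mu>"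
      using True by (simp add: normal_law_def)
    moreover have "has_bochner_integral (return borel \<mu>) (\<lambda>x. x\<^sup>2) (\<mu>\<^sup>2 + \<sigma>\<^sup>2)"
      using ret[of "\<lambda>x. x\<^sup>2"] True by simp
    ultimately show ?thesis
      using ret[of "\<lambda>x. x"] by simp
  next
    case False
    with assms have \<sigma>: "0 < \<sigma>" by simp
    have 1: "has_bochner_integral lborel (\<lambda>x. normal_density \<mu> \<sigma> x * x) \<mu>"
      by (rule normal_moment_nz_1[OF \<sigma>])
    have 2: "has_bochner_integral lborel (\<lambda>x. normal_density \<mu> \<sigma> x * (x - \<mu>)^2) (\<sigma>\<^sup>2)"
      using normal_moment_even[OF \<sigma>, of \<mu> 1] by (simp add: power2_eq_square)
    have 3: "has_bochner_integral lborel (normal_density \<mu> \<sigma>) 1"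
      using normal_moment_even[OF \<sigma>, of \<mu> 0] by simp
    have "has_bochner_integral lborel (\<lambda>x. normal_density \<mu> \<sigma> x * (x - \<mu>)^2
        + (2 * \<mu> * (normal_density \<mu> \<sigma> x * x) - \<mu>\<^sup>2 * normal_density \<mu> \<sigma> x)) (\<sigma>\<^sup>2 + (2 * \<mu> * \<mu> - \<mu>\<^sup>2 * 1))"
      by (intro has_bochner_integral_add has_bochner_integral_diff has_bochner_integral_mult_right 1 2 3)
    also have "(\<lambda>x. normal_density \<mu> \<sigma> x * (x - \<mu>)^2
        + (2 * \<mu> * (normal_density \<mu> \<sigma> x * x) - \<mu>\<^sup>2 * normal_density \<mu> \<sigma> x)) = (\<lambda>x. normal_density \<mu> \<sigma> x * x\<^sup>2)"
      by (simp add: fun_eq_iff power2_eq_square algebra_simps)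
    finally have "has_bochner_integral lborel (\<lambda>x. normal_density \<mu> \<sigma> x * x\<^sup>2) (\<mu>\<^sup>2 + \<sigma>\<^sup>2)"
      by (simp add: power2_eq_square algebra_simps)
    with 1 False show ?thesis
      by (auto simp: normal_law_def has_bochner_integral_density)
  qed
  then show "integrable (normal_law \<mu> \<sigma>) (\<lambda>x. x)" "integral\<^sup>L (normal_law \<mu> \<sigma>) (\<lambda>x. x) = \<mu>"
    "integrable (normal_law \<mu> \<sigma>) (\<lambda>x. x\<^sup>2)" "integral\<^sup>L (normal_law \<mu> \<sigma>) (\<lambda>x. x\<^sup>2) = \<mu>\<^sup>2 + \<sigma>\<^sup>2"
    by (auto simp: has_bochner_integral_iff)
qed

text \<open>The combination is normal by hypothesis, and its first two moments follow from the mean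
  and covariance of the process; they determine the law.\<close>

lemma char_fbm_combination:
  assumes "prob_space M" and fbm: "fractional_brownian_motion M H X"
    and t: "inj_on t I" "finite I" "\<And>i. i \<in> I \<Longrightarrow> 0 \<le> t i"
  shows "char (distr M borel (\<lambda>\<omega>. \<Sum>i\<in>I. c i * X (t i) \<omega>)) s =
    of_real (exp (- s\<^sup>2 * (\<Sum>i\<in>I. \<Sum>j\<in>I. c i * c j * fbm_cov H (t i) (t j)) / 2))"
proof -
  interpret prob_space M by fact
  let ?Y = "\<lambda>\<omega>. \<Sum>i\<in>I. c i * X (t i) \<omega>"
  have gp: "gaussian_process M {0..} X"
    and mean: "\<And>t. 0 \<le> t \<Longrightarrow> expectation (X t) = 0"
    and cov: "\<And>s t. 0 \<le> s \<Longrightarrow> 0 \<le> t \<Longrightarrow> expectation (\<lambda>\<omega>. X t \<omega> * X s \<omega>) = fbm_cov H t s"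
    using fbm by (auto simp: fractional_brownian_motion_def)
  have [measurable]: "X u \<in> borel_measurable M" if "0 \<le> u" for u
    using gp that by (auto simp: gaussian_process_def)
  have ex: "\<exists>\<mu> \<sigma>. 0 \<le> \<sigma> \<and> distr M borel (\<lambda>\<omega>. \<Sum>t\<in>F. c t * X t \<omega>) = normal_law \<mu> \<sigma>"
    if "finite F" "F \<subseteq> {0..}" for F c
    using gp that unfolding gaussian_process_def by blast
  \<comment> \<open>A covariance given as the value of a total integral does not by itself yield
    integrability. A single time is also a linear combination, so its law is normal and has second
    moments.\<close>
  have sq: "integrable M (X u)" "integrable M (\<lambda>\<omega>. (X u \<omega>)\<^sup>2)" if u: "0 \<le> u" for u
  proof -
    obtain \<mu> \<sigma> where *: "0 \<le> \<sigma>" "distr M borel (X u) = normal_law \<mu> \<sigma>"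
      using ex[of "{u}" "\<lambda>_. 1"] u by auto
    have m[measurable]: "X u \<in> borel_measurable M" using u by simp
    show "integrable M (X u)"
      using normal_law_moments(1)[OF *(1), of \<mu>] unfolding *(2)[symmetric]
      by (subst (asm) integrable_distr_eq) auto
    show "integrable M (\<lambda>\<omega>. (X u \<omega>)\<^sup>2)"
      using normal_law_moments(3)[OF *(1), of \<mu>] unfolding *(2)[symmetric]
      by (subst (asm) integrable_distr_eq) auto
  qed
  have prod: "integrable M (\<lambda>\<omega>. X u \<omega> * X v \<omega>)" if u: "0 \<le> u" "0 \<le> v" for u v
  proof (rule Bochner_Integration.integrable_bound)
    show "integrable M (\<lambda>\<omega>. (X u \<omega>)\<^sup>2 + (X v \<omega>)\<^sup>2)"
      using sq u by simp
    have "\<bar>a * b\<bar> \<le> a\<^sup>2 + b\<^sup>2" for a b :: real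
    proof -
      have "2 * (\<bar>a\<bar> * \<bar>b\<bar>) \<le> a\<^sup>2 + b\<^sup>2"
        using sum_squares_bound[of "\<bar>a\<bar>" "\<bar>b\<bar>"] by (simp add: mult.assoc)
      moreover have "0 \<le> \<bar>a\<bar> * \<bar>b\<bar>" by simp
      ultimately show ?thesis unfolding abs_mult by linarith
    qed
    then show "AE \<omega> in M. norm (X u \<omega> * X v \<omega>) \<le> norm ((X u \<omega>)\<^sup>2 + (X v \<omega>)\<^sup>2)"
      by (intro AE_I2) simp
  qed (use u in measurable)
  \<comment> \<open>\<open>gaussian_process\<close> attaches coefficients to times rather than to
    indices; injectivity of \<open>t\<close> lets them be transported.\<close>
  obtain \<mu> \<sigma> where \<sigma>: "0 \<le> \<sigma>" and Y: "distr M borel ?Y = normal_law \<mu> \<sigma>"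
  proof -
    have "(\<lambda>\<omega>. \<Sum>u\<in>t ` I. c (the_inv_into I t u) * X u \<omega>) = ?Y"
      using t(1) by (simp add: sum.reindex the_inv_into_f_f)
    then show ?thesis
      using ex[of "t ` I" "\<lambda>u. c (the_inv_into I t u)"] t that by auto
  qed
  have Ym[measurable]: "?Y \<in> borel_measurable M"
    using t(3) by (intro borel_measurable_sum borel_measurable_times) auto
  have "\<mu> = integral\<^sup>L (distr M borel ?Y) (\<lambda>x. x)"
    unfolding Y normal_law_moments(2)[OF \<sigma>] ..
  also have "\<dots> = (\<Sum>i\<in>I. c i * expectation (X (t i)))"
    using sq(1) t(3) by (subst integral_distr) (auto simp: Bochner_Integration.integral_sum)
  also have "\<dots> = 0" using mean t(3) by simp
  finally have \<mu>: "\<mu> = 0" .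
  have "\<sigma>\<^sup>2 = integral\<^sup>L (distr M borel ?Y) (\<lambda>x. x\<^sup>2)"
    unfolding Y normal_law_moments(4)[OF \<sigma>] \<mu> by simp
  also have "\<dots> = expectation (\<lambda>\<omega>. \<Sum>i\<in>I. \<Sum>j\<in>I. c i * c j * (X (t i) \<omega> * X (t j) \<omega>))"
    by (subst integral_distr) (auto simp: power2_eq_square sum_product mult_ac)
  also have "\<dots> = (\<Sum>i\<in>I. \<Sum>j\<in>I. c i * c j * fbm_cov H (t i) (t j))"
    using prod t(3) cov by (simp add: Bochner_Integration.integral_sum)
  finally show ?thesis
    unfolding Y \<mu> char_normal_law[OF \<sigma>] by (simp add: power_mult_distrib mult.commute)
qed

lemma expectation_cos_eq_char:
  assumes "prob_space M" and [measurable]: "Y \<in> borel_measurable M"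
  shows "(\<integral>\<omega>. cos (Y \<omega> + \<phi>) \<partial>M) = Re (cis \<phi> * char (distr M borel Y) 1)"
proof -
  interpret prob_space M by fact
  have "char (distr M borel Y) 1 = (\<integral>\<omega>. iexp (Y \<omega>) \<partial>M)"
    by (simp add: char_def integral_distr)
  then have "Re (cis \<phi> * char (distr M borel Y) 1) = Re (\<integral>\<omega>. cis \<phi> * iexp (Y \<omega>) \<partial>M)"
    by simp
  also have "\<dots> = (\<integral>\<omega>. Re (cis \<phi> * iexp (Y \<omega>)) \<partial>M)"
    by (intro integral_Re[symmetric] integrable_mult_right integrable_iexp) auto
  also have "\<dots> = (\<integral>\<omega>. cos (Y \<omega> + \<phi>) \<partial>M)"
    by (simp add: cis_conv_exp[symmetric] cis_mult add.commute)
  finally show ?thesis ..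
qed

text \<open>Only the Gram matrix of \<open>A\<close> is prescribed, so the same law may be
  represented by any square root of the covariance; a triangular and a rotated one are both inserted
  later.\<close>

theorem Z_law_eq_affine_image:
  assumes M: "prob_space M" and h: "h > 0"
    and fbm: "\<And>r. r \<in> {1..m} \<Longrightarrow> fractional_brownian_motion M (H r) (B r)"
    and indep: "independent_processes M {1..m} B"
    and v: "0 \<le> \<psi> $ 1"
    and A: "\<And>i j. i < N \<Longrightarrow> j < N \<Longrightarrow>
      (\<Sum>k<N. A i k * A j k) = \<psi> $ 1 * (\<Sum>r = 1..m. fbm_cov (H r) (obs_time h i) (obs_time h j))"
  shows "Z_law M B m h N \<psi> =
    distr (std_normal_vec N) (sample_space N) (affine_image N (\<lambda>i. \<psi> $ 0 * obs_time h i) A)"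
proof (rule PiM_borel_eqI_cos[of "{..<N}"])
  interpret prob_space M by fact
  interpret S: prob_space "std_normal_vec N" by (rule prob_space_std_normal_vec)
  let ?\<theta> = "\<psi> $ 0" and ?\<alpha> = "sqrt (\<psi> $ 1)" and ?t = "obs_time h"
  have t: "inj_on ?t {..<N}" "\<And>i. 0 \<le> ?t i"
    using h by (auto simp: inj_on_def obs_time_def)
  have B[measurable]: "B r (?t i) \<in> borel_measurable M" if "r \<in> {1..m}" for r i
    using fbm[OF that] t(2) by (auto simp: fractional_brownian_motion_def gaussian_process_def)
  have Zm: "Z_process B m ?\<theta> ?\<alpha> (?t i) \<in> borel_measurable M" for i
    unfolding Z_process_def
    by (intro borel_measurable_add borel_measurable_times borel_measurable_const borel_measurable_sum B)
  then have Z1: "(\<lambda>\<omega>. \<lambda>i\<in>{..<N}. Z_process B m ?\<theta> ?\<alpha> (?t i) \<omega>) \<in> measurable M (sample_space N)"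
    unfolding sample_space_def by (intro measurable_restrict) simp
  have A1: "affine_image N \<mu> A \<in> measurable (std_normal_vec N) (sample_space N)" for \<mu>
    by (rule measurable_affine_image[OF sets_std_normal_vec])
  show "prob_space (Z_law M B m h N \<psi>)"
    unfolding Z_law_def by (rule prob_space_distr[OF Z1])
  show "prob_space (distr (std_normal_vec N) (sample_space N) (affine_image N (\<lambda>i. ?\<theta> * ?t i) A))"
    by (rule S.prob_space_distr[OF A1])
  show "sets (Z_law M B m h N \<psi>) = sets (\<Pi>\<^sub>M i\<in>{..<N}. borel)"
    "sets (distr (std_normal_vec N) (sample_space N) (affine_image N (\<lambda>i. ?\<theta> * ?t i) A)) = sets (\<Pi>\<^sub>M i\<in>{..<N}. borel)"
    by (simp_all add: Z_law_def sets_sample_space)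
  fix c :: "nat \<Rightarrow> real" and \<phi> :: real
  define q where "q r = (\<Sum>i<N. \<Sum>j<N. (?\<alpha> * c i) * (?\<alpha> * c j) * fbm_cov (H r) (?t i) (?t j))" for r
  \<comment> \<open>The deterministic drift is absorbed into the phase, leaving a centred Gaussian
    sum under the cosine.\<close>
  define \<phi>' where "\<phi>' = (\<Sum>i<N. c i * (?\<theta> * ?t i)) + \<phi>"
  let ?Y = "\<lambda>r \<omega>. \<Sum>i<N. (?\<alpha> * c i) * B r (?t i) \<omega>"
  have cosm: "(\<lambda>w. cos ((\<Sum>i<N. c i * w i) + \<phi>)) \<in> borel_measurable (sample_space N)"
    unfolding sample_space_def by measurable
  have charY: "char (distr M borel (?Y r)) 1 = of_real (exp (- q r / 2))" if "r \<in> {1..m}" for r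
    using char_fbm_combination[OF M fbm[OF that] t(1) _ t(2), of "\<lambda>i. ?\<alpha> * c i" 1]
    by (simp add: q_def)
  \<comment> \<open>Each \<open>?Y r\<close> is a measurable function of the restricted path of
    \<open>B r\<close>, an element of the product space in which independence is stated.\<close>
  have indepY: "indep_vars (\<lambda>_. borel) ?Y {1..m}"
  proof -
    have "indep_vars (\<lambda>_. borel) (\<lambda>r \<omega>. (\<lambda>f. \<Sum>i<N. (?\<alpha> * c i) * f (?t i)) (\<lambda>t\<in>{0..}. B r t \<omega>)) {1..m}"
    proof (rule indep_vars_compose2[OF indep[unfolded independent_processes_def]])
      fix r
      have "(\<lambda>f. f (?t i)) \<in> borel_measurable (\<Pi>\<^sub>M t\<in>{0::real..}. borel :: real measure)" for i
        using t(2) by (intro measurable_component_singleton) simp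
      then show "(\<lambda>f. \<Sum>i<N. (?\<alpha> * c i) * f (?t i)) \<in> borel_measurable (\<Pi>\<^sub>M t\<in>{0::real..}. borel :: real measure)"
        by (intro borel_measurable_sum borel_measurable_times borel_measurable_const) 
    qed
    then show ?thesis using t(2) by simp
  qed
  have "(\<integral>w. cos ((\<Sum>i<N. c i * w i) + \<phi>) \<partial>Z_law M B m h N \<psi>) =
      (\<integral>\<omega>. cos ((\<Sum>i<N. c i * Z_process B m ?\<theta> ?\<alpha> (?t i) \<omega>) + \<phi>) \<partial>M)"
    unfolding Z_law_def by (subst integral_distr[OF Z1 cosm]) simp
  also have "\<dots> = (\<integral>\<omega>. cos ((\<Sum>r = 1..m. ?Y r \<omega>) + \<phi>') \<partial>M)"
  proof -
    have "(\<Sum>i<N. c i * Z_process B m ?\<theta> ?\<alpha> (?t i) \<omega>) + \<phi> = (\<Sum>r = 1..m. ?Y r \<omega>) + \<phi>'" for \<omega>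
    proof -
      have "(\<Sum>r = 1..m. ?Y r \<omega>) = (\<Sum>i<N. \<Sum>r = 1..m. (?\<alpha> * c i) * B r (?t i) \<omega>)"
        by (rule sum.swap)
      also have "\<dots> = (\<Sum>i<N. c i * (?\<alpha> * (\<Sum>r = 1..m. B r (?t i) \<omega>)))"
        by (simp add: sum_distrib_left mult_ac)
      finally show ?thesis
        by (simp add: Z_process_def \<phi>'_def distrib_left sum.distrib)
    qed
    then show ?thesis by simp
  qed
  also have "\<dots> = Re (cis \<phi>' * char (distr M borel (\<lambda>\<omega>. \<Sum>r = 1..m. ?Y r \<omega>)) 1)"
    by (intro expectation_cos_eq_char[OF M] borel_measurable_sum borel_measurable_times borel_measurable_const B)
  also have "char (distr M borel (\<lambda>\<omega>. \<Sum>r = 1..m. ?Y r \<omega>)) 1 = of_real (exp (- (\<Sum>r = 1..m. q r) / 2))"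
  proof -
    have "(\<Prod>r = 1..m. char (distr M borel (?Y r)) 1) = (\<Prod>r = 1..m. of_real (exp (- q r / 2)))"
      by (intro prod.cong refl charY)
    also have "\<dots> = of_real (exp (\<Sum>r = 1..m. - q r / 2))"
      by (simp only: exp_sum finite_atLeastAtMost of_real_prod)
    also have "(\<Sum>r = 1..m. - q r / 2) = - (\<Sum>r = 1..m. q r) / 2"
      by (simp only: sum_negf sum_divide_distrib[symmetric])
    finally show ?thesis
      unfolding char_distr_sum[OF indepY] .
  qed
  \<comment> \<open>The variance of the combination with coefficients \<open>c\<close> is the
    squared Euclidean norm of \<open>A^T c\<close>, which is the variance on the standard normal
    side.\<close>
  also have "(\<Sum>r = 1..m. q r) = (\<Sum>k<N. (\<Sum>i<N. c i * A i k)\<^sup>2)"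
  proof -
    have "(\<Sum>r = 1..m. q r) = (\<Sum>r = 1..m. \<Sum>i<N. \<Sum>j<N. c i * c j * (\<psi> $ 1 * fbm_cov (H r) (?t i) (?t j)))"
      unfolding q_def using v by (intro sum.cong refl) (simp add: mult_ac)
    also have "\<dots> = (\<Sum>i<N. \<Sum>r = 1..m. \<Sum>j<N. c i * c j * (\<psi> $ 1 * fbm_cov (H r) (?t i) (?t j)))"
      by (rule sum.swap)
    also have "\<dots> = (\<Sum>i<N. \<Sum>j<N. \<Sum>r = 1..m. c i * c j * (\<psi> $ 1 * fbm_cov (H r) (?t i) (?t j)))"
      by (rule sum.cong[OF refl]) (rule sum.swap)
    also have "\<dots> = (\<Sum>i<N. \<Sum>j<N. c i * c j * (\<Sum>k<N. A i k * A j k))"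
      by (intro sum.cong refl) (simp add: A sum_distrib_left)
    also have "\<dots> = (\<Sum>i<N. \<Sum>j<N. \<Sum>k<N. (c i * A i k) * (c j * A j k))"
      by (intro sum.cong refl) (simp add: sum_distrib_left mult_ac)
    also have "\<dots> = (\<Sum>i<N. \<Sum>k<N. \<Sum>j<N. (c i * A i k) * (c j * A j k))"
      by (rule sum.cong[OF refl]) (rule sum.swap)
    also have "\<dots> = (\<Sum>k<N. \<Sum>i<N. \<Sum>j<N. (c i * A i k) * (c j * A j k))"
      by (rule sum.swap)
    also have "\<dots> = (\<Sum>k<N. (\<Sum>i<N. c i * A i k)\<^sup>2)"
      by (simp add: power2_eq_square sum_product)
    finally show ?thesis .
  qed
  also have "Re (cis \<phi>' * of_real (exp (- (\<Sum>k<N. (\<Sum>i<N. c i * A i k)\<^sup>2) / 2))) =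
      exp (- (\<Sum>k<N. (\<Sum>i<N. c i * A i k)\<^sup>2) / 2) * cos \<phi>'"
    by simp
  also have "\<dots> = (\<integral>w. cos ((\<Sum>k<N. (\<Sum>i<N. c i * A i k) * w k) + \<phi>') \<partial>std_normal_vec N)"
    by (rule std_normal_vec_cos[symmetric])
  also have "\<dots> = (\<integral>w. cos ((\<Sum>i<N. c i * affine_image N (\<lambda>i. ?\<theta> * ?t i) A w i) + \<phi>) \<partial>std_normal_vec N)"
  proof -
    have "(\<Sum>k<N. (\<Sum>i<N. c i * A i k) * w k) + \<phi>' =
        (\<Sum>i<N. c i * affine_image N (\<lambda>i. ?\<theta> * ?t i) A w i) + \<phi>" for w
    proof -
      have "(\<Sum>k<N. (\<Sum>i<N. c i * A i k) * w k) = (\<Sum>k<N. \<Sum>i<N. c i * (A i k * w k))"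
        by (simp only: sum_distrib_right mult.assoc)
      also have "\<dots> = (\<Sum>i<N. \<Sum>k<N. c i * (A i k * w k))"
        by (rule sum.swap)
      finally show ?thesis
        by (simp add: \<phi>'_def affine_image_def distrib_left sum.distrib sum_distrib_left)
    qed
    then show ?thesis by simp
  qed
  also have "\<dots> = (\<integral>w. cos ((\<Sum>i<N. c i * w i) + \<phi>) \<partial>distr (std_normal_vec N) (sample_space N) (affine_image N (\<lambda>i. ?\<theta> * ?t i) A))"
    by (rule integral_distr[OF A1 cosm, symmetric])
  finally show "(\<integral>w. cos ((\<Sum>i\<in>{..<N}. c i * w i) + \<phi>) \<partial>Z_law M B m h N \<psi>) =
     (\<integral>w. cos ((\<Sum>i\<in>{..<N}. c i * w i) + \<phi>) \<partial>distr (std_normal_vec N) (sample_space N) (affine_image N (\<lambda>i. ?\<theta> * ?t i) A))" .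
qed simp

subsection \<open>Gram factorizations and the multivariate normal density\<close>


text \<open>A right inverse suffices: the determinants multiply to 1, so \<open>mat_inverse\<close>
  does return a matrix, and two-sided inverses are unique.\<close>

lemma mat_inverse_eqI:
  fixes A X :: "'a :: field mat"
  assumes A: "A \<in> carrier_mat n n" and X: "X \<in> carrier_mat n n" and AX: "A * X = 1\<^sub>m n"
  shows "the (mat_inverse A) = X"
proof -
  have "det A * det X = det (1\<^sub>m n :: 'a mat)"
    unfolding AX[symmetric] by (rule det_mult[OF A X, symmetric])
  then have "det A \<noteq> 0" by (auto simp: det_one)
  then have "A \<in> Units (ring_mat TYPE('a) n ())"
    by (rule det_non_zero_imp_unit[OF A])
  then obtain B where B: "mat_inverse A = Some B"
    using mat_inverse(1)[OF A, of "()"] by (cases "mat_inverse A") auto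
  have "B * A = 1\<^sub>m n" "B \<in> carrier_mat n n"
    using mat_inverse(2)[OF A B] by auto
  then have "B = B * (A * X)" "B * (A * X) = X"
    using AX A X assoc_mult_mat[of B n n A n X n] by simp_all
  then show ?thesis using B by simp
qed

lemma mat_inverse_exists:
  fixes A :: "'a :: field mat"
  assumes A: "A \<in> carrier_mat n n" and "det A \<noteq> 0"
  obtains B where "B \<in> carrier_mat n n" "A * B = 1\<^sub>m n" "B * A = 1\<^sub>m n"
proof -
  have "A \<in> Units (ring_mat TYPE('a) n ())"
    by (rule det_non_zero_imp_unit[OF assms])
  then obtain B where "mat_inverse A = Some B"
    using mat_inverse(1)[OF A, of "()"] by (cases "mat_inverse A") auto
  from mat_inverse(2)[OF A this] that show ?thesis by auto
qed

lemma mat_inverse_gram: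
  fixes A :: "real mat"
  assumes A: "A \<in> carrier_mat n n" and B: "B \<in> carrier_mat n n"
    and AB: "A * B = 1\<^sub>m n" and BA: "B * A = 1\<^sub>m n" and v: "v \<noteq> 0"
  shows "the (mat_inverse (v \<cdot>\<^sub>m (A * transpose_mat A))) = (1 / v) \<cdot>\<^sub>m (transpose_mat B * B)"
proof (rule mat_inverse_eqI)
  let ?At = "transpose_mat A" and ?Bt = "transpose_mat B"
  have At: "?At \<in> carrier_mat n n" and Bt: "?Bt \<in> carrier_mat n n"
    using A B by auto
  have "?At * ?Bt = 1\<^sub>m n"
    using transpose_mult[OF B A] BA by simp
  then have "(A * ?At) * (?Bt * B) = 1\<^sub>m n"
    using A B At Bt AB assoc_mult_mat[of A n n ?At n "?Bt * B" n] assoc_mult_mat[of ?At n n ?Bt n B n]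
    by simp
  then show "v \<cdot>\<^sub>m (A * ?At) * ((1 / v) \<cdot>\<^sub>m (?Bt * B)) = 1\<^sub>m n"
    using A B At Bt v mult_smult_assoc_mat[of "A * ?At" n n "(1 / v) \<cdot>\<^sub>m (?Bt * B)" n v]
      mult_smult_distrib[of "A * ?At" n n "?Bt * B" n "1 / v"]
    by (simp, intro eq_matI) auto
qed (use A B in auto)

text \<open>Together with \<open>mat_inverse_gram\<close> this turns every quadratic form in an
  inverse covariance into a Euclidean inner product of whitened vectors.\<close>

lemma gram_form:
  fixes B :: "real mat"
  assumes B: "B \<in> carrier_mat n n" and u: "u \<in> carrier_vec n" and x: "x \<in> carrier_vec n"
  shows "u \<bullet> ((k \<cdot>\<^sub>m (transpose_mat B * B)) *\<^sub>v x) = k * ((B *\<^sub>v u) \<bullet> (B *\<^sub>v x))"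
proof -
  have Bt: "transpose_mat B \<in> carrier_mat n n" and Bx: "B *\<^sub>v x \<in> carrier_vec n" and Bu: "B *\<^sub>v u \<in> carrier_vec n"
    using assms by auto
  have "(k \<cdot>\<^sub>m (transpose_mat B * B)) *\<^sub>v x = k \<cdot>\<^sub>v (transpose_mat B *\<^sub>v (B *\<^sub>v x))"
  proof -
    have "(k \<cdot>\<^sub>m M) *\<^sub>v x = k \<cdot>\<^sub>v (M *\<^sub>v x)" if "M \<in> carrier_mat n n" for M
      using that x by (intro eq_vecI) (auto simp: scalar_prod_def sum_distrib_left mult.assoc)
    from this[of "transpose_mat B * B"] show ?thesis
      using B Bt assoc_mult_mat_vec[OF Bt B x] by simp
  qed
  then have "u \<bullet> ((k \<cdot>\<^sub>m (transpose_mat B * B)) *\<^sub>v x) = k * (u \<bullet> (transpose_mat B *\<^sub>v (B *\<^sub>v x)))"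
    using u Bt Bx by simp
  also have "u \<bullet> (transpose_mat B *\<^sub>v (B *\<^sub>v x)) = (transpose_mat B *\<^sub>v (B *\<^sub>v x)) \<bullet> u"
    using u Bt Bx by (intro comm_scalar_prod[of _ n]) auto
  also have "\<dots> = (B *\<^sub>v x) \<bullet> (B *\<^sub>v u)"
    by (rule transpose_vec_mult_scalar[OF B u Bx])
  also have "\<dots> = (B *\<^sub>v u) \<bullet> (B *\<^sub>v x)"
    by (rule comm_scalar_prod[OF Bx Bu])
  finally show ?thesis .
qed

text \<open>Kept for an arbitrary invertible square root: the triangular one is used to verify the
  density, the rotated one to read it in canonical coordinates.\<close>

lemma mvn_density_gram:
  assumes A: "A \<in> carrier_mat N N" and B: "B \<in> carrier_mat N N"
    and AB: "A * B = 1\<^sub>m N" and BA: "B * A = 1\<^sub>m N" and v: "0 < v"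
    and \<mu>: "\<mu> \<in> carrier_vec N"
  shows "mvn_density N \<mu> (v \<cdot>\<^sub>m (A * transpose_mat A)) z =
    exp (- ((B *\<^sub>v (vec N z - \<mu>)) \<bullet> (B *\<^sub>v (vec N z - \<mu>))) / (2 * v)) /
    sqrt ((2 * pi) ^ N * (v ^ N * (det A)\<^sup>2))"
proof -
  have x: "vec N z - \<mu> \<in> carrier_vec N" using \<mu> by auto
  have "det (v \<cdot>\<^sub>m (A * transpose_mat A)) = v ^ N * (det A)\<^sup>2"
    using A det_mult[OF A, of "transpose_mat A"] det_transpose[OF A] by (simp add: power2_eq_square)
  then show ?thesis
    unfolding mvn_density_def using v
    by (simp add: mat_inverse_gram[OF A B AB BA] gram_form[OF B x x])
qed

lemma mvn_density_measurable:
  assumes \<mu>: "\<mu> \<in> carrier_vec N" and S: "the (mat_inverse \<Sigma>) \<in> carrier_mat N N"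
  shows "mvn_density N \<mu> \<Sigma> \<in> borel_measurable (sample_space N)"
proof -
  let ?M = "the (mat_inverse \<Sigma>)"
  have "(vec N z - \<mu>) \<bullet> (?M *\<^sub>v (vec N z - \<mu>)) =
      (\<Sum>i<N. (z i - \<mu> $ i) * (\<Sum>j<N. ?M $$ (i, j) * (z j - \<mu> $ j)))" for z
    using \<mu> S by (auto simp: scalar_prod_def lessThan_atLeast0 intro!: sum.cong)
  then have eq: "mvn_density N \<mu> \<Sigma> = (\<lambda>z. exp (- (\<Sum>i<N. (z i - \<mu> $ i) * (\<Sum>j<N. ?M $$ (i, j) * (z j - \<mu> $ j))) / 2) /
      sqrt ((2 * pi) ^ N * det \<Sigma>))"
    by (simp add: mvn_density_def fun_eq_iff)
  have [measurable]: "(\<lambda>z. \<Sum>i<N. (z i - \<mu> $ i) * (\<Sum>j<N. ?M $$ (i, j) * (z j - \<mu> $ j))) \<in> borel_measurable (sample_space N)"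
    unfolding sample_space_def by measurable
  show ?thesis
    unfolding eq by measurable
qed

text \<open>Whitening undoes the map, so the exponent becomes the standard one, and the square root
  of \<open>(det A)^2\<close> in the normalization cancels against the Jacobian.\<close>

lemma mvn_density_triangular:
  assumes L: "\<And>i. i < N \<Longrightarrow> 0 < L i i" "\<And>i j. i < j \<Longrightarrow> L i j = 0"
    and \<Sigma>: "\<Sigma> = mat N N (\<lambda>(i, j). \<Sum>k<N. L i k * L j k)" and \<mu>: "\<mu> \<in> carrier_vec N"
  shows "distr (std_normal_vec N) (sample_space N) (affine_image N (\<lambda>i. \<mu> $ i) L) =
    density (sample_space N) (\<lambda>z. ennreal (mvn_density N \<mu> \<Sigma> z))"
proof (rule triangular_image_density[OF L])
  define A where "A = mat N N (\<lambda>(i, j). L i j)"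
  have A: "A \<in> carrier_mat N N" by (simp add: A_def)
  have "det A = prod_list (diag_mat A)"
    by (rule det_lower_triangular[OF _ A]) (use L(2) in \<open>auto simp: A_def\<close>)
  also have "\<dots> = (\<Prod>i<N. L i i)"
    by (simp add: prod_list_diag_prod A_def lessThan_atLeast0)
  finally have detA: "det A = (\<Prod>i<N. L i i)" .
  have pos: "0 < (\<Prod>i<N. L i i)"
    using L(1) by (intro prod_pos) simp
  then have "det A \<noteq> 0" unfolding detA by (metis less_irrefl)
  then obtain B where B: "B \<in> carrier_mat N N" "A * B = 1\<^sub>m N" "B * A = 1\<^sub>m N"
    using mat_inverse_exists[OF A] by blast
  \<comment> \<open>The scalar 1 puts the covariance in the shape
    \<open>v \<cdot>\<^sub>m (A * transpose_mat A)\<close> expected by the Gram lemmas.\<close>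
  have \<Sigma>A: "\<Sigma> = 1 \<cdot>\<^sub>m (A * transpose_mat A)"
    unfolding \<Sigma> A_def by (intro eq_matI) (auto simp: scalar_prod_def lessThan_atLeast0)
  have "the (mat_inverse \<Sigma>) \<in> carrier_mat N N"
    unfolding \<Sigma>A mat_inverse_gram[OF A B one_neq_zero] using B by auto
  then show "mvn_density N \<mu> \<Sigma> \<in> borel_measurable (sample_space N)"
    by (rule mvn_density_measurable[OF \<mu>])
  fix w :: "nat \<Rightarrow> real"
  have "vec N (affine_image N (\<lambda>i. \<mu> $ i) L w) - \<mu> = A *\<^sub>v vec N w"
    using \<mu> by (intro eq_vecI) (auto simp: affine_image_def A_def scalar_prod_def lessThan_atLeast0)
  then have "B *\<^sub>v (vec N (affine_image N (\<lambda>i. \<mu> $ i) L w) - \<mu>) = vec N w"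
    using assoc_mult_mat_vec[OF B(1) A, of "vec N w"] B by simp
  moreover have "vec N w \<bullet> vec N w = (\<Sum>k<N. (w k)\<^sup>2)"
    by (simp add: scalar_prod_def lessThan_atLeast0 power2_eq_square)
  ultimately have "mvn_density N \<mu> \<Sigma> (affine_image N (\<lambda>i. \<mu> $ i) L w) =
      exp (- (\<Sum>k<N. (w k)\<^sup>2) / 2) / sqrt ((2 * pi) ^ N * (1 ^ N * (det A)\<^sup>2))"
    unfolding \<Sigma>A by (subst mvn_density_gram[OF A B _ \<mu>]) simp_all
  also have "\<dots> = exp (- (\<Sum>k<N. (w k)\<^sup>2) / 2) / (sqrt (2 * pi) ^ N * (\<Prod>i<N. L i i))"
    unfolding detA using pos
    by (simp only: power_one mult_1 real_sqrt_mult[of "(2 * pi) ^ N"] real_sqrt_power[of "2 * pi"]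
        real_sqrt_abs abs_of_pos)
  finally have eq: "mvn_density N \<mu> \<Sigma> (affine_image N (\<lambda>i. \<mu> $ i) L w) =
      exp (- (\<Sum>k<N. (w k)\<^sup>2) / 2) / (sqrt (2 * pi) ^ N * (\<Prod>i<N. L i i))" .
  have "(\<Prod>i<N. std_normal_density (w i)) = (\<Prod>i<N. exp (- (w i)\<^sup>2 / 2) / sqrt (2 * pi))"
    by (simp add: std_normal_density_def)
  also have "\<dots> = exp (\<Sum>i<N. - (w i)\<^sup>2 / 2) / sqrt (2 * pi) ^ N"
    by (simp add: prod_dividef exp_sum)
  also have "(\<Sum>i<N. - (w i)\<^sup>2 / 2) = - (\<Sum>k<N. (w k)\<^sup>2) / 2"
    by (simp only: sum_negf sum_divide_distrib[symmetric])
  finally show "(\<Prod>i<N. L i i) * mvn_density N \<mu> \<Sigma> (affine_image N (\<lambda>i. \<mu> $ i) L w) = (\<Prod>i<N. std_normal_density (w i))"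
    unfolding eq using less_imp_neq[OF pos] by (simp del: prod_zero_iff)
qed

section \<open>Rotating a square root towards the drift direction\<close>

text \<open>A Householder reflection; if \<open>x\<close> is the first basis vector then \<open>s = 0\<close>, so \<open>\<beta> = 2 / s = 0\<close>
  and \<open>Q\<close> is the identity.\<close>

lemma orthogonal_first_column:
  assumes x: "x \<in> carrier_vec n" "x \<bullet> x = (1 :: real)" and n: "0 < n"
  obtains Q where "Q \<in> carrier_mat n n" "Q * transpose_mat Q = 1\<^sub>m n" "col Q 0 = x"
proof -
  define e where "e i = (if i = 0 then 1 else 0 :: real)" for i :: nat
  define u where "u i = e i - x $ i" for i
  define s where "s = (\<Sum>k<n. u k * u k)"
  define \<beta> where "\<beta> = 2 / s"
  define Q where "Q = mat n n (\<lambda>(i, j). (if i = j then 1 else 0) - \<beta> * u i * u j)"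
  have xx: "(\<Sum>k<n. x $ k * x $ k) = 1"
    using x by (simp add: scalar_prod_def lessThan_atLeast0)
  have "s = (\<Sum>k<n. e k * e k) - 2 * (\<Sum>k<n. e k * x $ k) + (\<Sum>k<n. x $ k * x $ k)"
    by (simp add: s_def u_def sum_subtractf sum.distrib sum_distrib_left algebra_simps)
  also have "\<dots> = 2 * u 0"
    using n xx by (simp add: e_def u_def if_distrib[of "\<lambda>z. z * _"] cong: if_cong)
  \<comment> \<open>Since \<open>x\<close> is a unit vector, the squared norm of e - x is 2 - 2
    \<open>x $ 0\<close>. Hence \<open>\<beta> * u 0\<close> is 1 when \<open>s\<close> is nonzero,
    and the first column is e - u = x.\<close>
  finally have s: "s = 2 * u 0" .
  have u0: "u k = 0" if "s = 0" "k < n" for k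
    using that sum_nonneg_eq_0_iff[of "{..<n}" "\<lambda>k. u k * u k"] by (simp add: s_def)
  have Q: "Q \<in> carrier_mat n n" by (simp add: Q_def)
  have "Q * transpose_mat Q = 1\<^sub>m n"
  proof (rule eq_matI)
    fix i j assume "i < dim_row (1\<^sub>m n :: real mat)" "j < dim_col (1\<^sub>m n :: real mat)"
    then have ij: "i < n" "j < n" by auto
    have "(Q * transpose_mat Q) $$ (i, j) =
        (\<Sum>k<n. ((if i = k then 1 else 0) - \<beta> * u i * u k) * ((if j = k then 1 else 0) - \<beta> * u j * u k))"
      using ij by (simp add: Q_def scalar_prod_def lessThan_atLeast0)
    also have "\<dots> = (\<Sum>k<n. (if i = k then (if j = k then 1 else 0) else 0)
        - (if i = k then \<beta> * u j * u k else 0) - (if j = k then \<beta> * u i * u k else 0)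
        + \<beta> * \<beta> * u i * u j * (u k * u k))"
      by (intro sum.cong refl) (simp add: algebra_simps)
    also have "\<dots> = (if i = j then 1 else 0) - \<beta> * u j * u i - \<beta> * u i * u j + \<beta> * \<beta> * u i * u j * s"
      using ij by (simp add: sum_subtractf sum.distrib s_def sum_distrib_left)
    also have "\<dots> = (if i = j then 1 else 0)"
      by (cases "s = 0") (simp_all add: \<beta>_def field_simps)
    finally show "(Q * transpose_mat Q) $$ (i, j) = 1\<^sub>m n $$ (i, j)"
      using ij by simp
  qed (use Q in auto)
  moreover have "col Q 0 = x"
  proof (rule eq_vecI)
    fix i assume "i < dim_vec x"
    then have i: "i < n" using x by auto
    have "col Q 0 $ i = e i - \<beta> * u i * u 0"
      using i n by (simp add: Q_def e_def)
    also have "\<dots> = e i - u i"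
      using s u0[of i] i by (cases "s = 0") (simp_all add: \<beta>_def)
    also have "\<dots> = x $ i" by (simp add: u_def)
    finally show "col Q 0 $ i = x $ i" .
  qed (use Q x in auto)
  ultimately show ?thesis using that Q by blast
qed

text \<open>Right multiplication of \<open>L\<close> by an orthogonal \<open>Q\<close> preserves the
  Gram matrix and makes the first column \<open>L x\<close>, where \<open>x\<close> is the first
  column of \<open>Q\<close>. Taking \<open>x\<close> as the normalized \<open>L^(-1) T\<close> puts
  this column on the ray of \<open>T\<close>, with \<open>c\<close> the norm of
  \<open>L^(-1) T\<close>.\<close>

lemma gram_factor_along:
  fixes L :: "real mat"
  assumes L: "L \<in> carrier_mat n n" and det: "det L \<noteq> 0" and n: "0 < n"
    and T: "T \<in> carrier_vec n" "T \<noteq> 0\<^sub>v n"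
  obtains A B c where "A \<in> carrier_mat n n" "B \<in> carrier_mat n n" "A * B = 1\<^sub>m n" "B * A = 1\<^sub>m n"
    "A * transpose_mat A = L * transpose_mat L" "0 < c" "T = c \<cdot>\<^sub>v col A 0"
proof -
  obtain K where K: "K \<in> carrier_mat n n" "L * K = 1\<^sub>m n" "K * L = 1\<^sub>m n"
    using mat_inverse_exists[OF L det] by blast
  define \<tau> where "\<tau> = K *\<^sub>v T"
  have \<tau>: "\<tau> \<in> carrier_vec n" using K T by (simp add: \<tau>_def)
  have L\<tau>: "L *\<^sub>v \<tau> = T"
    using assoc_mult_mat_vec[OF L K(1) T(1)] K T by (simp add: \<tau>_def)
  have "\<tau> \<noteq> 0\<^sub>v n"
  proof
    assume "\<tau> = 0\<^sub>v n"
    then have "T = 0\<^sub>v n" using L\<tau> L by (simp add: mult_mat_vec_def) (auto intro!: eq_vecI)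
    with T show False by simp
  qed
  then obtain k where k: "k < n" "\<tau> $ k \<noteq> 0"
    using \<tau> by (auto simp: vec_eq_iff)
  define c where "c = sqrt (\<tau> \<bullet> \<tau>)"
  have "0 < (\<Sum>i<n. \<tau> $ i * \<tau> $ i)"
    using k by (intro sum_pos2[of _ k]) (auto simp: zero_less_mult_iff linorder_neq_iff)
  then have \<tau>\<tau>: "0 < \<tau> \<bullet> \<tau>" using \<tau> by (simp add: scalar_prod_def lessThan_atLeast0)
  then have c: "0 < c" "c * c = \<tau> \<bullet> \<tau>" by (simp_all add: c_def)
  define x where "x = (1 / c) \<cdot>\<^sub>v \<tau>"
  have x: "x \<in> carrier_vec n" "x \<bullet> x = 1"
    using \<tau> c by (simp_all add: x_def flip: c(2))
  obtain Q where Q: "Q \<in> carrier_mat n n" "Q * transpose_mat Q = 1\<^sub>m n" "col Q 0 = x"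
    using orthogonal_first_column[OF x n] by blast
  define A where "A = L * Q"
  have A: "A \<in> carrier_mat n n" using L Q by (simp add: A_def)
  have Qt: "transpose_mat Q \<in> carrier_mat n n" using Q by simp
  have "det Q * det (transpose_mat Q) = det (1\<^sub>m n :: real mat)"
    unfolding Q(2)[symmetric] by (rule det_mult[OF Q(1) Qt, symmetric])
  then have "det Q \<noteq> 0" by (auto simp: det_one)
  then have "det A \<noteq> 0" using det det_mult[OF L Q(1)] by (simp add: A_def)
  then obtain B where B: "B \<in> carrier_mat n n" "A * B = 1\<^sub>m n" "B * A = 1\<^sub>m n"
    using mat_inverse_exists[OF A] by blast
  have "A * transpose_mat A = L * (Q * (transpose_mat Q * transpose_mat L))"
    unfolding A_def transpose_mult[OF L Q(1)] using L Q Qt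
    by (intro assoc_mult_mat[of _ n n _ n _ n]) auto
  also have "Q * (transpose_mat Q * transpose_mat L) = (Q * transpose_mat Q) * transpose_mat L"
    using L Q Qt by (intro assoc_mult_mat[symmetric, of _ n n _ n _ n]) auto
  finally have "A * transpose_mat A = L * transpose_mat L"
    using L Q by simp
  moreover have "T = c \<cdot>\<^sub>v col A 0"
  proof -
    have "col A 0 = L *\<^sub>v x"
      unfolding A_def using col_mult2[OF L Q(1) n] Q by simp
    also have "\<dots> = (1 / c) \<cdot>\<^sub>v T"
      unfolding x_def using mult_mat_vec[OF L \<tau>] L\<tau> by simp
    finally show ?thesis
      using c by (intro eq_vecI) auto
  qed
  ultimately show ?thesis using that A B c(1) by blast
qed

subsection \<open>Exponential tilting and Gaussian moments\<close>


text \<open>Convexity bounds the exponential by its chords from 0 to plus or minus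
  \<open>\<kappa> * s\<close>. The resulting bound does not depend on \<open>u\<close>, as dominated
  convergence demands.\<close>

lemma exp_diff_quotient_bound:
  fixes s u \<kappa> :: real
  assumes "0 < u" "u \<le> \<kappa>"
  shows "\<bar>(exp (u * s) - 1) / u\<bar> \<le> (exp (\<kappa> * s) + exp (- \<kappa> * s)) / \<kappa>"
proof -
  define r X where "r = u / \<kappa>" and "X = exp (\<kappa> * s) + exp (- \<kappa> * s)"
  have r: "0 \<le> r" "r \<le> 1" and ru: "r * \<kappa> = u" using assms by (auto simp: r_def)
  have conv: "exp (r * y) \<le> 1 - r + r * exp y" for y
    using convex_onD[OF exp_convex r, of 0 y] by simp
  have u: "r * (\<kappa> * s) = u * s" "r * (- \<kappa> * s) = - (u * s)"
    by (simp_all add: ru[symmetric])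
  have up: "exp (u * s) - 1 \<le> r * exp (\<kappa> * s) - r"
    using conv[of "\<kappa> * s"] unfolding u by simp
  have "exp (- (u * s)) - 1 \<le> r * exp (- \<kappa> * s) - r"
    using conv[of "- \<kappa> * s"] unfolding u by simp
  \<comment> \<open>Equivalent to cosh being at least 1; it reduces the lower bound to the chord
    estimate at the reflected point.\<close>
  moreover have "1 - exp (u * s) \<le> exp (- (u * s)) - 1"
    using exp_ge_add_one_self[of "u * s"] exp_ge_add_one_self[of "- (u * s)"] by linarith
  ultimately have lo: "1 - exp (u * s) \<le> r * exp (- \<kappa> * s) - r" by linarith
  have X: "r * X = r * exp (\<kappa> * s) + r * exp (- \<kappa> * s)"
    by (simp add: X_def distrib_left)
  have "0 \<le> r * exp (\<kappa> * s)" "0 \<le> r * exp (- \<kappa> * s)"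
    using r by (auto intro!: mult_nonneg_nonneg)
  with up lo r X have "\<bar>exp (u * s) - 1\<bar> \<le> r * X" by linarith
  then have "\<bar>exp (u * s) - 1\<bar> / u \<le> r * X / u"
    using assms by (intro divide_right_mono) auto
  also have "r * X / u = X / \<kappa>"
    using assms by (simp add: r_def)
  finally show ?thesis
    using assms by (simp add: X_def)
qed

text \<open>The difference quotients are dominated by the tilts at \<open>t + \<kappa>\<close> and
  \<open>t - \<kappa>\<close>, integrable by assumption, so nothing else about the size of
  \<open>F\<close> or \<open>s\<close> is required. The conclusion has the form of the hypothesis,
  with \<open>F\<close> multiplied by \<open>s\<close>, which allows iteration.\<close>

lemma exp_tilt_zero_integral_deriv:
  fixes F s :: "'a \<Rightarrow> real"
  assumes [measurable]: "F \<in> borel_measurable M" "s \<in> borel_measurable M"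
    and zero: "\<And>t. \<bar>t\<bar> < \<delta> \<Longrightarrow> has_bochner_integral M (\<lambda>z. F z * exp (t * s z)) 0"
    and t: "\<bar>t\<bar> < \<delta>"
  shows "has_bochner_integral M (\<lambda>z. F z * s z * exp (t * s z)) 0"
proof -
  \<comment> \<open>Half the distance from \<open>t\<close> to the boundary, so that both
    neighbouring tilts stay inside the interval.\<close>
  define \<kappa> where "\<kappa> = (\<delta> - \<bar>t\<bar>) / 2"
  have \<kappa>: "0 < \<kappa>" "\<bar>t + \<kappa>\<bar> < \<delta>" "\<bar>t - \<kappa>\<bar> < \<delta>"
    using t by (auto simp: \<kappa>_def field_simps abs_if)
  define u where "u n = \<kappa> / Suc n" for n :: nat
  have u: "0 < u n" "u n \<le> \<kappa>" for n
    using \<kappa> by (auto simp: u_def field_simps)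
  have tu: "\<bar>t + u n\<bar> < \<delta>" for n
    using \<kappa> u[of n] t by linarith
  have u0: "filterlim u (at 0) sequentially"
    unfolding filterlim_at
  proof
    show "u \<longlonglongrightarrow> 0"
      unfolding u_def divide_inverse
      using tendsto_mult_left[OF LIMSEQ_inverse_real_of_nat, of \<kappa>] by simp
    show "\<forall>\<^sub>F n in sequentially. u n \<in> UNIV \<and> u n \<noteq> 0"
      using u(1) by (simp add: less_imp_neq[THEN not_sym])
  qed
  let ?q = "\<lambda>n z. F z * (exp ((t + u n) * s z) - exp (t * s z)) / u n"
  let ?f = "\<lambda>z. F z * s z * exp (t * s z)"
  let ?w = "\<lambda>z. (\<bar>F z * exp ((t + \<kappa>) * s z)\<bar> + \<bar>F z * exp ((t - \<kappa>) * s z)\<bar>) / \<kappa>"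
  have qint: "has_bochner_integral M (?q n) 0" for n
  proof -
    have "has_bochner_integral M (\<lambda>z. (F z * exp ((t + u n) * s z) - F z * exp (t * s z)) / u n) ((0 - 0) / u n)"
      by (intro has_bochner_integral_divide_zero has_bochner_integral_diff zero t tu)
    then show ?thesis by (simp add: right_diff_distrib)
  qed
  have w: "integrable M ?w"
    using zero[OF \<kappa>(2)] zero[OF \<kappa>(3)]
    by (intro integrable_divide_zero Bochner_Integration.integrable_add integrable_abs)
      (auto simp: has_bochner_integral_iff)
  have lim: "AE z in M. (\<lambda>n. ?q n z) \<longlonglongrightarrow> ?f z"
  proof (rule AE_I2)
    fix z
    have "((\<lambda>x. exp (x * s z)) has_field_derivative s z * exp (t * s z)) (at t)"
      by (auto intro!: derivative_eq_intros)
    then have "((\<lambda>h. (exp ((t + h) * s z) - exp (t * s z)) / h) \<longlongrightarrow> s z * exp (t * s z)) (at 0)"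
      by (simp add: DERIV_def)
    then have "(\<lambda>n. (exp ((t + u n) * s z) - exp (t * s z)) / u n) \<longlonglongrightarrow> s z * exp (t * s z)"
      using filterlim_compose[OF _ u0] by fast
    then have "(\<lambda>n. F z * ((exp ((t + u n) * s z) - exp (t * s z)) / u n)) \<longlonglongrightarrow> F z * (s z * exp (t * s z))"
      by (rule tendsto_mult_left)
    then show "(\<lambda>n. ?q n z) \<longlonglongrightarrow> ?f z"
      by (simp only: times_divide_eq_right mult.assoc)
  qed
  have bound: "AE z in M. norm (?q n z) \<le> ?w z" for n
  proof (rule AE_I2)
    fix z
    have "?q n z = F z * exp (t * s z) * ((exp (u n * s z) - 1) / u n)"
    proof -
      have "exp ((t + u n) * s z) = exp (t * s z) * exp (u n * s z)"
        by (simp add: exp_add[symmetric] distrib_right)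
      then show ?thesis by (simp add: right_diff_distrib)
    qed
    then have "norm (?q n z) = \<bar>F z\<bar> * exp (t * s z) * \<bar>(exp (u n * s z) - 1) / u n\<bar>"
      by (simp only: real_norm_def abs_mult abs_exp_cancel)
    also have "\<dots> \<le> \<bar>F z\<bar> * exp (t * s z) * ((exp (\<kappa> * s z) + exp (- \<kappa> * s z)) / \<kappa>)"
      by (intro mult_left_mono exp_diff_quotient_bound u) auto
    also have "\<dots> = ?w z"
    proof -
      have e: "exp ((t + \<kappa>) * s z) = exp (t * s z) * exp (\<kappa> * s z)"
        "exp ((t - \<kappa>) * s z) = exp (t * s z) * exp (- \<kappa> * s z)"
        by (simp_all add: exp_add[symmetric] distrib_right left_diff_distrib)
      have "x * y * ((p + q) / \<kappa>) = (x * (y * p) + x * (y * q)) / \<kappa>" for x y p q :: real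
        by (simp add: distrib_left mult.assoc)
      then show ?thesis
        unfolding e abs_mult abs_exp_cancel .
    qed
    finally show "norm (?q n z) \<le> ?w z" .
  qed
  have m: "?f \<in> borel_measurable M" "\<And>n. ?q n \<in> borel_measurable M"
    by measurable
  have "integrable M ?f"
    by (rule integrable_dominated_convergence[OF m w lim bound])
  moreover have "(\<lambda>n. integral\<^sup>L M (?q n)) \<longlonglongrightarrow> integral\<^sup>L M ?f"
    by (rule integral_dominated_convergence[OF m w lim bound])
  then have "integral\<^sup>L M ?f = 0"
    unfolding has_bochner_integral_integral_eq[OF qint] by (simp only: LIMSEQ_const_iff)
  ultimately show ?thesis
    by (simp add: has_bochner_integral_iff)
qed

section \<open>Moments of coordinates of a standard normal vector\<close>

lemma std_normal_vec_integral_component: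
  fixes f :: "real \<Rightarrow> real"
  assumes "i < N" "has_bochner_integral std_normal_distribution f x"
  shows "has_bochner_integral (std_normal_vec N) (\<lambda>w. f (w i)) x"
proof -
  interpret S: prob_space std_normal_distribution by (rule prob_space_normal_density) simp
  interpret P: product_prob_space "\<lambda>_::nat. std_normal_distribution" "{..<N}" ..
  have D: "distr (std_normal_vec N) std_normal_distribution (\<lambda>w. w i) = std_normal_distribution"
    using P.PiM_component[of i] assms(1) by simp
  have m: "(\<lambda>w. w i) \<in> measurable (std_normal_vec N) std_normal_distribution"
    using assms(1) by (intro measurable_component_singleton) simp
  have f: "integrable std_normal_distribution f" "integral\<^sup>L std_normal_distribution f = x"
    using assms(2) by (simp_all add: has_bochner_integral_iff)
  note fm = borel_measurable_integrable[OF f(1)]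
  show ?thesis
    using integrable_distr_eq[OF m fm] integral_distr[OF m fm] f unfolding D
    by (simp only: has_bochner_integral_iff)
qed

lemma std_normal_vec_integral_component2:
  fixes f g :: "real \<Rightarrow> real"
  assumes ij: "i < N" "j < N" "i \<noteq> j"
    and f: "has_bochner_integral std_normal_distribution f x"
    and g: "has_bochner_integral std_normal_distribution g y"
  shows "has_bochner_integral (std_normal_vec N) (\<lambda>w. f (w i) * g (w j)) (x * y)"
proof -
  interpret S: prob_space std_normal_distribution by (rule prob_space_normal_density) simp
  interpret P: product_sigma_finite "\<lambda>_::nat. std_normal_distribution" ..
  define F where "F k = (if k = i then f else if k = j then g else (\<lambda>_. 1))" for k
  have int: "integrable std_normal_distribution (F k)" for k
    using f g by (auto simp: F_def has_bochner_integral_iff)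
  have split: "(\<Prod>k<N. h k) = h i * h j" if "\<And>k. k \<noteq> i \<Longrightarrow> k \<noteq> j \<Longrightarrow> h k = 1" for h :: "nat \<Rightarrow> real"
  proof -
    have "(\<Prod>k<N. h k) = (\<Prod>k\<in>{i, j}. h k)"
      using ij that by (intro prod.mono_neutral_right) auto
    then show ?thesis using ij by simp
  qed
  have F: "(\<Prod>k<N. F k (w k)) = f (w i) * g (w j)" for w
    using ij split[of "\<lambda>k. F k (w k)"] by (simp add: F_def)
  have "(\<integral>w. (\<Prod>k<N. F k (w k)) \<partial>std_normal_vec N) = (\<Prod>k<N. integral\<^sup>L std_normal_distribution (F k))"
    by (rule P.product_integral_prod) (use int in auto)
  also have "\<dots> = x * y"
  proof (subst split)
    have "measure std_normal_distribution UNIV = 1"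
      using S.prob_space by simp
    then show "integral\<^sup>L std_normal_distribution (F k) = 1" if "k \<noteq> i" "k \<noteq> j" for k
      using that by (simp add: F_def)
    show "integral\<^sup>L std_normal_distribution (F i) * integral\<^sup>L std_normal_distribution (F j) = x * y"
      using ij f g by (simp add: F_def has_bochner_integral_iff)
  qed
  finally show ?thesis
    using P.product_integrable_prod[of "{..<N}" F] int by (simp add: F has_bochner_integral_iff)
qed

lemma std_normal_moments:
  "has_bochner_integral std_normal_distribution (\<lambda>x. x) 0"
  "has_bochner_integral std_normal_distribution (\<lambda>x. x\<^sup>2) 1"
  "has_bochner_integral std_normal_distribution (\<lambda>x. x\<^sup>2 - 1) 0"
  "has_bochner_integral std_normal_distribution (\<lambda>x. (x\<^sup>2 - 1) * (x\<^sup>2 - 1)) 2"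
  "has_bochner_integral std_normal_distribution (\<lambda>x. x * (x\<^sup>2 - 1)) 0"
proof -
  have hbi: "has_bochner_integral std_normal_distribution (\<lambda>x. x ^ k) (integral\<^sup>L std_normal_distribution (\<lambda>x. x ^ k))" for k
    using integrable_std_normal_distribution_moment[of k] by (simp add: has_bochner_integral_iff)
  have 0: "has_bochner_integral std_normal_distribution (\<lambda>x. 1) (1 :: real)"
    using hbi[of 0] std_normal_distribution_even_moments(1)[of 0] by simp
  show 1: "has_bochner_integral std_normal_distribution (\<lambda>x. x) 0"
    using hbi[of 1] integral_std_normal_distribution_moment_odd[of 1] by simp
  show 2: "has_bochner_integral std_normal_distribution (\<lambda>x. x\<^sup>2) 1"
    using hbi[of 2] std_normal_distribution_even_moments(1)[of 1] by simp
  have 3: "has_bochner_integral std_normal_distribution (\<lambda>x. x ^ 3) 0"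
    using hbi[of 3] integral_std_normal_distribution_moment_odd[of 3] by simp
  have 4: "has_bochner_integral std_normal_distribution (\<lambda>x. x ^ 4) 3"
    using hbi[of 4] std_normal_distribution_even_moments(1)[of 2] by (simp add: fact_numeral)
  show "has_bochner_integral std_normal_distribution (\<lambda>x. x\<^sup>2 - 1) 0"
    using has_bochner_integral_diff[OF 2 0] by simp
  have "has_bochner_integral std_normal_distribution (\<lambda>x. x ^ 4 - 2 * x\<^sup>2 + 1) (3 - 2 * 1 + 1)"
    by (intro has_bochner_integral_add has_bochner_integral_diff has_bochner_integral_mult_right 0 2 4)
  also have "(\<lambda>x::real. x ^ 4 - 2 * x\<^sup>2 + 1) = (\<lambda>x. (x\<^sup>2 - 1) * (x\<^sup>2 - 1))"
    by (simp add: fun_eq_iff algebra_simps power4_eq_xxxx power2_eq_square)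
  finally show "has_bochner_integral std_normal_distribution (\<lambda>x. (x\<^sup>2 - 1) * (x\<^sup>2 - 1)) 2"
    by simp
  have "has_bochner_integral std_normal_distribution (\<lambda>x. x ^ 3 - x) (0 - 0)"
    by (intro has_bochner_integral_diff 1 3)
  also have "(\<lambda>x::real. x ^ 3 - x) = (\<lambda>x. x * (x\<^sup>2 - 1))"
    by (simp add: fun_eq_iff algebra_simps power3_eq_cube power2_eq_square)
  finally show "has_bochner_integral std_normal_distribution (\<lambda>x. x * (x\<^sup>2 - 1)) 0"
    by simp
qed

text \<open>A centred chi-square variable; the \<open>- 1\<close> stands inside the sum. All
  coordinates occur in the score of the variance parameter, those from 1 on in the variance
  estimator.\<close>

definition chi_dev :: "nat set \<Rightarrow> (nat \<Rightarrow> real) \<Rightarrow> real" where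
  "chi_dev K w = (\<Sum>k\<in>K. (w k)\<^sup>2 - 1)"

text \<open>Distinct centred squares are uncorrelated, so only the diagonal terms, each 3 - 2 + 1 =
  2, survive. The third integral vanishes by oddness for coordinate 0 and by independence for the
  others; it makes the parameters orthogonal.\<close>

lemma chi_dev_moments:
  assumes K: "K \<subseteq> {..<N}"
  shows "has_bochner_integral (std_normal_vec N) (chi_dev K) 0"
    "has_bochner_integral (std_normal_vec N) (\<lambda>w. chi_dev K w * chi_dev K w) (2 * real (card K))"
    "0 < N \<Longrightarrow> has_bochner_integral (std_normal_vec N) (\<lambda>w. w 0 * chi_dev K w) 0"
proof -
  have fin: "finite K" using K finite_subset by blast
  have KN: "k < N" if "k \<in> K" for k using K that by blast
  have sum0: "has_bochner_integral (std_normal_vec N) (\<lambda>w. \<Sum>k\<in>K. f k w) 0"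
    if "\<And>k. k \<in> K \<Longrightarrow> has_bochner_integral (std_normal_vec N) (f k) (0 :: real)" for f
    using has_bochner_integral_sum[of K "std_normal_vec N" f "\<lambda>_. 0"] that by simp
  show "has_bochner_integral (std_normal_vec N) (chi_dev K) 0"
    unfolding chi_dev_def[abs_def]
    by (rule sum0) (rule std_normal_vec_integral_component[OF KN std_normal_moments(3)])
  have "has_bochner_integral (std_normal_vec N) (\<lambda>w. ((w i)\<^sup>2 - 1) * ((w j)\<^sup>2 - 1)) (if i = j then 2 else 0)"
    if ij: "i \<in> K" "j \<in> K" for i j
  proof (cases "i = j")
    case True
    show ?thesis
      unfolding True if_P[OF refl]
      by (rule std_normal_vec_integral_component[OF KN[OF ij(2)] std_normal_moments(4)])
  next
    case False
    show ?thesis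
      unfolding if_not_P[OF False]
      using std_normal_vec_integral_component2[OF KN[OF ij(1)] KN[OF ij(2)] False std_normal_moments(3) std_normal_moments(3)]
      unfolding mult_zero_left .
  qed
  then have "has_bochner_integral (std_normal_vec N) (\<lambda>w. \<Sum>i\<in>K. \<Sum>j\<in>K. ((w i)\<^sup>2 - 1) * ((w j)\<^sup>2 - 1))
      (\<Sum>i\<in>K. \<Sum>j\<in>K. if i = j then 2 else 0)"
    by (intro has_bochner_integral_sum)
  moreover have "(\<Sum>i\<in>K. \<Sum>j\<in>K. if i = j then 2 else 0 :: real) = 2 * real (card K)"
    using fin by (simp add: mult.commute)
  ultimately show "has_bochner_integral (std_normal_vec N) (\<lambda>w. chi_dev K w * chi_dev K w) (2 * real (card K))"
    by (simp only: chi_dev_def sum_product)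
  assume N: "0 < N"
  have "has_bochner_integral (std_normal_vec N) (\<lambda>w. w 0 * ((w k)\<^sup>2 - 1)) 0" if k: "k \<in> K" for k
  proof (cases "0 = k")
    case True
    show ?thesis
      unfolding True[symmetric]
      by (rule std_normal_vec_integral_component[OF N std_normal_moments(5)])
  next
    case False
    show ?thesis
      using std_normal_vec_integral_component2[OF N KN[OF k] False std_normal_moments(1) std_normal_moments(3)]
      unfolding mult_zero_left .
  qed
  then show "has_bochner_integral (std_normal_vec N) (\<lambda>w. w 0 * chi_dev K w) 0"
    unfolding chi_dev_def sum_distrib_left by (rule sum0)
qed

subsection \<open>Information and estimation in canonical coordinates\<close>


definition par :: "real \<Rightarrow> real \<Rightarrow> real vec" where
  "par \<theta> v = vec_of_list [\<theta>, v]"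

lemma par_simps [simp]: "dim_vec (par \<theta> v) = 2" "par \<theta> v $ 0 = \<theta>" "par \<theta> v $ 1 = v" "par \<theta> v $ Suc 0 = v"
  by (simp_all add: par_def)

lemma par_update:
  "vec (dim_vec (par \<theta> v)) (\<lambda>j. if j = 0 then x else par \<theta> v $ j) = par x v"
  "vec (dim_vec (par \<theta> v)) (\<lambda>j. if j = 1 then x else par \<theta> v $ j) = par \<theta> x"
  by (auto simp: less_Suc_eq numeral_2_eq_2 intro!: eq_vecI)

lemma ln_gaussian_density:
  fixes a v D x :: real
  assumes "0 < a" "0 < v" "0 < D"
  shows "ln (exp x / sqrt (a ^ n * (v ^ n * D))) = x - (n * ln a + n * ln v + ln D) / 2"
proof -
  have "0 < a ^ n * (v ^ n * D)" using assms by simp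
  then have "ln (exp x / sqrt (a ^ n * (v ^ n * D))) = x - ln (a ^ n * (v ^ n * D)) / 2"
    using assms by (simp add: ln_div ln_sqrt)
  also have "ln (a ^ n * (v ^ n * D)) = n * ln a + n * ln v + ln D"
    using assms by (simp add: ln_mult ln_realpow)
  finally show ?thesis .
qed

text \<open>The model in the coordinates \<open>y\<close> in which the covariance is \<open>v\<close> times the identity and
  the mean is \<open>\<theta> * c\<close> times the first basis vector.\<close>

locale canonical_gaussian_model =
  fixes N :: nat and c D :: real and P :: "real vec \<Rightarrow> (nat \<Rightarrow> real) measure"
    and p :: "real vec \<Rightarrow> (nat \<Rightarrow> real) \<Rightarrow> real"
    and y :: "nat \<Rightarrow> (nat \<Rightarrow> real) \<Rightarrow> real"
    and img :: "real \<Rightarrow> real \<Rightarrow> (nat \<Rightarrow> real) \<Rightarrow> nat \<Rightarrow> real"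
  assumes N: "0 < N" and c: "0 < c" and D: "0 < D"
    and P_density: "\<And>\<theta> v. 0 < v \<Longrightarrow> P (par \<theta> v) = density (sample_space N) (\<lambda>z. ennreal (p (par \<theta> v) z))"
    and P_distr: "\<And>\<theta> v. 0 < v \<Longrightarrow> P (par \<theta> v) = distr (std_normal_vec N) (sample_space N) (img \<theta> v)"
    and img: "\<And>\<theta> v. img \<theta> v \<in> measurable (std_normal_vec N) (sample_space N)"
    and y_img: "\<And>\<theta> v w k. k < N \<Longrightarrow> y k (img \<theta> v w) = (if k = 0 then \<theta> * c else 0) + sqrt v * w k"
    and p_eq: "\<And>\<theta> v z. 0 < v \<Longrightarrow> p (par \<theta> v) z =
      exp (- ((\<Sum>k<N. (y k z)\<^sup>2) - 2 * \<theta> * c * y 0 z + \<theta>\<^sup>2 * c\<^sup>2) / (2 * v)) / sqrt ((2 * pi) ^ N * (v ^ N * D))"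
    and y_meas: "\<And>k. k < N \<Longrightarrow> y k \<in> borel_measurable (sample_space N)"
begin

definition Q :: "(nat \<Rightarrow> real) \<Rightarrow> real" where
  "Q z = (\<Sum>k<N. (y k z)\<^sup>2)"

definition theta_est :: "(nat \<Rightarrow> real) \<Rightarrow> real" where
  "theta_est z = y 0 z / c"

text \<open>Removing the square of \<open>y 0\<close> discards the one coordinate whose mean depends
  on \<theta>; \<open>N - 1\<close> centred coordinates remain.\<close>

definition var_est :: "(nat \<Rightarrow> real) \<Rightarrow> real" where
  "var_est z = (Q z - (y 0 z)\<^sup>2) / (real N - 1)"

lemma y0_meas [measurable]: "y 0 \<in> borel_measurable (sample_space N)"
  using y_meas N by blast

lemma Q_meas [measurable]: "Q \<in> borel_measurable (sample_space N)"
  unfolding Q_def by (intro borel_measurable_sum borel_measurable_power y_meas) simp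

lemma theta_est_meas [measurable]: "theta_est \<in> borel_measurable (sample_space N)"
  unfolding theta_est_def by measurable

lemma var_est_meas [measurable]: "var_est \<in> borel_measurable (sample_space N)"
  unfolding var_est_def by measurable

lemma prob_space_P: "0 < v \<Longrightarrow> prob_space (P (par \<theta> v))"
  unfolding P_distr by (rule prob_space.prob_space_distr[OF prob_space_std_normal_vec img])

lemma sets_P: "0 < v \<Longrightarrow> sets (P (par \<theta> v)) = sets (sample_space N)"
  unfolding P_distr by simp

text \<open>Moments are computed through the image representation of the law; its density
  representation serves the scores and the tilting argument.\<close>

lemma P_integral:
  fixes f :: "(nat \<Rightarrow> real) \<Rightarrow> real"
  assumes v: "0 < v" and f: "f \<in> borel_measurable (sample_space N)"
    and g: "has_bochner_integral (std_normal_vec N) g x" and eq: "\<And>w. f (img \<theta> v w) = g w"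
  shows "has_bochner_integral (P (par \<theta> v)) f x"
  unfolding P_distr[OF v]
  by (rule has_bochner_integral_distr[OF f img[of \<theta> v]]) (simp only: eq g)

lemma p_pos: "0 < v \<Longrightarrow> 0 < p (par \<theta> v) z"
  unfolding p_eq using D by (intro divide_pos_pos) auto

lemma p_meas: "0 < v \<Longrightarrow> p (par \<theta> v) \<in> borel_measurable (sample_space N)"
  by (subst measurable_cong[OF p_eq[folded Q_def]]) measurable

lemma y0_img: "y 0 (img \<theta> v w) = \<theta> * c + sqrt v * w 0"
  using y_img[OF N] by simp

text \<open>With the true mean subtracted, all \<open>N\<close> normal squares remain; with
  \<open>y 0\<close> removed instead, only \<open>N - 1\<close> do. This is the loss of one degree
  of freedom that separates the attainable variance from the bound.\<close>

lemma Q_img: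
  assumes "0 < v"
  shows "Q (img \<theta> v w) - 2 * \<theta> * c * y 0 (img \<theta> v w) + \<theta>\<^sup>2 * c\<^sup>2 = v * (\<Sum>k<N. (w k)\<^sup>2)"
    and "Q (img \<theta> v w) - (y 0 (img \<theta> v w))\<^sup>2 = v * (\<Sum>k=1..<N. (w k)\<^sup>2)"
proof -
  have split: "(\<Sum>k<N. f k) = f 0 + (\<Sum>k=1..<N. f k)" for f :: "nat \<Rightarrow> real"
    using N by (simp add: lessThan_atLeast0 sum.atLeast_Suc_lessThan)
  have tail: "(\<Sum>k=1..<N. (y k (img \<theta> v w))\<^sup>2) = v * (\<Sum>k=1..<N. (w k)\<^sup>2)"
    unfolding sum_distrib_left using assms
    by (intro sum.cong refl) (simp add: y_img power_mult_distrib)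
  show "Q (img \<theta> v w) - (y 0 (img \<theta> v w))\<^sup>2 = v * (\<Sum>k=1..<N. (w k)\<^sup>2)"
    unfolding Q_def split tail by simp
  have sv: "sqrt v * sqrt v = v" using assms by simp
  have "(\<theta> * c + a * b)\<^sup>2 + X - 2 * \<theta> * c * (\<theta> * c + a * b) + \<theta>\<^sup>2 * c\<^sup>2 = (a * a) * b\<^sup>2 + X" for a b X
    by (simp add: power2_eq_square algebra_simps)
  from this[of "sqrt v" "w 0" "v * (\<Sum>k=1..<N. (w k)\<^sup>2)"]
  show "Q (img \<theta> v w) - 2 * \<theta> * c * y 0 (img \<theta> v w) + \<theta>\<^sup>2 * c\<^sup>2 = v * (\<Sum>k<N. (w k)\<^sup>2)"
    unfolding Q_def split tail y0_img sv distrib_left .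
qed

section \<open>Scores, Fisher information and the resulting bounds\<close>

lemma ln_p:
  assumes v: "0 < v"
  shows "ln (p (par \<theta> v) z) = - (Q z - 2 * \<theta> * c * y 0 z + \<theta>\<^sup>2 * c\<^sup>2) / (2 * v)
    - (N * ln (2 * pi) + N * ln v + ln D) / 2"
  unfolding p_eq[OF v] Q_def[symmetric] using v D by (intro ln_gaussian_density) auto

lemma score_deriv:
  assumes v: "0 < v"
  shows "(log_density_section p (par \<theta> v) 0 z has_field_derivative c * (y 0 z - \<theta> * c) / v) (at \<theta>)"
    and "(log_density_section p (par \<theta> v) 1 z has_field_derivative
      (Q z - 2 * \<theta> * c * y 0 z + \<theta>\<^sup>2 * c\<^sup>2) / (2 * v\<^sup>2) - N / (2 * v)) (at v)"
proof -
  have "log_density_section p (par \<theta> v) 0 z = (\<lambda>x. - (Q z - 2 * x * c * y 0 z + x\<^sup>2 * c\<^sup>2) / (2 * v)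
      - (N * ln (2 * pi) + N * ln v + ln D) / 2)"
    unfolding log_density_section_def par_update ln_p[OF v] ..
  moreover have "((\<lambda>x. - (Q z - 2 * x * c * y 0 z + x\<^sup>2 * c\<^sup>2) / (2 * v)
      - (N * ln (2 * pi) + N * ln v + ln D) / 2) has_field_derivative
      - (0 - 2 * 1 * c * y 0 z + 2 * \<theta> * c\<^sup>2) / (2 * v) - 0) (at \<theta>)"
    using v by (auto intro!: derivative_eq_intros simp: field_simps)
  moreover have "- (0 - 2 * 1 * c * y 0 z + 2 * \<theta> * c\<^sup>2) / (2 * v) - 0 = c * (y 0 z - \<theta> * c) / v"
    using v by (simp add: field_simps power2_eq_square)
  ultimately show "(log_density_section p (par \<theta> v) 0 z has_field_derivative c * (y 0 z - \<theta> * c) / v) (at \<theta>)"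
    by simp
  define q where "q = Q z - 2 * \<theta> * c * y 0 z + \<theta>\<^sup>2 * c\<^sup>2"
  have "((\<lambda>x. - q / (2 * x) - (N * ln (2 * pi) + N * ln x + ln D) / 2) has_field_derivative
      q / (2 * v\<^sup>2) - N / (2 * v)) (at v)"
    using v by (auto intro!: derivative_eq_intros simp: power2_eq_square field_simps)
  then show "(log_density_section p (par \<theta> v) 1 z has_field_derivative q / (2 * v\<^sup>2) - N / (2 * v)) (at v)"
  \<comment> \<open>As a function of the variance parameter, the formula for the log-density is
    available only at positive values, hence the passage through an open neighbourhood; in \<theta>
    it holds on the whole line.\<close>
  proof (rule has_field_derivative_transform_within_open[where S="{0<..}"])
    fix x :: real assume "x \<in> {0<..}"
    then have "0 < x" by simp
    from ln_p[OF this, of \<theta> z] show "- q / (2 * x) - (N * ln (2 * pi) + N * ln x + ln D) / 2 = log_density_section p (par \<theta> v) 1 z x"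
      unfolding log_density_section_def par_update q_def by simp
  qed (use v in auto)
qed

lemma score_eq:
  assumes v: "0 < v"
  shows "score p (par \<theta> v) 0 z = c * (y 0 z - \<theta> * c) / v"
    and "score p (par \<theta> v) 1 z = (Q z - 2 * \<theta> * c * y 0 z + \<theta>\<^sup>2 * c\<^sup>2) / (2 * v\<^sup>2) - N / (2 * v)"
  using DERIV_imp_deriv[OF score_deriv(1)[OF v]] DERIV_imp_deriv[OF score_deriv(2)[OF v]]
  by (simp_all add: score_def)

lemma score_meas:
  assumes "0 < v" "i < 2"
  shows "score p (par \<theta> v) i \<in> borel_measurable (sample_space N)"
proof -
  have "i = 0 \<or> i = 1" using assms by auto
  then show ?thesis
    using score_eq[OF assms(1)] by (auto simp: fun_eq_iff[symmetric] cong: measurable_cong)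
qed

text \<open>Pulled back to the standard normal vector, the scores are multiples of
  \<open>w 0\<close> and of a centred chi-square, so every Fisher entry is one of the moments
  already computed.\<close>

lemma score_img:
  assumes v: "0 < v"
  shows "score p (par \<theta> v) 0 (img \<theta> v w) = c / sqrt v * w 0"
    and "score p (par \<theta> v) 1 (img \<theta> v w) = 1 / (2 * v) * chi_dev {..<N} w"
proof -
  have "c * (\<theta> * c + sqrt v * w 0 - \<theta> * c) / v = c * (sqrt v / v) * w 0"
    by simp
  also have "sqrt v / v = 1 / sqrt v"
    using v by (simp add: sqrt_divide_self_eq inverse_eq_divide)
  finally show "score p (par \<theta> v) 0 (img \<theta> v w) = c / sqrt v * w 0"
    unfolding score_eq(1)[OF v] y0_img by simp
  have "v * S / (2 * v\<^sup>2) - N / (2 * v) = 1 / (2 * v) * (S - N)" for S :: real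
    using v by (simp add: power2_eq_square diff_divide_distrib)
  then show "score p (par \<theta> v) 1 (img \<theta> v w) = 1 / (2 * v) * chi_dev {..<N} w"
    unfolding score_eq(2)[OF v] Q_img(1)[OF v] chi_dev_def by (simp add: sum_subtractf)
qed

lemma score_integrals:
  assumes v: "0 < v"
  shows "has_bochner_integral (P (par \<theta> v)) (\<lambda>z. score p (par \<theta> v) 0 z * score p (par \<theta> v) 0 z) (c\<^sup>2 / v)"
    and "has_bochner_integral (P (par \<theta> v)) (\<lambda>z. score p (par \<theta> v) 0 z * score p (par \<theta> v) 1 z) 0"
    and "has_bochner_integral (P (par \<theta> v)) (\<lambda>z. score p (par \<theta> v) 1 z * score p (par \<theta> v) 1 z) (N / (2 * v\<^sup>2))"
proof -
  have [measurable]: "score p (par \<theta> v) 0 \<in> borel_measurable (sample_space N)"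
    "score p (par \<theta> v) 1 \<in> borel_measurable (sample_space N)"
    using score_meas[OF v] by auto
  note chi = chi_dev_moments[of "{..<N}" N, OF order_refl]
  have "has_bochner_integral (std_normal_vec N) (\<lambda>w. c\<^sup>2 / v * (w 0)\<^sup>2) (c\<^sup>2 / v * 1)"
    by (intro has_bochner_integral_mult_right std_normal_vec_integral_component[OF N std_normal_moments(2)])
  also have "(\<lambda>w. c\<^sup>2 / v * (w 0)\<^sup>2) = (\<lambda>w. (c / sqrt v * w 0) * (c / sqrt v * w 0))"
    using v by (simp add: fun_eq_iff power2_eq_square)
  finally show "has_bochner_integral (P (par \<theta> v)) (\<lambda>z. score p (par \<theta> v) 0 z * score p (par \<theta> v) 0 z) (c\<^sup>2 / v)"
    unfolding mult_1_right
    by (intro P_integral[OF v, where g="\<lambda>w. (c / sqrt v * w 0) * (c / sqrt v * w 0)"])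
      (measurable, simp_all only: score_img[OF v])
  have "has_bochner_integral (std_normal_vec N) (\<lambda>w. (c / sqrt v * (1 / (2 * v))) * (w 0 * chi_dev {..<N} w)) ((c / sqrt v * (1 / (2 * v))) * 0)"
    by (intro has_bochner_integral_mult_right chi(3) N)
  then show "has_bochner_integral (P (par \<theta> v)) (\<lambda>z. score p (par \<theta> v) 0 z * score p (par \<theta> v) 1 z) 0"
    unfolding mult_zero_right
    by (intro P_integral[OF v, where g="\<lambda>w. (c / sqrt v * (1 / (2 * v))) * (w 0 * chi_dev {..<N} w)"])
      (measurable, simp_all only: score_img[OF v] mult_ac)
  have "has_bochner_integral (std_normal_vec N) (\<lambda>w. (1 / (2 * v) * (1 / (2 * v))) * (chi_dev {..<N} w * chi_dev {..<N} w))
      ((1 / (2 * v) * (1 / (2 * v))) * (2 * real (card {..<N})))"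
    by (intro has_bochner_integral_mult_right chi(2))
  moreover have "(1 / (2 * v) * (1 / (2 * v))) * (2 * real (card {..<N})) = N / (2 * v\<^sup>2)"
    by (simp add: power2_eq_square)
  ultimately show "has_bochner_integral (P (par \<theta> v)) (\<lambda>z. score p (par \<theta> v) 1 z * score p (par \<theta> v) 1 z) (N / (2 * v\<^sup>2))"
    by (intro P_integral[OF v, where g="\<lambda>w. (1 / (2 * v) * (1 / (2 * v))) * (chi_dev {..<N} w * chi_dev {..<N} w)"])
      (measurable, simp_all only: score_img[OF v] mult_ac)
qed

lemma fisher_information_exists:
  assumes v: "0 < v"
  shows "fisher_information_exists P p (par \<theta> v)"
  unfolding fisher_information_exists_def
proof (intro conjI ballI allI impI)
  fix z and i :: nat assume "i < dim_vec (par \<theta> v)"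
  then have "i = 0 \<or> i = 1" by auto
  then show "log_density_section p (par \<theta> v) i z field_differentiable at (par \<theta> v $ i)"
    using score_deriv[OF v, of \<theta> z] by (auto simp: field_differentiable_def)
next
  fix i j assume "i < dim_vec (par \<theta> v)" "j < dim_vec (par \<theta> v)"
  then have "(i = 0 \<or> i = 1) \<and> (j = 0 \<or> j = 1)" by auto
  then show "integrable (P (par \<theta> v)) (\<lambda>z. score p (par \<theta> v) i z * score p (par \<theta> v) j z)"
    using score_integrals[OF v, of \<theta>, THEN integrable.intros]
    by (auto simp: mult.commute simp del: One_nat_def)
qed (rule p_pos[OF v])

lemma fisher_information_eq:
  assumes v: "0 < v"
  shows "fisher_information P p (par \<theta> v) = mat_of_rows_list 2 [[c\<^sup>2 / v, 0], [0, N / (2 * v\<^sup>2)]]"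
proof (rule eq_matI)
  fix i j assume "i < dim_row (mat_of_rows_list 2 [[c\<^sup>2 / v, 0], [0, N / (2 * v\<^sup>2)]])"
    "j < dim_col (mat_of_rows_list 2 [[c\<^sup>2 / v, 0], [0, N / (2 * v\<^sup>2)]])"
  then have "(i = 0 \<or> i = 1) \<and> (j = 0 \<or> j = 1)" by (auto simp: mat_of_rows_list_def)
  then show "fisher_information P p (par \<theta> v) $$ (i, j) = mat_of_rows_list 2 [[c\<^sup>2 / v, 0], [0, N / (2 * v\<^sup>2)]] $$ (i, j)"
    using score_integrals[OF v, of \<theta>, THEN has_bochner_integral_integral_eq]
    by (auto simp: fisher_information_def mat_of_rows_list_def mult.commute)
qed (auto simp: fisher_information_def mat_of_rows_list_def)

lemma cramer_rao_bounds:
  assumes v: "0 < v"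
  shows "cramer_rao_bound P p (par \<theta> v) 0 = v / c\<^sup>2" "cramer_rao_bound P p (par \<theta> v) 1 = 2 * v\<^sup>2 / N"
proof -
  let ?F = "mat_of_rows_list 2 [[c\<^sup>2 / v, 0], [0, N / (2 * v\<^sup>2)]]"
  let ?G = "mat_of_rows_list 2 [[v / c\<^sup>2, 0], [0, 2 * v\<^sup>2 / N]]"
  have "the (mat_inverse ?F) = ?G"
  proof (rule mat_inverse_eqI)
    show "?F \<in> carrier_mat 2 2" "?G \<in> carrier_mat 2 2"
      by (auto simp: mat_of_rows_list_def)
    show "?F * ?G = 1\<^sub>m 2"
    proof (rule eq_matI)
      fix i j assume "i < dim_row (1\<^sub>m 2 :: real mat)" "j < dim_col (1\<^sub>m 2 :: real mat)"
      then have "(i = 0 \<or> i = 1) \<and> (j = 0 \<or> j = 1)" by auto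
      then show "(?F * ?G) $$ (i, j) = 1\<^sub>m 2 $$ (i, j)"
        using v c N by (auto simp: mat_of_rows_list_def scalar_prod_def numeral_2_eq_2)
    qed (auto simp: mat_of_rows_list_def)
  qed
  then show "cramer_rao_bound P p (par \<theta> v) 0 = v / c\<^sup>2" "cramer_rao_bound P p (par \<theta> v) 1 = 2 * v\<^sup>2 / N"
    unfolding cramer_rao_bound_def fisher_information_eq[OF v]
    by (simp_all add: mat_of_rows_list_def)
qed

section \<open>Bias and variance of the two estimators\<close>

lemma theta_est_moments:
  assumes v: "0 < v"
  shows "has_bochner_integral (P (par \<theta> v)) theta_est \<theta>"
    and "has_bochner_integral (P (par \<theta> v)) (\<lambda>z. (theta_est z - \<theta>)\<^sup>2) (v / c\<^sup>2)"
    and "has_bochner_integral (P (par \<theta> v)) (\<lambda>z. (theta_est z)\<^sup>2) (v / c\<^sup>2 + \<theta>\<^sup>2)"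
proof -
  interpret prob_space "std_normal_vec N" by (rule prob_space_std_normal_vec)
  have est: "theta_est (img \<theta> v w) = \<theta> + sqrt v / c * w 0" for w
    using c by (simp add: theta_est_def y0_img add_divide_distrib)
  have const: "has_bochner_integral (std_normal_vec N) (\<lambda>_. a) a" for a :: real
    using prob_space by (simp add: has_bochner_integral_iff)
  note m1 = std_normal_vec_integral_component[OF N std_normal_moments(1)]
  note m2 = std_normal_vec_integral_component[OF N std_normal_moments(2)]
  have "has_bochner_integral (std_normal_vec N) (\<lambda>w. \<theta> + sqrt v / c * w 0) (\<theta> + sqrt v / c * 0)"
    by (intro has_bochner_integral_add has_bochner_integral_mult_right const m1)
  then show "has_bochner_integral (P (par \<theta> v)) theta_est \<theta>"
    by (intro P_integral[OF v, where g="\<lambda>w. \<theta> + sqrt v / c * w 0"]) (simp_all add: est)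
  have "has_bochner_integral (std_normal_vec N) (\<lambda>w. v / c\<^sup>2 * (w 0)\<^sup>2) (v / c\<^sup>2 * 1)"
    by (intro has_bochner_integral_mult_right m2)
  moreover have "(theta_est (img \<theta> v w) - \<theta>)\<^sup>2 = v / c\<^sup>2 * (w 0)\<^sup>2" for w
    using v by (simp add: est power_mult_distrib power_divide)
  ultimately show "has_bochner_integral (P (par \<theta> v)) (\<lambda>z. (theta_est z - \<theta>)\<^sup>2) (v / c\<^sup>2)"
    by (intro P_integral[OF v, where g="\<lambda>w. v / c\<^sup>2 * (w 0)\<^sup>2"]) simp_all
  \<comment> \<open>The raw second moment is computed besides the centred one because
    \<open>finite_variance\<close> speaks about the square itself.\<close>
  have "has_bochner_integral (std_normal_vec N) (\<lambda>w. v / c\<^sup>2 * (w 0)\<^sup>2 + (2 * \<theta> * (sqrt v / c) * w 0 + \<theta>\<^sup>2))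
      (v / c\<^sup>2 * 1 + (2 * \<theta> * (sqrt v / c) * 0 + \<theta>\<^sup>2))"
    by (intro has_bochner_integral_add has_bochner_integral_mult_right m1 m2 const)
  moreover have "(theta_est (img \<theta> v w))\<^sup>2 = v / c\<^sup>2 * (w 0)\<^sup>2 + (2 * \<theta> * (sqrt v / c) * w 0 + \<theta>\<^sup>2)" for w
    using v by (simp add: est power2_sum power_mult_distrib power_divide)
  ultimately show "has_bochner_integral (P (par \<theta> v)) (\<lambda>z. (theta_est z)\<^sup>2) (v / c\<^sup>2 + \<theta>\<^sup>2)"
    by (intro P_integral[OF v, where g="\<lambda>w. v / c\<^sup>2 * (w 0)\<^sup>2 + (2 * \<theta> * (sqrt v / c) * w 0 + \<theta>\<^sup>2)"]) simp_all
qed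

lemma var_est_moments:
  assumes v: "0 < v" and N2: "2 \<le> N"
  shows "has_bochner_integral (P (par \<theta> v)) var_est v"
    and "has_bochner_integral (P (par \<theta> v)) (\<lambda>z. (var_est z - v)\<^sup>2) (2 * v\<^sup>2 / (real N - 1))"
    and "has_bochner_integral (P (par \<theta> v)) (\<lambda>z. (var_est z)\<^sup>2) (2 * v\<^sup>2 / (real N - 1) + v\<^sup>2)"
proof -
  interpret prob_space "std_normal_vec N" by (rule prob_space_std_normal_vec)
  have const: "has_bochner_integral (std_normal_vec N) (\<lambda>_. a) a" for a :: real
    using prob_space by (simp add: has_bochner_integral_iff)
  define M where "M = real N - 1"
  have M: "0 < M" "real (card {1..<N}) = M" using N2 by (auto simp: M_def of_nat_diff)
  have sub: "{1..<N} \<subseteq> {..<N}" by auto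
  note chi = chi_dev_moments[OF sub]
  let ?X = "chi_dev {1..<N}"
  \<comment> \<open>Splitting off \<open>M\<close> normalizes the sum of squares to a centred
    chi-square with \<open>M\<close> terms, whose second moment \<open>2 * M\<close> gives the
    variance \<open>(v / M)^2 * 2 * M\<close>.\<close>
  have est: "var_est (img \<theta> v w) = v + v / M * ?X w" for w
  proof -
    have "(\<Sum>k=1..<N. (w k)\<^sup>2) = ?X w + M"
      using M(2) by (simp add: chi_dev_def sum_subtractf)
    then show ?thesis
      using M(1) unfolding var_est_def Q_img(2)[OF v] M_def[symmetric]
      by (simp add: distrib_left add_divide_distrib)
  qed
  have "has_bochner_integral (std_normal_vec N) (\<lambda>w. v + v / M * ?X w) (v + v / M * 0)"
    by (intro has_bochner_integral_add has_bochner_integral_mult_right const chi(1))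
  then show "has_bochner_integral (P (par \<theta> v)) var_est v"
    by (intro P_integral[OF v, where g="\<lambda>w. v + v / M * ?X w"]) (simp_all add: est)
  have sq: "(v + a * x - v)\<^sup>2 = a\<^sup>2 * (x * x)"
    and sq': "(v + a * x)\<^sup>2 = a\<^sup>2 * (x * x) + (2 * v * a * x + v\<^sup>2)" for a x
    by (simp_all add: power2_eq_square algebra_simps)
  have c2: "(v / M)\<^sup>2 * (2 * real (card {1..<N})) = 2 * v\<^sup>2 / (real N - 1)"
    unfolding M(2) M_def[symmetric] using M(1) by (simp add: power2_eq_square)
  have "has_bochner_integral (std_normal_vec N) (\<lambda>w. (v / M)\<^sup>2 * (?X w * ?X w)) ((v / M)\<^sup>2 * (2 * real (card {1..<N})))"
    by (intro has_bochner_integral_mult_right chi(2))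
  moreover have "(var_est (img \<theta> v w) - v)\<^sup>2 = (v / M)\<^sup>2 * (?X w * ?X w)" for w
    unfolding est sq ..
  ultimately show "has_bochner_integral (P (par \<theta> v)) (\<lambda>z. (var_est z - v)\<^sup>2) (2 * v\<^sup>2 / (real N - 1))"
    unfolding c2 by (intro P_integral[OF v, where g="\<lambda>w. (v / M)\<^sup>2 * (?X w * ?X w)"]) simp_all
  have "has_bochner_integral (std_normal_vec N) (\<lambda>w. (v / M)\<^sup>2 * (?X w * ?X w) + (2 * v * (v / M) * ?X w + v\<^sup>2))
      ((v / M)\<^sup>2 * (2 * real (card {1..<N})) + (2 * v * (v / M) * 0 + v\<^sup>2))"
    by (intro has_bochner_integral_add has_bochner_integral_mult_right chi(1,2) const)
  moreover have "(var_est (img \<theta> v w))\<^sup>2 = (v / M)\<^sup>2 * (?X w * ?X w) + (2 * v * (v / M) * ?X w + v\<^sup>2)" for w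
    unfolding est sq' ..
  ultimately show "has_bochner_integral (P (par \<theta> v)) (\<lambda>z. (var_est z)\<^sup>2) (2 * v\<^sup>2 / (real N - 1) + v\<^sup>2)"
    unfolding c2 by (intro P_integral[OF v, where g="\<lambda>w. (v / M)\<^sup>2 * (?X w * ?X w) + (2 * v * (v / M) * ?X w + v\<^sup>2)"]) simp_all
qed

section \<open>Tilting and minimum variance\<close>

text \<open>The natural parameters are \<open>- 1 / (2 * v)\<close> for \<open>Q\<close> and
  \<open>\<theta> * c / v\<close> for \<open>y 0\<close>; the exponent holds their differences. The
  factor \<open>C\<close> collects normalizations and mean terms, none of which involves
  \<open>z\<close>.\<close>

lemma exp_tilt:
  assumes v: "0 < v" and v': "0 < v'"
  obtains C where "\<And>z. p (par \<theta> v) z * exp ((1 / (2 * v) - 1 / (2 * v')) * Q z + (\<theta>' / v' - \<theta> / v) * c * y 0 z)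
    = C * p (par \<theta>' v') z"
proof
  fix z
  define K K' where "K = sqrt ((2 * pi) ^ N * (v ^ N * D))" and "K' = sqrt ((2 * pi) ^ N * (v' ^ N * D))"
  have K: "K > 0" "K' > 0" using v v' D by (auto simp: K_def K'_def)
  define E where "E = exp (\<theta>'\<^sup>2 * c\<^sup>2 / (2 * v') - \<theta>\<^sup>2 * c\<^sup>2 / (2 * v))"
  have "- (Q z - 2 * \<theta> * c * y 0 z + \<theta>\<^sup>2 * c\<^sup>2) / (2 * v) + ((1 / (2 * v) - 1 / (2 * v')) * Q z + (\<theta>' / v' - \<theta> / v) * c * y 0 z)
      = (\<theta>'\<^sup>2 * c\<^sup>2 / (2 * v') - \<theta>\<^sup>2 * c\<^sup>2 / (2 * v)) + - (Q z - 2 * \<theta>' * c * y 0 z + \<theta>'\<^sup>2 * c\<^sup>2) / (2 * v')"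
    using v v' by (simp add: add_divide_distrib diff_divide_distrib left_diff_distrib)
  then have "exp (- (Q z - 2 * \<theta> * c * y 0 z + \<theta>\<^sup>2 * c\<^sup>2) / (2 * v)) * exp ((1 / (2 * v) - 1 / (2 * v')) * Q z + (\<theta>' / v' - \<theta> / v) * c * y 0 z)
      = E * exp (- (Q z - 2 * \<theta>' * c * y 0 z + \<theta>'\<^sup>2 * c\<^sup>2) / (2 * v'))"
    unfolding E_def exp_add[symmetric] by simp
  then show "p (par \<theta> v) z * exp ((1 / (2 * v) - 1 / (2 * v')) * Q z + (\<theta>' / v' - \<theta> / v) * c * y 0 z)
    = (exp (\<theta>'\<^sup>2 * c\<^sup>2 / (2 * v') - \<theta>\<^sup>2 * c\<^sup>2 / (2 * v)) * sqrt ((2 * pi) ^ N * (v' ^ N * D)) / sqrt ((2 * pi) ^ N * (v ^ N * D))) * p (par \<theta>' v') z"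
    unfolding p_eq[OF v] p_eq[OF v'] Q_def[symmetric] K_def[symmetric] K'_def[symmetric] E_def[symmetric]
    using K by (simp add: field_simps)
qed

text \<open>Differentiating the identities \<open>E U = 0\<close> in the natural parameters of the exponential
  family shows that an unbiased estimator of zero is uncorrelated with the sufficient statistics.\<close>

lemma unbiased_zero_uncorrelated:
  assumes U: "\<And>\<theta> v. 0 < v \<Longrightarrow> has_bochner_integral (P (par \<theta> v)) U 0" and v: "0 < v"
  shows "has_bochner_integral (P (par \<theta> v)) (\<lambda>z. U z * Q z) 0"
    and "has_bochner_integral (P (par \<theta> v)) (\<lambda>z. U z * (y 0 z)\<^sup>2) 0"
proof -
  have Um[measurable]: "U \<in> borel_measurable (sample_space N)"
    using borel_measurable_integrable[OF integrable.intros[OF U[OF v, of 0]]]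
    unfolding measurable_cong_sets[OF sets_P[OF v] refl] .
  note [measurable] = p_meas
  have dens: "has_bochner_integral (P (par \<theta> v)) f x \<longleftrightarrow> has_bochner_integral (sample_space N) (\<lambda>z. p (par \<theta> v) z * f z) x"
    if "0 < v" "f \<in> borel_measurable (sample_space N)" for f x \<theta> v
    unfolding P_density[OF that(1)] has_bochner_integral_iff
    using that p_meas[OF that(1)] p_pos[OF that(1), THEN less_imp_le]
    by (simp add: integrable_density integral_density)
  \<comment> \<open>Unbiasedness at another parameter point is re-read as a statement about the
    tilted density at the fixed point.\<close>
  have zero: "has_bochner_integral (sample_space N) (\<lambda>z. (U z * p (par \<theta> v) z) *
      exp ((1 / (2 * v) - 1 / (2 * v')) * Q z + (\<theta>' / v' - \<theta> / v) * c * y 0 z)) 0" if v': "0 < v'" for \<theta>' v'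
  proof -
    obtain C where C: "\<And>z. p (par \<theta> v) z * exp ((1 / (2 * v) - 1 / (2 * v')) * Q z + (\<theta>' / v' - \<theta> / v) * c * y 0 z)
      = C * p (par \<theta>' v') z"
      using exp_tilt[OF v v'] by blast
    have "has_bochner_integral (sample_space N) (\<lambda>z. C * (p (par \<theta>' v') z * U z)) (C * 0)"
      using U[OF v', of \<theta>'] unfolding dens[OF v' Um] by (rule has_bochner_integral_mult_right)
    moreover have "C * (p (par \<theta>' v') z * U z) = (U z * p (par \<theta> v) z) *
        exp ((1 / (2 * v) - 1 / (2 * v')) * Q z + (\<theta>' / v' - \<theta> / v) * c * y 0 z)" for z
    proof -
      have "C * (p (par \<theta>' v') z * U z) = U z * (C * p (par \<theta>' v') z)" by simp
      then show ?thesis unfolding C[symmetric] mult.assoc[symmetric] .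
    qed
    ultimately show ?thesis by (simp only: mult_zero_right)
  qed
  have zQ: "has_bochner_integral (sample_space N) (\<lambda>z. (U z * p (par \<theta> v) z) * exp (t * Q z)) 0"
    if t: "\<bar>t\<bar> < 1 / (2 * v)" for t
  proof -
    \<comment> \<open>\<open>v'\<close> below solves \<open>1 / (2 * v) - 1 / (2 * v') = t\<close>,
      and \<theta> is divided by the same factor to keep \<open>\<theta> / v\<close> fixed, so that
      only \<open>Q\<close> is tilted. The range of \<open>t\<close> keeps \<open>v'\<close>
      positive.\<close>
    have tv: "0 < 1 - 2 * v * t" using t v by (simp add: abs_less_iff field_simps)
    define v' where "v' = v / (1 - 2 * v * t)"
    have v': "0 < v'" using v tv by (simp add: v'_def)
    have e: "1 / (2 * v) - 1 / (2 * v') = t" "\<theta> / (1 - 2 * v * t) / v' - \<theta> / v = 0"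
      using v tv by (simp_all add: v'_def field_simps)
    from zero[OF v', of "\<theta> / (1 - 2 * v * t)"] show ?thesis
      unfolding e mult_zero_left add_0_right .
  qed
  \<comment> \<open>Keeping \<open>v\<close> and moving \<theta> by \<open>t * v / c\<close> tilts
    \<open>y 0\<close> alone, here for every real \<open>t\<close>.\<close>
  have zy: "has_bochner_integral (sample_space N) (\<lambda>z. (U z * p (par \<theta> v) z) * exp (t * y 0 z)) 0" for t
  proof -
    have "((\<theta> + t * v / c) / v - \<theta> / v) * c = t"
      using v c by (simp add: add_divide_distrib)
    with zero[OF v, of "\<theta> + t * v / c"] show ?thesis by simp
  qed
  have [measurable]: "p (par \<theta> v) \<in> borel_measurable (sample_space N)" by (rule p_meas[OF v])
  have UP: "(\<lambda>z. U z * p (par \<theta> v) z) \<in> borel_measurable (sample_space N)" by measurable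
  have "has_bochner_integral (sample_space N) (\<lambda>z. (U z * p (par \<theta> v) z) * Q z * exp (0 * Q z)) 0"
    by (rule exp_tilt_zero_integral_deriv[where \<delta>="1 / (2 * v)", OF UP Q_meas zQ]) (use v in auto)
  then show "has_bochner_integral (P (par \<theta> v)) (\<lambda>z. U z * Q z) 0"
    by (subst dens[OF v]) (simp_all add: mult_ac)
  \<comment> \<open>The first derivative vanishes for all \<open>t\<close>, not just at 0, so the
    differentiation lemma applies a second time and produces the square of
    \<open>y 0\<close>.\<close>
  have d1: "has_bochner_integral (sample_space N) (\<lambda>z. (U z * p (par \<theta> v) z) * y 0 z * exp (t * y 0 z)) 0" for t
    by (rule exp_tilt_zero_integral_deriv[where \<delta>="\<bar>t\<bar> + 1", OF UP y0_meas zy]) auto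
  have "has_bochner_integral (sample_space N) (\<lambda>z. ((U z * p (par \<theta> v) z) * y 0 z) * y 0 z * exp (0 * y 0 z)) 0"
    by (rule exp_tilt_zero_integral_deriv[where \<delta>=1, OF borel_measurable_times[OF UP y0_meas] y0_meas d1]) auto
  then show "has_bochner_integral (P (par \<theta> v)) (\<lambda>z. U z * (y 0 z)\<^sup>2) 0"
    by (subst dens[OF v]) (simp_all add: mult_ac power2_eq_square)
qed

lemma params_iff: "\<psi> \<in> params \<longleftrightarrow> (\<exists>\<theta> v. \<psi> = par \<theta> v \<and> 0 < v)"
  by (auto simp: params_def par_def)

lemma theta_est_attains:
  assumes v: "0 < v"
  shows "finite_variance (P (par \<theta> v)) theta_est"
    "prob_space.variance (P (par \<theta> v)) theta_est = v / c\<^sup>2"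
    "attains_cramer_rao_at params P p 0 theta_est (par \<theta> v)"
proof -
  note m = theta_est_moments[OF v, of \<theta>]
  show fv: "finite_variance (P (par \<theta> v)) theta_est"
    using m by (simp add: finite_variance_def has_bochner_integral_iff)
  show var: "prob_space.variance (P (par \<theta> v)) theta_est = v / c\<^sup>2"
    using m by (simp add: has_bochner_integral_iff)
  have "unbiased_estimator params P (\<lambda>\<psi>. \<psi> $ 0) theta_est"
    using theta_est_moments(1) by (auto simp: unbiased_estimator_def params_iff has_bochner_integral_iff)
  then show "attains_cramer_rao_at params P p 0 theta_est (par \<theta> v)"
    unfolding attains_cramer_rao_at_def cramer_rao_bounds[OF v] using fv var by simp
qed

lemma var_est_variance:
  assumes v: "0 < v" and N2: "2 \<le> N"
  shows "prob_space.variance (P (par \<theta> v)) var_est = 2 * v\<^sup>2 / (real N - 1)"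
  using var_est_moments[OF v N2, of \<theta>] by (simp add: has_bochner_integral_iff)

text \<open>The difference \<open>?U\<close> from a competitor has mean zero everywhere and is
  uncorrelated with \<open>var_est\<close>; by Pythagoras it can only add to the second moment,
  while the means agree.\<close>

lemma var_est_umvu:
  assumes N2: "2 \<le> N"
  shows "umvu_estimator params P (\<lambda>\<psi>. \<psi> $ 1) var_est"
  unfolding umvu_estimator_def
proof (intro conjI ballI allI impI)
  show unb: "unbiased_estimator params P (\<lambda>\<psi>. \<psi> $ 1) var_est"
    using var_est_moments(1)[OF _ N2] by (auto simp: unbiased_estimator_def params_iff has_bochner_integral_iff)
  fix \<psi> assume "\<psi> \<in> params"
  then obtain \<theta> v where \<psi>: "\<psi> = par \<theta> v" and v: "0 < v" by (auto simp: params_iff)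
  note m = var_est_moments[OF v N2, of \<theta>]
  show "finite_variance (P \<psi>) var_est"
    using m by (simp add: \<psi> finite_variance_def has_bochner_integral_iff)
  fix S assume S: "unbiased_estimator params P (\<lambda>\<psi>. \<psi> $ 1) S \<and> finite_variance (P \<psi>) S"
  interpret prob_space "P \<psi>" unfolding \<psi> by (rule prob_space_P[OF v])
  let ?U = "\<lambda>z. S z - var_est z"
  have SP: "has_bochner_integral (P (par \<theta> v)) S v" if "0 < v" for \<theta> v
  proof -
    have "par \<theta> v \<in> params" using that by (auto simp: params_iff)
    then show ?thesis
      using S by (simp add: unbiased_estimator_def has_bochner_integral_iff)
  qed
  have U: "has_bochner_integral (P (par \<theta> v)) ?U 0" if "0 < v" for \<theta> v
    using has_bochner_integral_diff[OF SP[OF that] var_est_moments(1)[OF that N2]] by simp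
  have "has_bochner_integral (P \<psi>) (\<lambda>z. (?U z * Q z - ?U z * (y 0 z)\<^sup>2) / (real N - 1)) ((0 - 0) / (real N - 1))"
    unfolding \<psi> by (intro has_bochner_integral_divide_zero has_bochner_integral_diff unbiased_zero_uncorrelated U v)
  then have UT: "has_bochner_integral (P \<psi>) (\<lambda>z. ?U z * var_est z) 0"
    by (simp add: var_est_def right_diff_distrib)
  have S2: "integrable (P \<psi>) (\<lambda>z. (S z)\<^sup>2)" and S1: "integrable (P \<psi>) S"
    using S by (auto simp: finite_variance_def)
  have T2: "integrable (P \<psi>) (\<lambda>z. (var_est z)\<^sup>2)" and T1: "integrable (P \<psi>) var_est"
    using m by (auto simp: \<psi> has_bochner_integral_iff)
  \<comment> \<open>Written this way, the square of \<open>?U\<close> is integrable because the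
    three terms are: the product with \<open>var_est\<close> was obtained by tilting, so no
    Cauchy-Schwarz inequality is needed.\<close>
  have sq: "(S z)\<^sup>2 - (var_est z)\<^sup>2 - 2 * (?U z * var_est z) = (?U z)\<^sup>2" for z
    by (simp add: power2_eq_square algebra_simps)
  have "has_bochner_integral (P \<psi>) (\<lambda>z. (S z)\<^sup>2 - (var_est z)\<^sup>2 - 2 * (?U z * var_est z))
      (expectation (\<lambda>z. (S z)\<^sup>2) - expectation (\<lambda>z. (var_est z)\<^sup>2) - 2 * 0)"
    by (intro has_bochner_integral_diff has_bochner_integral_mult_right UT has_bochner_integral_integrable S2 T2)
  then have "expectation (\<lambda>z. (?U z)\<^sup>2) = expectation (\<lambda>z. (S z)\<^sup>2) - expectation (\<lambda>z. (var_est z)\<^sup>2)"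
    unfolding sq by (simp only: has_bochner_integral_iff mult_zero_right diff_zero)
  moreover have "0 \<le> expectation (\<lambda>z. (?U z)\<^sup>2)"
    by (rule Bochner_Integration.integral_nonneg) simp
  ultimately have "expectation (\<lambda>z. (var_est z)\<^sup>2) \<le> expectation (\<lambda>z. (S z)\<^sup>2)"
    by linarith
  moreover have "expectation S = expectation var_est"
    using SP[OF v, of \<theta>] m(1) by (simp add: \<psi> has_bochner_integral_iff)
  ultimately show "variance var_est \<le> variance S"
    unfolding variance_eq[OF S1 S2] variance_eq[OF T1 T2] by simp
qed

lemma no_estimator_attains:
  assumes N2: "2 \<le> N" and v: "0 < v"
  shows "\<not> attains_cramer_rao_at params P p 1 S (par \<theta> v)"
proof
  assume "attains_cramer_rao_at params P p 1 S (par \<theta> v)"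
  then have S: "unbiased_estimator params P (\<lambda>\<psi>. \<psi> $ 1) S" "finite_variance (P (par \<theta> v)) S"
    "prob_space.variance (P (par \<theta> v)) S = 2 * v\<^sup>2 / N"
    unfolding attains_cramer_rao_at_def cramer_rao_bounds[OF v] by auto
  have "prob_space.variance (P (par \<theta> v)) var_est \<le> prob_space.variance (P (par \<theta> v)) S"
    using var_est_umvu[OF N2] S(1,2) v unfolding umvu_estimator_def by (auto simp: params_iff)
  then have "2 * v\<^sup>2 / (real N - 1) \<le> 2 * v\<^sup>2 / N"
    unfolding S(3) var_est_variance[OF v N2] .
  moreover have "2 * v\<^sup>2 / N < 2 * v\<^sup>2 / (real N - 1)"
    using v N2 by (intro divide_strict_left_mono) auto
  ultimately show False by simp
qed

end

subsection \<open>Canonical coordinates for the observations\<close>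


lemma affine_image_cong:
  assumes "\<And>i. i < N \<Longrightarrow> \<mu> i = \<mu>' i" "\<And>i k. i < N \<Longrightarrow> k < N \<Longrightarrow> A i k = A' i k"
  shows "affine_image N \<mu> A = affine_image N \<mu>' A'"
  using assms by (auto simp: affine_image_def fun_eq_iff intro!: sum.cong)

lemma mat_gram_index:
  assumes "A \<in> carrier_mat n n" "i < n" "j < n"
  shows "(A * transpose_mat A) $$ (i, j) = (\<Sum>k<n. A $$ (i, k) * A $$ (j, k))"
  using assms by (simp add: scalar_prod_def lessThan_atLeast0)

text \<open>Each summand has a positive definite form, and \<open>m \<ge> 1\<close> makes the sum
  nonempty, hence positive definite as well.\<close>

lemma Gamma_mat_cholesky:
  fixes H :: "nat \<Rightarrow> real" and m :: nat
  assumes h: "h > 0" and m: "m \<ge> 1" and H: "\<And>r. r \<in> {1..m} \<Longrightarrow> 1/2 < H r \<and> H r < 1"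
  obtains L where "\<And>i. i < N \<Longrightarrow> 0 < L i i" "\<And>i j. i < j \<Longrightarrow> L i j = 0"
    "\<And>i j. i < N \<Longrightarrow> j < N \<Longrightarrow> (\<Sum>k<N. L i k * L j k) = (\<Sum>r = 1..m. fbm_cov (H r) (obs_time h i) (obs_time h j))"
proof -
  let ?G = "\<lambda>i j. \<Sum>r = 1..m. fbm_cov (H r) (obs_time h i) (obs_time h j)"
  have sym: "?G i j = ?G j i" for i j
    by (intro sum.cong refl) (simp add: fbm_cov_def abs_minus_commute)
  have pos: "0 < (\<Sum>i<N. \<Sum>j<N. c i * c j * ?G i j)" if k: "k < N" "c k \<noteq> 0" for c k
  proof -
    have "0 < (\<Sum>r = 1..m. \<Sum>i<N. \<Sum>j<N. c i * c j * fbm_cov (H r) (obs_time h i) (obs_time h j))"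
    proof (rule sum_pos)
      fix r assume "r \<in> {1..m}"
      then have "0 < H r" "H r < 1" using H[of r] by auto
      then show "0 < (\<Sum>i<N. \<Sum>j<N. c i * c j * fbm_cov (H r) (obs_time h i) (obs_time h j))"
        using h k by (rule fbm_cov_pos_def)
    qed (use m in auto)
    also have "\<dots> = (\<Sum>i<N. \<Sum>r = 1..m. \<Sum>j<N. c i * c j * fbm_cov (H r) (obs_time h i) (obs_time h j))"
      by (rule sum.swap)
    also have "\<dots> = (\<Sum>i<N. \<Sum>j<N. \<Sum>r = 1..m. c i * c j * fbm_cov (H r) (obs_time h i) (obs_time h j))"
      by (rule sum.cong[OF refl]) (rule sum.swap)
    finally show ?thesis by (simp only: sum_distrib_left)
  qed
  have "\<exists>L. (\<forall>i<N. 0 < L i i) \<and> (\<forall>i j. i < j \<longrightarrow> L i j = 0) \<and>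
    (\<forall>i<N. \<forall>j<N. (\<Sum>k<N. L i k * L j k) = ?G i j)"
    by (rule cholesky_exists[OF sym pos])
  then obtain L where L: "(\<forall>i<N. 0 < L i i) \<and> (\<forall>i j. i < j \<longrightarrow> L i j = 0) \<and>
    (\<forall>i<N. \<forall>j<N. (\<Sum>k<N. L i k * L j k) = ?G i j)" ..
  show ?thesis
    by (rule that[OF L[THEN conjunct1, rule_format] L[THEN conjunct2, THEN conjunct1, rule_format]
      L[THEN conjunct2, THEN conjunct2, rule_format]])
qed

text \<open>The coordinates are \<open>y = A^(-1) z\<close> for the rotated factor \<open>A\<close>,
  whose inverse is \<open>K\<close>. The constant \<open>D\<close> is \<open>(det A)^2\<close>, the
  determinant of the matrix \<open>Gamma_mat\<close>.\<close>

theorem Z_law_canonical: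
  fixes B :: "nat \<Rightarrow> real \<Rightarrow> 'w \<Rightarrow> real"
  assumes M: "prob_space M" and h: "h > 0" and m: "m \<ge> 1"
    and H: "\<And>r. r \<in> {1..m} \<Longrightarrow> 1/2 < H r \<and> H r < 1"
    and fbm: "\<And>r. r \<in> {1..m} \<Longrightarrow> fractional_brownian_motion M (H r) (B r)"
    and indep: "independent_processes M {1..m} B"
    and N: "N \<ge> 1"
  obtains c D y img where
    "canonical_gaussian_model N c D (Z_law M B m h N) (Z_density H m h N) y img"
    "d_coeff H m h N = c\<^sup>2" "\<And>z. theta_hat H m h N z = y 0 z / c"
    "\<And>z. alpha2_hat H m h N z = ((\<Sum>k<N. (y k z)\<^sup>2) - (y 0 z)\<^sup>2) / N"
proof -
  have N0: "0 < N" using N by simp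
  let ?\<Gamma> = "Gamma_mat H m h N" and ?T = "time_vec h N"
  obtain L where L: "\<And>i. i < N \<Longrightarrow> 0 < L i i" "\<And>i j. i < j \<Longrightarrow> L i j = 0"
    and LL: "\<And>i j. i < N \<Longrightarrow> j < N \<Longrightarrow> (\<Sum>k<N. L i k * L j k) = (\<Sum>r = 1..m. fbm_cov (H r) (obs_time h i) (obs_time h j))"
    using Gamma_mat_cholesky[where H=H and N=N, OF h m H] by blast
  define Lm where "Lm = mat N N (\<lambda>(i, j). L i j)"
  have Lm: "Lm \<in> carrier_mat N N" by (simp add: Lm_def)
  have \<Gamma>L: "?\<Gamma> = Lm * transpose_mat Lm"
  proof (rule eq_matI)
    fix i j assume "i < dim_row (Lm * transpose_mat Lm)" "j < dim_col (Lm * transpose_mat Lm)"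
    then have ij: "i < N" "j < N" using Lm by auto
    then show "?\<Gamma> $$ (i, j) = (Lm * transpose_mat Lm) $$ (i, j)"
      unfolding mat_gram_index[OF Lm ij] by (simp add: Gamma_mat_def Lm_def LL)
  qed (use Lm in \<open>auto simp: Gamma_mat_def\<close>)
  have "det Lm = prod_list (diag_mat Lm)"
    by (rule det_lower_triangular[OF _ Lm]) (use L(2) in \<open>auto simp: Lm_def\<close>)
  also have "\<dots> = (\<Prod>i<N. L i i)"
    by (simp add: prod_list_diag_prod Lm_def lessThan_atLeast0)
  also have "0 < \<dots>" using L(1) by (intro prod_pos) simp
  finally have det: "det Lm \<noteq> 0" by simp
  have T: "?T \<in> carrier_vec N" by (simp add: time_vec_def)
  have "?T $ 0 \<noteq> 0" using h N0 by (simp add: time_vec_def obs_time_def)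
  then have "?T \<noteq> 0\<^sub>v N" using N0 by (metis index_zero_vec(1))
  then obtain A K c where A: "A \<in> carrier_mat N N" and K: "K \<in> carrier_mat N N"
    and AK: "A * K = 1\<^sub>m N" and KA: "K * A = 1\<^sub>m N"
    and AA: "A * transpose_mat A = Lm * transpose_mat Lm" and c: "0 < c" and Tc: "?T = c \<cdot>\<^sub>v col A 0"
    using gram_factor_along[OF Lm det N0 T] by blast
  have \<Gamma>A: "?\<Gamma> = A * transpose_mat A" using \<Gamma>L AA by simp
  define y where "y k z = (K *\<^sub>v vec N z) $ k" for k and z :: "nat \<Rightarrow> real"
  define img where "img \<theta> v = affine_image N (\<lambda>i. \<theta> * obs_time h i) (\<lambda>i k. sqrt v * A $$ (i, k))" for \<theta> v
  \<comment> \<open>In the new coordinates the time vector lies along the first axis, because it is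
    \<open>c\<close> times the first column of \<open>A\<close>.\<close>
  have KT: "K *\<^sub>v ?T = c \<cdot>\<^sub>v unit_vec N 0"
  proof -
    have "K *\<^sub>v ?T = c \<cdot>\<^sub>v (K *\<^sub>v col A 0)"
      unfolding Tc by (rule mult_mat_vec[OF K]) (use A in auto)
    also have "K *\<^sub>v col A 0 = col (K * A) 0"
      by (rule col_mult2[OF K A N0, symmetric])
    also have "col (K * A) 0 = unit_vec N 0"
      unfolding KA using N0 by simp
    finally show ?thesis .
  qed
  have "det A * det K = det (1\<^sub>m N :: real mat)"
    unfolding AK[symmetric] by (rule det_mult[OF A K, symmetric])
  then have "det A \<noteq> 0" by (auto simp: det_one)
  then have D: "0 < (det A)\<^sup>2" by simp
  have inv: "Gamma_inv H m h N = 1 \<cdot>\<^sub>m (transpose_mat K * K)"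
  proof -
    have "?\<Gamma> = 1 \<cdot>\<^sub>m (A * transpose_mat A)" unfolding \<Gamma>A by (intro eq_matI) auto
    then show ?thesis
      unfolding Gamma_inv_def using mat_inverse_gram[OF A K AK KA, of 1] by simp
  qed
  have z: "vec N z \<in> carrier_vec N" for z :: "nat \<Rightarrow> real" by simp
  have form: "u \<bullet> (Gamma_inv H m h N *\<^sub>v x) = (K *\<^sub>v u) \<bullet> (K *\<^sub>v x)"
    if "u \<in> carrier_vec N" "x \<in> carrier_vec N" for u x
    unfolding inv gram_form[OF K that] by simp
  have ey: "unit_vec N 0 \<bullet> (K *\<^sub>v vec N z) = y 0 z" for z
    using K N0 by (simp add: y_def)
  have lin: "?T \<bullet> (Gamma_inv H m h N *\<^sub>v vec N z) = c * y 0 z" for z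
    unfolding form[OF T z] KT ey[symmetric] using K by simp
  have d: "d_coeff H m h N = c\<^sup>2"
    unfolding d_coeff_def form[OF T T] KT using N0 by (simp add: power2_eq_square)
  have yy: "(K *\<^sub>v vec N z) \<bullet> (K *\<^sub>v vec N z) = (\<Sum>k<N. (y k z)\<^sup>2)" for z
    using K by (simp add: scalar_prod_def y_def lessThan_atLeast0 power2_eq_square)
  have quad: "vec N z \<bullet> (Gamma_inv H m h N *\<^sub>v vec N z) = (\<Sum>k<N. (y k z)\<^sup>2)" for z
    unfolding form[OF z z] yy ..
  have theta: "theta_hat H m h N z = y 0 z / c" for z
    unfolding theta_hat_def lin d using c by (simp add: power2_eq_square)
  have alpha: "alpha2_hat H m h N z = ((\<Sum>k<N. (y k z)\<^sup>2) - (y 0 z)\<^sup>2) / N" for z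
    unfolding alpha2_hat_def lin d quad using c by (simp add: power_mult_distrib)
  have "canonical_gaussian_model N c ((det A)\<^sup>2) (Z_law M B m h N) (Z_density H m h N) y img"
  proof
    fix \<theta> v :: real assume v: "0 < v"
    have par: "0 \<le> par \<theta> v $ 1" using v by simp
    have scale: "(\<Sum>k<N. (sqrt v * f k) * (sqrt v * g k)) = v * (\<Sum>k<N. f k * g k)" for f g
    proof -
      have "(sqrt v * a) * (sqrt v * b) = (sqrt v * sqrt v) * (a * b)" for a b
        by (simp only: mult_ac)
      moreover have "sqrt v * sqrt v = v" using v by simp
      ultimately show ?thesis by (simp only: sum_distrib_left)
    qed
    show "Z_law M B m h N (par \<theta> v) = distr (std_normal_vec N) (sample_space N) (img \<theta> v)"
    proof -
      have "(\<Sum>k<N. (sqrt v * A $$ (i, k)) * (sqrt v * A $$ (j, k))) =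
          par \<theta> v $ 1 * (\<Sum>r = 1..m. fbm_cov (H r) (obs_time h i) (obs_time h j))" if ij: "i < N" "j < N" for i j
        unfolding scale mat_gram_index[OF A ij, symmetric] \<Gamma>A[symmetric] using ij by (simp add: Gamma_mat_def)
      from Z_law_eq_affine_image[OF M h fbm indep par this] show ?thesis
        by (simp add: img_def)
    qed
    \<comment> \<open>Here the law is represented through the triangular \<open>L\<close>, since the
      change of variables is available only for triangular maps; the Gram matrix is the same as for
      \<open>A\<close>.\<close>
    show "Z_law M B m h N (par \<theta> v) = density (sample_space N) (\<lambda>z. ennreal (Z_density H m h N (par \<theta> v) z))"
    proof -
      have LL': "(\<Sum>k<N. (sqrt v * L i k) * (sqrt v * L j k)) =
          par \<theta> v $ 1 * (\<Sum>r = 1..m. fbm_cov (H r) (obs_time h i) (obs_time h j))" if ij: "i < N" "j < N" for i j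
        unfolding scale using ij by (simp add: LL)
      have "Z_law M B m h N (par \<theta> v) =
          distr (std_normal_vec N) (sample_space N) (affine_image N (\<lambda>i. \<theta> * obs_time h i) (\<lambda>i k. sqrt v * L i k))"
        using Z_law_eq_affine_image[OF M h fbm indep par LL'] by simp
      also have "affine_image N (\<lambda>i. \<theta> * obs_time h i) (\<lambda>i k. sqrt v * L i k) =
          affine_image N (\<lambda>i. (\<theta> \<cdot>\<^sub>v ?T) $ i) (\<lambda>i k. sqrt v * L i k)"
        by (rule affine_image_cong) (simp_all add: time_vec_def)
      also have "distr (std_normal_vec N) (sample_space N) \<dots> =
          density (sample_space N) (\<lambda>z. ennreal (mvn_density N (\<theta> \<cdot>\<^sub>v ?T) (v \<cdot>\<^sub>m ?\<Gamma>) z))"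
      proof (rule mvn_density_triangular)
        show "v \<cdot>\<^sub>m ?\<Gamma> = mat N N (\<lambda>(i, j). \<Sum>k<N. (sqrt v * L i k) * (sqrt v * L j k))"
          unfolding scale by (intro eq_matI) (auto simp: Gamma_mat_def LL)
      qed (use L v T in auto)
      finally show ?thesis by (simp add: Z_density_def)
    qed
    fix z
    have x: "\<theta> \<cdot>\<^sub>v ?T \<in> carrier_vec N" using T by simp
    have Kx: "K *\<^sub>v (vec N z - \<theta> \<cdot>\<^sub>v ?T) = K *\<^sub>v vec N z - (\<theta> * c) \<cdot>\<^sub>v unit_vec N 0"
      using mult_minus_distrib_mat_vec[OF K z x] mult_mat_vec[OF K T] KT
      by (simp add: smult_smult_assoc)
    have "(K *\<^sub>v (vec N z - \<theta> \<cdot>\<^sub>v ?T)) \<bullet> (K *\<^sub>v (vec N z - \<theta> \<cdot>\<^sub>v ?T)) =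
        (\<Sum>k<N. (y k z)\<^sup>2) - 2 * \<theta> * c * y 0 z + \<theta>\<^sup>2 * c\<^sup>2"
    proof -
      have "(K *\<^sub>v (vec N z - \<theta> \<cdot>\<^sub>v ?T)) \<bullet> (K *\<^sub>v (vec N z - \<theta> \<cdot>\<^sub>v ?T)) =
          (\<Sum>k<N. (y k z - (if k = 0 then \<theta> * c else 0))\<^sup>2)"
        unfolding Kx using K
        by (auto simp: scalar_prod_def y_def lessThan_atLeast0 power2_eq_square unit_vec_def intro!: sum.cong)
      also have "\<dots> = (\<Sum>k<N. (y k z)\<^sup>2 + (if k = 0 then \<theta>\<^sup>2 * c\<^sup>2 - 2 * \<theta> * c * y 0 z else 0))"
        by (intro sum.cong refl) (simp add: power2_diff power_mult_distrib)
      also have "\<dots> = (\<Sum>k<N. (y k z)\<^sup>2) - 2 * \<theta> * c * y 0 z + \<theta>\<^sup>2 * c\<^sup>2"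
        using N0 by (simp add: sum.distrib)
      finally show ?thesis .
    qed
    then show "Z_density H m h N (par \<theta> v) z =
      exp (- ((\<Sum>k<N. (y k z)\<^sup>2) - 2 * \<theta> * c * y 0 z + \<theta>\<^sup>2 * c\<^sup>2) / (2 * v)) / sqrt ((2 * pi) ^ N * (v ^ N * (det A)\<^sup>2))"
      unfolding Z_density_def par_simps \<Gamma>A mvn_density_gram[OF A K AK KA v x] by simp
  next
    fix \<theta> v :: real and w :: "nat \<Rightarrow> real" and k assume k: "k < N"
    have "vec N (img \<theta> v w) = \<theta> \<cdot>\<^sub>v ?T + sqrt v \<cdot>\<^sub>v (A *\<^sub>v vec N w)"
      using A by (intro eq_vecI)
        (auto simp: img_def affine_image_def time_vec_def scalar_prod_def lessThan_atLeast0 sum_distrib_left mult.assoc)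
    moreover have Aw: "A *\<^sub>v vec N w \<in> carrier_vec N" using A by simp
    ultimately have "K *\<^sub>v vec N (img \<theta> v w) = \<theta> \<cdot>\<^sub>v (K *\<^sub>v ?T) + sqrt v \<cdot>\<^sub>v (K *\<^sub>v (A *\<^sub>v vec N w))"
      using mult_add_distrib_mat_vec[OF K, of "\<theta> \<cdot>\<^sub>v ?T" "sqrt v \<cdot>\<^sub>v (A *\<^sub>v vec N w)"] T
        mult_mat_vec[OF K T] mult_mat_vec[OF K Aw] by simp
    also have "K *\<^sub>v (A *\<^sub>v vec N w) = vec N w"
      using assoc_mult_mat_vec[OF K A z[of w]] KA by simp
    finally show "y k (img \<theta> v w) = (if k = 0 then \<theta> * c else 0) + sqrt v * w k"
      unfolding y_def KT using k by simp
  next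
    fix k assume k: "k < N"
    have "y k = (\<lambda>z. \<Sum>j<N. K $$ (k, j) * z j)"
      using K k by (auto simp: fun_eq_iff y_def scalar_prod_def lessThan_atLeast0)
    moreover have "(\<lambda>z. \<Sum>j<N. K $$ (k, j) * z j) \<in> borel_measurable (sample_space N)"
      unfolding sample_space_def by measurable
    ultimately show "y k \<in> borel_measurable (sample_space N)" by simp
  next
    fix \<theta> v :: real
    show "img \<theta> v \<in> measurable (std_normal_vec N) (sample_space N)"
      unfolding img_def by (rule measurable_affine_image[OF sets_std_normal_vec])
  qed (use N0 c D in auto)
  from that[OF this d theta alpha] show ?thesis .
qed

theorem proposition3p10:
  fixes M :: "'w measure" and B :: "nat \<Rightarrow> real \<Rightarrow> 'w \<Rightarrow> real"
    and H :: "nat \<Rightarrow> real" and h \<theta> \<alpha> :: real and m :: nat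
  assumes "prob_space M"
    and "h > 0" and "m \<ge> 1"
    and "\<And>r. r \<in> {1..m} \<Longrightarrow> 1/2 < H r \<and> H r < 1"
    and "\<And>r. r \<in> {1..m} \<Longrightarrow> fractional_brownian_motion M (H r) (B r)"
    and "independent_processes M {1..m} B"
    and "\<alpha> > 0"
  shows
    "(\<forall>N\<ge>1.
        (\<forall>\<psi>\<in>params. Z_law M B m h N \<psi> =
           density (sample_space N) (\<lambda>z. ennreal (Z_density H m h N \<psi> z))) \<and>
        d_coeff H m h N > 0 \<and>
        fisher_information_exists (Z_law M B m h N) (Z_density H m h N) (vec_of_list [\<theta>, \<alpha>\<^sup>2]) \<and>
        fisher_information (Z_law M B m h N) (Z_density H m h N) (vec_of_list [\<theta>, \<alpha>\<^sup>2]) =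
          mat_of_rows_list 2
            [[d_coeff H m h N / \<alpha>\<^sup>2, 0],
             [0, real N / (2 * \<alpha>^4)]] \<and>
        fisher_information (Z_law M B m h N) (Z_density H m h N) (vec_of_list [\<theta>, \<alpha>\<^sup>2]) $$ (0, 1) = 0 \<and>
        finite_variance (Z_law M B m h N (vec_of_list [\<theta>, \<alpha>\<^sup>2])) (theta_hat H m h N) \<and>
        prob_space.variance (Z_law M B m h N (vec_of_list [\<theta>, \<alpha>\<^sup>2])) (theta_hat H m h N) =
          \<alpha>\<^sup>2 / d_coeff H m h N) \<and>
     (\<forall>N\<ge>2.
        attains_cramer_rao_at params (Z_law M B m h N) (Z_density H m h N) 0
          (theta_hat H m h N) (vec_of_list [\<theta>, \<alpha>\<^sup>2]) \<and>
        cramer_rao_bound (Z_law M B m h N) (Z_density H m h N) (vec_of_list [\<theta>, \<alpha>\<^sup>2]) 1 =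
          2 * \<alpha>^4 / real N \<and>
        \<not> (\<exists>S. attains_cramer_rao_at params (Z_law M B m h N) (Z_density H m h N) 1
               S (vec_of_list [\<theta>, \<alpha>\<^sup>2])) \<and>
        umvu_estimator params (Z_law M B m h N) (\<lambda>\<psi>. vec_index \<psi> 1) (alpha2_tilde H m h N) \<and>
        prob_space.variance (Z_law M B m h N (vec_of_list [\<theta>, \<alpha>\<^sup>2])) (alpha2_tilde H m h N) =
          real N / (real N - 1) *
          cramer_rao_bound (Z_law M B m h N) (Z_density H m h N) (vec_of_list [\<theta>, \<alpha>\<^sup>2]) 1) \<and>
     (\<lambda>N. real N / (real N - 1)) \<longlonglongrightarrow> 1"
  proof -
  have v: "0 < \<alpha>\<^sup>2" using assms(7) by simp
  have \<alpha>4: "\<alpha> ^ 4 = (\<alpha>\<^sup>2)\<^sup>2" by simp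
  note model = Z_law_canonical[where H=H, OF assms(1-6)]
  show ?thesis (is "(\<forall>N\<ge>1. ?A N) \<and> (\<forall>N\<ge>2. ?C N) \<and> ?L")
  proof (intro conjI allI impI)
    fix N :: nat assume "1 \<le> N"
    then obtain c D y img where
      "canonical_gaussian_model N c D (Z_law M B m h N) (Z_density H m h N) y img"
      and d: "d_coeff H m h N = c\<^sup>2" and \<theta>_hat: "\<And>z. theta_hat H m h N z = y 0 z / c"
      using model by metis
    then interpret canonical_gaussian_model N c D "Z_law M B m h N" "Z_density H m h N" y img
      by simp
    have est: "theta_hat H m h N = theta_est"
      by (simp add: fun_eq_iff \<theta>_hat theta_est_def)
    note psi = par_def[symmetric]
    show "d_coeff H m h N > 0"
      unfolding d using c by simp
    show "fisher_information_exists (Z_law M B m h N) (Z_density H m h N) (vec_of_list [\<theta>, \<alpha>\<^sup>2])"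
      unfolding psi by (rule fisher_information_exists[OF v])
    show fi: "fisher_information (Z_law M B m h N) (Z_density H m h N) (vec_of_list [\<theta>, \<alpha>\<^sup>2]) =
        mat_of_rows_list 2 [[d_coeff H m h N / \<alpha>\<^sup>2, 0], [0, real N / (2 * \<alpha> ^ 4)]]"
      unfolding psi d \<alpha>4 by (rule fisher_information_eq[OF v])
    show "fisher_information (Z_law M B m h N) (Z_density H m h N) (vec_of_list [\<theta>, \<alpha>\<^sup>2]) $$ (0, 1) = 0"
      unfolding fi by (simp add: mat_of_rows_list_def)
    show "finite_variance (Z_law M B m h N (vec_of_list [\<theta>, \<alpha>\<^sup>2])) (theta_hat H m h N)"
      unfolding psi est by (rule theta_est_attains(1)[OF v])
    show "prob_space.variance (Z_law M B m h N (vec_of_list [\<theta>, \<alpha>\<^sup>2])) (theta_hat H m h N) = \<alpha>\<^sup>2 / d_coeff H m h N"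
      unfolding psi est d by (rule theta_est_attains(2)[OF v])
    show "\<forall>\<psi>\<in>params. Z_law M B m h N \<psi> =
        density (sample_space N) (\<lambda>z. ennreal (Z_density H m h N \<psi> z))"
      using P_density by (auto simp: params_iff)
  next
    fix N :: nat assume N2: "2 \<le> N"
    then have "1 \<le> N" by simp
    then obtain c D y img where
      "canonical_gaussian_model N c D (Z_law M B m h N) (Z_density H m h N) y img"
      and \<theta>_hat: "\<And>z. theta_hat H m h N z = y 0 z / c"
      and \<alpha>_hat: "\<And>z. alpha2_hat H m h N z = ((\<Sum>k<N. (y k z)\<^sup>2) - (y 0 z)\<^sup>2) / N"
      using model by metis
    then interpret canonical_gaussian_model N c D "Z_law M B m h N" "Z_density H m h N" y img
      by simp
    have est: "theta_hat H m h N = theta_est"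
      by (simp add: fun_eq_iff \<theta>_hat theta_est_def)
    \<comment> \<open>The factor \<open>N / (N - 1)\<close> replaces the divisor \<open>N\<close> by
      \<open>N - 1\<close>; N >= 2 keeps that divisor nonzero.\<close>
    have vest: "alpha2_tilde H m h N = var_est"
      using N2 by (simp add: fun_eq_iff alpha2_tilde_def \<alpha>_hat var_est_def Q_def)
    note psi = par_def[symmetric]
    show "attains_cramer_rao_at params (Z_law M B m h N) (Z_density H m h N) 0
        (theta_hat H m h N) (vec_of_list [\<theta>, \<alpha>\<^sup>2])"
      unfolding psi est by (rule theta_est_attains(3)[OF v])
    show crb: "cramer_rao_bound (Z_law M B m h N) (Z_density H m h N) (vec_of_list [\<theta>, \<alpha>\<^sup>2]) 1 = 2 * \<alpha> ^ 4 / real N"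
      unfolding psi \<alpha>4 by (rule cramer_rao_bounds(2)[OF v])
    show "\<not> (\<exists>S. attains_cramer_rao_at params (Z_law M B m h N) (Z_density H m h N) 1
        S (vec_of_list [\<theta>, \<alpha>\<^sup>2]))"
      unfolding psi using no_estimator_attains[OF N2 v] by blast
    show "umvu_estimator params (Z_law M B m h N) (\<lambda>\<psi>. vec_index \<psi> 1) (alpha2_tilde H m h N)"
      unfolding vest by (rule var_est_umvu[OF N2])
    show "prob_space.variance (Z_law M B m h N (vec_of_list [\<theta>, \<alpha>\<^sup>2])) (alpha2_tilde H m h N) =
        real N / (real N - 1) *
        cramer_rao_bound (Z_law M B m h N) (Z_density H m h N) (vec_of_list [\<theta>, \<alpha>\<^sup>2]) 1"
      unfolding crb unfolding psi vest var_est_variance[OF v N2] \<alpha>4 using N2 by simp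
  next
    show ?L by real_asymp
  qed
qed


end
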